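(* Let $d$ denote the maximum vector space dimension in a quiver representation of type $A_{n+1}$ over a field $\mathbb F$ (finite-dimensional spaces $V_0,\dots,V_n$, $n$ edges of arbitrary directions). When the divide and conquer algorithm described in the context is used recursively, it computes the barcode form in $$O\big((d\log d)\,n+d^3\log n\big)$$ time when the recursion is run in parallel with an unlimited number of parallel processes available.
   Context: Setting. Type $A_{n+1}$: the underlying graph is a line with vertices $0,\dots,n$. Edge $i$ ($0\le i\le n-1$) joins $V_i$ and $V_{i+1}$ and carries a matrix $A_i$; it has direction $\leftarrow$ if $A_i:V_{i+1}\to V_i$ and $\rightarrow$ if $A_i:V_i\to V_{i+1}$. Representations of the same directed graph are isomorphic if they differ by invertible changes of basis at the vertices. A pivot matrix has at most one non-zero entry in each row and each column, the non-zero entries being $1$. Computing the barcode form means finding an isomorphic representation all of whose edge matrices are pivot matrices (equivalently, whose companion matrix, i.e. the block matrix on $\bigoplus_iV_i$ with the edge matrices as non-zero blocks, is $PTP^T$ with $T$ a direct sum of companion matrices of interval representations and $P$ a permutation respecting the vertex blocks). Shapes. $E_L$: $E=\sum_{(i,j)\in S}e_ie_j^T$ is a pivot matrix such that, writing $(i(j),j)$ for elements of $S$, $j_1<j_2$ implies $i(j_1)<i(j_2)$, and every column to the right of a zero column is zero. With $J$ the anti-diagonal permutation matrix: $E_U=(E_L)^T$; $\hat E_L=JE_UJ$; $\hat E_U=JE_LJ$. $L$, $U$, $P$ denote invertible lower triangular, invertible upper triangular, permutation matrices; $Q$ a pivot matrix. Every matrix can be factored in each of the forms $LE_LUP$, $PLE_UU$,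 $U\hat E_ULP$, $PU\hat E_LL$, $LQU$, $UQL$; every pivot matrix in the forms $E_LP$, $PE_U$, $\hat E_UP$, $P\hat E_L$; and products can be rewritten (commuted) as $E_LL=\tilde LE_L$, $L\hat E_L=\hat E_L\tilde L$, $UE_U=E_U\tilde U$, $\hat E_UU=\tilde U\hat E_U$. "Passing" a factor through a vertex means performing the change of basis at that vertex that removes the factor from one incident edge matrix and multiplies the other incident edge matrix by it or its inverse. Rightward form: edges $\leftarrow$ carry $E_L$ shapes and edges $\rightarrow$ carry $\hat E_L$ shapes, up to leftover triangular/permutation factors at the two end vertices; leftward form: edges $\leftarrow$ carry $E_U$ shapes and edges $\rightarrow$ carry $\hat E_U$ shapes, up to such leftover factors. For one edge, these are obtained by the factorizations $LE_LUP$, $PU\hat E_LL$ (rightward) and $PLE_UU$, $U\hat E_ULP$ (leftward). Divide and conquer algorithm (output in rightward or leftward form, as requested): (1) choose the middle edge $m=\lfloor n/2\rfloor$; (2) recursively put the edges $A_0,\dots,A_{m-1}$ in rightward form and the edges $A_{m+1},\dots,A_{n-1}$ in leftward form (these two recursive calls are run in parallel); (3) pass the leftover factors at $V_m$ and $V_{m+1}$ to edge $m$, obtaining $\tilde A_m$; (4) factor $\tilde A_m=L_mQ_mU_m$ if edge $m$ is $\leftarrow$, and $\tilde A_m=U_mQ_mL_m$ if it is $\rightarrow$; (5) pass and commute $L_m$ to the left through edges $m-1,\dots,0$ and $U_m$ to the right through edges $m+1,\dots,n-1$, leaving triangular factors only at the end vertices; (6) for rightward form, starting from edge $m$ and moving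 right, factor the pivot matrix on each edge as $E_LP$ (if $\leftarrow$) or $P\hat E_L$ (if $\rightarrow$) and pass $P$ rightward; for leftward form, starting from edge $m$ and moving left, factor as $PE_U$ (if $\leftarrow$) or $\hat E_UP$ (if $\rightarrow$) and pass $P$ leftward. At the top level, the leftover factors at $V_0$ and $V_n$ are removed by changes of basis there. Permutation and pivot matrices are stored in sparse format. Time is parallel time, counted with unit cost for operations in $\mathbb F$ and elementary index operations, the algorithm being suitably implemented. *)

theory Defs
  imports
    Complex_Main
    "HOL-Library.Monad_Syntax"
    "Jordan_Normal_Form.Matrix"
begin

section \<open>Representations of type \<open>A\<^bsub>n+1\<^esub>\<close> and their barcode form\<close>

text \<open>
  The vertices are \<open>0, \<dots>, n\<close>, the space at vertex \<open>i\<close> is \<open>F\<^bsup>dims i\<^esup>\<close>, and edge \<open>i < n\<close> joins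
  the vertices \<open>i\<close> and \<open>i + 1\<close>. \<open>LArr\<close> is the direction from \<open>i + 1\<close> to \<open>i\<close>, and \<open>RArr\<close> is the
  direction from \<open>i\<close> to \<open>i + 1\<close>.
\<close>

datatype arrow = LArr | RArr

definition is_rep :: "nat \<Rightarrow> (nat \<Rightarrow> arrow) \<Rightarrow> (nat \<Rightarrow> nat) \<Rightarrow> (nat \<Rightarrow> 'a mat) \<Rightarrow> bool" where
  "is_rep n dir dims A \<longleftrightarrow>
     (\<forall>i<n. A i \<in> (case dir i of
                      LArr \<Rightarrow> carrier_mat (dims i) (dims (i + 1))
                    | RArr \<Rightarrow> carrier_mat (dims (i + 1)) (dims i)))"

definition isomorphic_reps ::
  "nat \<Rightarrow> (nat \<Rightarrow> arrow) \<Rightarrow> (nat \<Rightarrow> nat) \<Rightarrow> (nat \<Rightarrow> 'a::field mat) \<Rightarrow> (nat \<Rightarrow> 'a mat) \<Rightarrow> bool" where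
  "isomorphic_reps n dir dims A B \<longleftrightarrow>
     (\<exists>g. (\<forall>i\<le>n. g i \<in> carrier_mat (dims i) (dims i) \<and> invertible_mat (g i)) \<and>
          (\<forall>i<n. case dir i of
                    LArr \<Rightarrow> B i * g (i + 1) = g i * A i
                  | RArr \<Rightarrow> B i * g i = g (i + 1) * A i))"

definition pivot_matrix :: "'a::field mat \<Rightarrow> bool" where
  "pivot_matrix M \<longleftrightarrow>
     (\<forall>i<dim_row M. \<forall>j<dim_col M. M $$ (i, j) \<noteq> 0 \<longrightarrow> M $$ (i, j) = 1) \<and>
     (\<forall>i<dim_row M. \<forall>j<dim_col M. \<forall>j'<dim_col M.
         M $$ (i, j) \<noteq> 0 \<and> M $$ (i, j') \<noteq> 0 \<longrightarrow> j = j') \<and>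
     (\<forall>i<dim_row M. \<forall>i'<dim_row M. \<forall>j<dim_col M.
         M $$ (i, j) \<noteq> 0 \<and> M $$ (i', j) \<noteq> 0 \<longrightarrow> i = i')"

definition is_barcode_form ::
  "nat \<Rightarrow> (nat \<Rightarrow> arrow) \<Rightarrow> (nat \<Rightarrow> nat) \<Rightarrow> (nat \<Rightarrow> 'a::field mat) \<Rightarrow> (nat \<Rightarrow> 'a mat) \<Rightarrow> bool" where
  "is_barcode_form n dir dims A B \<longleftrightarrow>
     is_rep n dir dims B \<and> isomorphic_reps n dir dims A B \<and> (\<forall>i<n. pivot_matrix (B i))"


section \<open>Cost model\<close>

text \<open>
  \<open>TM x t\<close> is a computation with result \<open>x\<close> and parallel running time \<open>t\<close>. A program is put
  together with the combinators of this section only. Pure terms inside a program merely build and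
  take apart tuples and options, branch on the result of a charged test, name constants, and
  mention the stored size of an array; every
  operation on field elements or indices, every memory access, every iteration of a loop and every
  step through a list is charged. Only \<open>par\<close> runs anything in parallel.
\<close>

datatype 'a tm = TM (val: 'a) (time: nat)

fun bind_tm :: "'a tm \<Rightarrow> ('a \<Rightarrow> 'b tm) \<Rightarrow> 'b tm" where
  "bind_tm (TM x s) f = (case f x of TM y t \<Rightarrow> TM y (s + t))"

adhoc_overloading Monad_Syntax.bind \<rightleftharpoons> bind_tm

lemma bind_tm_cong [fundef_cong]:
  assumes "p = q" and "\<And>x. x = val q \<Longrightarrow> f x = g x"
  shows "bind_tm p f = bind_tm q g"
  using assms by (cases q) simp

definition ret :: "'a \<Rightarrow> 'a tm" where
  "ret x = TM x 0"

definition tick :: "'a \<Rightarrow> 'a tm" where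
  "tick x = TM x 1"

fun par :: "'a tm \<Rightarrow> 'b tm \<Rightarrow> ('a \<times> 'b) tm" where
  "par (TM x s) (TM y t) = TM (x, y) (1 + max s t)"

text \<open>\<open>loop k f s\<close> runs \<open>f 0\<close>, \<dots>, \<open>f (k - 1)\<close> one after the other on a state, initially \<open>s\<close>.\<close>

primrec loop :: "nat \<Rightarrow> (nat \<Rightarrow> 's \<Rightarrow> 's tm) \<Rightarrow> 's \<Rightarrow> 's tm" where
  "loop 0 f s = tick s"
| "loop (Suc k) f s = do { s' \<leftarrow> loop k f s; s'' \<leftarrow> f k s'; tick s'' }"

text \<open>Sequential construction of an array, entry after entry.\<close>

definition new_vec :: "nat \<Rightarrow> (nat \<Rightarrow> 'a tm) \<Rightarrow> 'a vec tm" where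
  "new_vec k f = TM (vec k (\<lambda>i. val (f i))) (1 + (\<Sum>i<k. 1 + time (f i)))"

definition new_mat :: "nat \<Rightarrow> nat \<Rightarrow> (nat \<Rightarrow> nat \<Rightarrow> 'a tm) \<Rightarrow> 'a mat tm" where
  "new_mat r c f =
     TM (mat r c (\<lambda>(i, j). val (f i j))) (1 + (\<Sum>i<r. 1 + (\<Sum>j<c. 1 + time (f i j))))"

definition get :: "'a vec \<Rightarrow> nat \<Rightarrow> 'a tm" where
  "get v i = tick (v $ i)"

text \<open>Arrays are only written to when the old version is no longer used.\<close>

definition put :: "'a vec \<Rightarrow> nat \<Rightarrow> 'a \<Rightarrow> 'a vec tm" where
  "put v i x = tick (v |\<^sub>v i \<mapsto> x)"

definition get_mat :: "'a mat \<Rightarrow> nat \<Rightarrow> nat \<Rightarrow> 'a tm" where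
  "get_mat M i j = tick (M $$ (i, j))"

definition get_input :: "(nat \<Rightarrow> 'b) \<Rightarrow> nat \<Rightarrow> 'b tm" where
  "get_input f i = tick (f i)"

definition add_tm :: "'a::plus \<Rightarrow> 'a \<Rightarrow> 'a tm" where "add_tm x y = tick (x + y)"
definition sub_tm :: "'a::minus \<Rightarrow> 'a \<Rightarrow> 'a tm" where "sub_tm x y = tick (x - y)"
definition mul_tm :: "'a::times \<Rightarrow> 'a \<Rightarrow> 'a tm" where "mul_tm x y = tick (x * y)"
definition div_tm :: "'a::inverse \<Rightarrow> 'a \<Rightarrow> 'a tm" where "div_tm x y = tick (x / y)"
definition half_tm :: "nat \<Rightarrow> nat tm" where "half_tm i = tick (i div 2)"
definition eq_tm :: "'a \<Rightarrow> 'a \<Rightarrow> bool tm" where "eq_tm x y = tick (x = y)"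

primrec append_tm :: "'a list \<Rightarrow> 'a list \<Rightarrow> 'a list tm" where
  "append_tm [] ys = tick ys"
| "append_tm (x # xs) ys = do { zs \<leftarrow> append_tm xs ys; tick (x # zs) }"


section \<open>Dense matrices\<close>

definition delta_tm :: "nat \<Rightarrow> nat \<Rightarrow> 'a::field tm" where
  "delta_tm i j = do { t \<leftarrow> eq_tm i j; ret (if t then 1 else 0) }"

definition id_mat_tm :: "nat \<Rightarrow> 'a::field mat tm" where
  "id_mat_tm k = new_mat k k delta_tm"

definition mul_mat_tm :: "'a::field mat \<Rightarrow> 'a mat \<Rightarrow> 'a mat tm" where
  "mul_mat_tm M N =
     new_mat (dim_row M) (dim_col N) (\<lambda>i j.
       loop (dim_col M) (\<lambda>k s. do {
         x \<leftarrow> get_mat M i k;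
         y \<leftarrow> get_mat N k j;
         z \<leftarrow> mul_tm x y;
         add_tm s z
       }) 0)"

text \<open>\<open>index_rev k i\<close> is \<open>k - 1 - i\<close>, so \<open>flip_mat_tm M\<close> is \<open>J M J\<close> with anti-diagonal \<open>J\<close>.\<close>

definition index_rev_tm :: "nat \<Rightarrow> nat \<Rightarrow> nat tm" where
  "index_rev_tm k i = do { l \<leftarrow> sub_tm k 1; sub_tm l i }"

definition flip_mat_tm :: "'a mat \<Rightarrow> 'a mat tm" where
  "flip_mat_tm M =
     new_mat (dim_row M) (dim_col M) (\<lambda>i j. do {
       i' \<leftarrow> index_rev_tm (dim_row M) i;
       j' \<leftarrow> index_rev_tm (dim_col M) j;
       get_mat M i' j'
     })"

text \<open>Inverse of an invertible lower triangular matrix, row by row, by forward substitution.\<close>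

definition lower_inverse_tm :: "'a::field mat \<Rightarrow> 'a mat tm" where
  "lower_inverse_tm L = do {
     V \<leftarrow> id_mat_tm (dim_row L);
     loop (dim_row L) (\<lambda>i V.
       new_mat (dim_row L) (dim_row L) (\<lambda>a b. do {
         t \<leftarrow> eq_tm a i;
         if t then do {
           s \<leftarrow> loop i (\<lambda>k s. do {
             x \<leftarrow> get_mat L i k;
             y \<leftarrow> get_mat V k b;
             z \<leftarrow> mul_tm x y;
             add_tm s z
           }) 0;
           e \<leftarrow> delta_tm i b;
           x \<leftarrow> sub_tm e s;
           y \<leftarrow> get_mat L i i;
           div_tm x y
         } else get_mat V a b
       })) V
   }"

definition upper_inverse_tm :: "'a::field mat \<Rightarrow> 'a mat tm" where
  "upper_inverse_tm U = do { L \<leftarrow> flip_mat_tm U; V \<leftarrow> lower_inverse_tm L; flip_mat_tm V }"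


section \<open>Sparse pivot matrices\<close>

text \<open>
  \<open>(r, q)\<close> stores the pivot matrix with \<open>r\<close> rows whose column \<open>j\<close> is zero if \<open>q $ j = None\<close> and is
  the unit vector \<open>e\<^sub>i\<close> if \<open>q $ j = Some i\<close>. Permutation matrices are stored in the same way.
\<close>

type_synonym sparse = "nat \<times> nat option vec"

definition mat_of_sparse :: "sparse \<Rightarrow> 'a::field mat" where
  "mat_of_sparse = (\<lambda>(r, q). mat r (dim_vec q) (\<lambda>(i, j). if q $ j = Some i then 1 else 0))"

definition id_sparse_tm :: "nat \<Rightarrow> sparse tm" where
  "id_sparse_tm k = do { q \<leftarrow> new_vec k (\<lambda>j. ret (Some j)); ret (k, q) }"

definition transpose_sparse_tm :: "sparse \<Rightarrow> sparse tm" where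
  "transpose_sparse_tm = (\<lambda>(r, q). do {
     v \<leftarrow> new_vec r (\<lambda>i. ret None);
     v \<leftarrow> loop (dim_vec q) (\<lambda>j v. do {
       x \<leftarrow> get q j;
       case x of None \<Rightarrow> ret v | Some i \<Rightarrow> put v i (Some j)
     }) v;
     ret (dim_vec q, v)
   })"

definition flip_sparse_tm :: "sparse \<Rightarrow> sparse tm" where
  "flip_sparse_tm = (\<lambda>(r, q). do {
     v \<leftarrow> new_vec (dim_vec q) (\<lambda>j. do {
       j' \<leftarrow> index_rev_tm (dim_vec q) j;
       x \<leftarrow> get q j';
       case x of None \<Rightarrow> ret None | Some i \<Rightarrow> do { i' \<leftarrow> index_rev_tm r i; ret (Some i') }
     });
     ret (r, v)
   })"

definition mul_sparse_tm :: "sparse \<Rightarrow> sparse \<Rightarrow> sparse tm" where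
  "mul_sparse_tm = (\<lambda>(r, p) (s, q). do {
     v \<leftarrow> new_vec (dim_vec q) (\<lambda>j. do {
       x \<leftarrow> get q j;
       case x of None \<Rightarrow> ret None | Some k \<Rightarrow> get p k
     });
     ret (r, v)
   })"

text \<open>Products of a dense matrix with a sparse permutation matrix: \<open>X P\<close> and \<open>P\<^sup>T X\<close>.\<close>

definition mul_perm_tm :: "'a::field mat \<Rightarrow> sparse \<Rightarrow> 'a mat tm" where
  "mul_perm_tm X = (\<lambda>(r, p).
     new_mat (dim_row X) (dim_vec p) (\<lambda>a b. do {
       x \<leftarrow> get p b;
       case x of None \<Rightarrow> ret 0 | Some k \<Rightarrow> get_mat X a k
     }))"

definition perm_transpose_mul_tm :: "sparse \<Rightarrow> 'a::field mat \<Rightarrow> 'a mat tm" where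
  "perm_transpose_mul_tm = (\<lambda>(r, p) X.
     new_mat (dim_vec p) (dim_col X) (\<lambda>a b. do {
       x \<leftarrow> get p a;
       case x of None \<Rightarrow> ret 0 | Some k \<Rightarrow> get_mat X k b
     }))"


section \<open>Factorizations\<close>

text \<open>
  The factorization \<open>E\<^sub>L P\<close> of a pivot matrix \<open>Q\<close>. The non-zero columns of \<open>Q\<close>, sorted by their rows,
  become the first columns of \<open>E\<^sub>L\<close>; the zero columns follow in their old order. Scanning the rows
  of \<open>Q\<close> with the help of \<open>Q\<^sup>T\<close> does the sorting.
\<close>

definition factor_EL_P_tm :: "sparse \<Rightarrow> (sparse \<times> sparse) tm" where
  "factor_EL_P_tm = (\<lambda>(r, q). do {
     (s, t) \<leftarrow> transpose_sparse_tm (r, q);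
     e \<leftarrow> new_vec (dim_vec q) (\<lambda>j. ret None);
     p \<leftarrow> new_vec (dim_vec q) (\<lambda>j. ret None);
     (k, e, p) \<leftarrow> loop r (\<lambda>i (k, e, p). do {
       x \<leftarrow> get t i;
       case x of
         None \<Rightarrow> ret (k, e, p)
       | Some j \<Rightarrow> do {
           e' \<leftarrow> put e k (Some i);
           p' \<leftarrow> put p j (Some k);
           k' \<leftarrow> add_tm k 1;
           ret (k', e', p')
         }
     }) (0, e, p);
     (k, p) \<leftarrow> loop (dim_vec q) (\<lambda>j (k, p). do {
       x \<leftarrow> get q j;
       case x of
         Some i \<Rightarrow> ret (k, p)
       | None \<Rightarrow> do {
           p' \<leftarrow> put p j (Some k);
           k' \<leftarrow> add_tm k 1;
           ret (k', p')
         }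
     }) (k, p);
     ret ((r, e), (dim_vec q, p))
   })"

text \<open>
  The other three shapes are \<open>E\<^sub>U = E\<^sub>L\<^sup>T\<close>, \<open>hat E\<^sub>L = J E\<^sub>U J\<close> and \<open>hat E\<^sub>U = J E\<^sub>L J\<close>, and their
  factorizations are obtained by transposing and flipping. In the names, \<open>HL\<close> and \<open>HU\<close> stand for
  the shapes with a hat.
\<close>

definition factor_P_EU_tm :: "sparse \<Rightarrow> (sparse \<times> sparse) tm" where
  "factor_P_EU_tm Q = do {
     Q' \<leftarrow> transpose_sparse_tm Q;
     (E', P') \<leftarrow> factor_EL_P_tm Q';
     P \<leftarrow> transpose_sparse_tm P';
     E \<leftarrow> transpose_sparse_tm E';
     ret (P, E)
   }"

definition factor_P_HL_tm :: "sparse \<Rightarrow> (sparse \<times> sparse) tm" where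
  "factor_P_HL_tm Q = do {
     Q' \<leftarrow> flip_sparse_tm Q;
     (P', E') \<leftarrow> factor_P_EU_tm Q';
     P \<leftarrow> flip_sparse_tm P';
     E \<leftarrow> flip_sparse_tm E';
     ret (P, E)
   }"

definition factor_HU_P_tm :: "sparse \<Rightarrow> (sparse \<times> sparse) tm" where
  "factor_HU_P_tm Q = do {
     Q' \<leftarrow> flip_sparse_tm Q;
     (E', P') \<leftarrow> factor_EL_P_tm Q';
     E \<leftarrow> flip_sparse_tm E';
     P \<leftarrow> flip_sparse_tm P';
     ret (E, P)
   }"

text \<open>Row index of the topmost non-zero entry of column \<open>j\<close>.\<close>

definition topmost_tm :: "'a::field mat \<Rightarrow> nat \<Rightarrow> nat option tm" where
  "topmost_tm R j =
     loop (dim_row R) (\<lambda>i x.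
       case x of
         Some k \<Rightarrow> ret x
       | None \<Rightarrow> do {
           y \<leftarrow> get_mat R i j;
           z \<leftarrow> eq_tm y 0;
           ret (if z then None else Some i)
         }) None"

text \<open>
  Gaussian elimination for \<open>M = L Q U\<close>. If the residual matrix \<open>R\<close>, initially \<open>M\<close>, has its topmost
  non-zero entry of column \<open>j\<close> in row \<open>i\<close>, with value \<open>x\<close>, then \<open>R e\<^sub>j\<close> becomes column \<open>i\<close> of \<open>L\<close>,
  \<open>e\<^sub>i\<^sup>T R / x\<close> becomes row \<open>j\<close> of \<open>U\<close>, \<open>e\<^sub>i e\<^sub>j\<^sup>T\<close> is added to \<open>Q\<close>, and the rank-one matrix
  \<open>(R e\<^sub>j) (e\<^sub>i\<^sup>T R) / x\<close> is subtracted from \<open>R\<close>. The residual matrix is zero in the end.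
\<close>

definition factor_LQU_tm :: "'a::field mat \<Rightarrow> ('a mat \<times> sparse \<times> 'a mat) tm" where
  "factor_LQU_tm M = do {
     L \<leftarrow> id_mat_tm (dim_row M);
     U \<leftarrow> id_mat_tm (dim_col M);
     q \<leftarrow> new_vec (dim_col M) (\<lambda>j. ret None);
     (R, L, U, q) \<leftarrow> loop (dim_col M) (\<lambda>j (R, L, U, q). do {
       pos \<leftarrow> topmost_tm R j;
       case pos of
         None \<Rightarrow> ret (R, L, U, q)
       | Some i \<Rightarrow> do {
           x \<leftarrow> get_mat R i j;
           L' \<leftarrow> new_mat (dim_row M) (dim_row M) (\<lambda>a b. do {
             t \<leftarrow> eq_tm b i;
             if t then get_mat R a j else get_mat L a b
           });
           U' \<leftarrow> new_mat (dim_col M) (dim_col M) (\<lambda>a b. do {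
             t \<leftarrow> eq_tm a j;
             if t then do { y \<leftarrow> get_mat R i b; div_tm y x } else get_mat U a b
           });
           R' \<leftarrow> new_mat (dim_row M) (dim_col M) (\<lambda>a b. do {
             u \<leftarrow> get_mat R a j;
             v \<leftarrow> get_mat R i b;
             w \<leftarrow> mul_tm u v;
             w' \<leftarrow> div_tm w x;
             y \<leftarrow> get_mat R a b;
             sub_tm y w'
           });
           q' \<leftarrow> put q j (Some i);
           ret (R', L', U', q')
         }
     }) (M, L, U, q);
     ret (L, (dim_row M, q), U)
   }"

definition factor_UQL_tm :: "'a::field mat \<Rightarrow> ('a mat \<times> sparse \<times> 'a mat) tm" where
  "factor_UQL_tm M = do {
     M' \<leftarrow> flip_mat_tm M;
     (L', Q', U') \<leftarrow> factor_LQU_tm M';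
     U \<leftarrow> flip_mat_tm L';
     Q \<leftarrow> flip_sparse_tm Q';
     L \<leftarrow> flip_mat_tm U';
     ret (U, Q, L)
   }"


section \<open>Passing factors through vertices\<close>

text \<open>
  A leftover factor at a vertex is stored as a pair \<open>(X, X\<^sup>-\<^sup>1)\<close>, where \<open>X\<close> turns new coordinates at
  that vertex into old ones: with factors \<open>X\<^sub>i\<close>, the old matrix of edge \<open>i\<close> is
  \<open>X\<^sub>i B X\<^bsub>i+1\<^esub>\<^sup>-\<^sup>1\<close> if the edge is \<open>LArr\<close>, and \<open>X\<^bsub>i+1\<^esub> B X\<^sub>i\<^sup>-\<^sup>1\<close> if it is \<open>RArr\<close>,
  where \<open>B\<close> is its new matrix.
\<close>

type_synonym 'a factor = "'a mat \<times> 'a mat"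

definition mul_factor_tm :: "'a::field factor \<Rightarrow> 'a factor \<Rightarrow> 'a factor tm" where
  "mul_factor_tm = (\<lambda>(X, X') (Y, Y'). do {
     Z \<leftarrow> mul_mat_tm X Y;
     Z' \<leftarrow> mul_mat_tm Y' X';
     ret (Z, Z')
   })"

definition mul_factor_perm_tm :: "'a::field factor \<Rightarrow> sparse \<Rightarrow> 'a factor tm" where
  "mul_factor_perm_tm = (\<lambda>(X, X') P. do {
     Z \<leftarrow> mul_perm_tm X P;
     Z' \<leftarrow> perm_transpose_mul_tm P X';
     ret (Z, Z')
   })"

type_synonym edge = "arrow \<times> sparse"

text \<open>
  Commuting a triangular \<open>X\<close> past a shape, as in \<open>E\<^sub>L X = X' E\<^sub>L\<close>, only moves entries: \<open>X'\<close> is the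
  identity except that its entry \<open>(a, b)\<close> is the entry \<open>(\<sigma> a, \<sigma> b)\<close> of \<open>X\<close> whenever \<open>\<sigma> a\<close> and
  \<open>\<sigma> b\<close> are defined, where \<open>\<sigma>\<close> is the partial index map given by the shape or its transpose. So a
  factor on its way through several edges is represented by the factor at the start and the composed
  index map, itself stored as a sparse pivot matrix; \<open>lift_tm\<close> writes out the entries on arrival.
\<close>

primrec pass_left_tm :: "edge list \<Rightarrow> sparse \<Rightarrow> sparse tm" where
  "pass_left_tm [] S = tick S"
| "pass_left_tm (e # es) S = do {
     S' \<leftarrow> pass_left_tm es S;
     S'' \<leftarrow> (case e of
       (LArr, E) \<Rightarrow> do { E' \<leftarrow> transpose_sparse_tm E; mul_sparse_tm S' E' }
     | (RArr, E) \<Rightarrow> mul_sparse_tm S' E);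
     tick S''
   }"

primrec pass_right_tm :: "edge list \<Rightarrow> sparse \<Rightarrow> sparse tm" where
  "pass_right_tm [] S = tick S"
| "pass_right_tm (e # es) S = do {
     S' \<leftarrow> (case e of
       (LArr, E) \<Rightarrow> mul_sparse_tm S E
     | (RArr, E) \<Rightarrow> do { E' \<leftarrow> transpose_sparse_tm E; mul_sparse_tm S E' });
     S'' \<leftarrow> pass_right_tm es S';
     tick S''
   }"

definition lift_tm :: "sparse \<Rightarrow> 'a::field mat \<Rightarrow> 'a mat tm" where
  "lift_tm = (\<lambda>(r, s) X.
     new_mat (dim_vec s) (dim_vec s) (\<lambda>a b. do {
       x \<leftarrow> get s a;
       y \<leftarrow> get s b;
       case (x, y) of (Some i, Some j) \<Rightarrow> get_mat X i j | _ \<Rightarrow> delta_tm a b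
     }))"

definition lift_factor_tm :: "sparse \<Rightarrow> 'a::field factor \<Rightarrow> 'a factor tm" where
  "lift_factor_tm S = (\<lambda>(X, X'). do { Y \<leftarrow> lift_tm S X; Y' \<leftarrow> lift_tm S X'; ret (Y, Y') })"

text \<open>
  Passing permutations. The second argument is the permutation \<open>Y\<close> with leftover factor
  \<open>(Y, Y\<^sup>T)\<close> at the vertex where the sweep starts; the one at the vertex where it ends is returned.
\<close>

primrec sweep_right_tm :: "edge list \<Rightarrow> sparse \<Rightarrow> (edge list \<times> sparse) tm" where
  "sweep_right_tm [] Y = tick ([], Y)"
| "sweep_right_tm (e # es) Y = do {
     (e', Y') \<leftarrow> (case e of
       (LArr, Q) \<Rightarrow> do {
         T \<leftarrow> transpose_sparse_tm Y;
         Q' \<leftarrow> mul_sparse_tm T Q;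
         (E, P) \<leftarrow> factor_EL_P_tm Q';
         P' \<leftarrow> transpose_sparse_tm P;
         ret ((LArr, E), P')
       }
     | (RArr, Q) \<Rightarrow> do {
         Q' \<leftarrow> mul_sparse_tm Q Y;
         (P, E) \<leftarrow> factor_P_HL_tm Q';
         ret ((RArr, E), P)
       });
     (es', Y'') \<leftarrow> sweep_right_tm es Y';
     tick (e' # es', Y'')
   }"

primrec sweep_left_tm :: "edge list \<Rightarrow> sparse \<Rightarrow> (edge list \<times> sparse) tm" where
  "sweep_left_tm [] Y = tick ([], Y)"
| "sweep_left_tm (e # es) Y = do {
     (es', Y') \<leftarrow> sweep_left_tm es Y;
     (e', Y'') \<leftarrow> (case e of
       (LArr, Q) \<Rightarrow> do {
         Q' \<leftarrow> mul_sparse_tm Q Y';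
         (P, E) \<leftarrow> factor_P_EU_tm Q';
         ret ((LArr, E), P)
       }
     | (RArr, Q) \<Rightarrow> do {
         T \<leftarrow> transpose_sparse_tm Y';
         Q' \<leftarrow> mul_sparse_tm T Q;
         (E, P) \<leftarrow> factor_HU_P_tm Q';
         P' \<leftarrow> transpose_sparse_tm P;
         ret ((RArr, E), P')
       });
     tick (e' # es', Y'')
   }"


section \<open>The divide and conquer algorithm\<close>

text \<open>
  The middle edge: absorb the leftover factors \<open>X\<close> of its left and \<open>Y\<close> of its right vertex, and
  factor. The result is the pivot matrix and the new leftover factors at these two vertices, the
  first one lower and the second one upper triangular.
\<close>

definition middle_tm ::
  "arrow \<Rightarrow> 'a::field mat \<Rightarrow> 'a factor \<Rightarrow> 'a factor \<Rightarrow> (sparse \<times> 'a factor \<times> 'a factor) tm" where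
  "middle_tm a M = (\<lambda>(X, X') (Y, Y'). case a of
     LArr \<Rightarrow> do {
       M' \<leftarrow> mul_mat_tm X' M;
       M'' \<leftarrow> mul_mat_tm M' Y;
       (L, Q, U) \<leftarrow> factor_LQU_tm M'';
       L' \<leftarrow> lower_inverse_tm L;
       U' \<leftarrow> upper_inverse_tm U;
       ret (Q, (L, L'), (U', U))
     }
   | RArr \<Rightarrow> do {
       M' \<leftarrow> mul_mat_tm Y' M;
       M'' \<leftarrow> mul_mat_tm M' X;
       (U, Q, L) \<leftarrow> factor_UQL_tm M'';
       L' \<leftarrow> lower_inverse_tm L;
       U' \<leftarrow> upper_inverse_tm U;
       ret (Q, (L', L), (U, U'))
     })"

datatype form = Rightward | Leftward

text \<open>
  Combining the two halves at the middle edge \<open>m\<close>. The arguments \<open>(left, XL, XM)\<close> and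
  \<open>(right, YM, YR)\<close> are the edges of the two halves with the leftover factors at their end vertices.
\<close>

type_synonym 'a segment = "edge list \<times> 'a factor \<times> 'a factor"

definition conquer_tm ::
  "form \<Rightarrow> (nat \<Rightarrow> arrow) \<Rightarrow> (nat \<Rightarrow> nat) \<Rightarrow> (nat \<Rightarrow> 'a::field mat) \<Rightarrow> nat \<Rightarrow>
     'a segment \<Rightarrow> 'a segment \<Rightarrow> 'a segment tm" where
  "conquer_tm form dir dims A m = (\<lambda>(left, XL, XM) (right, YM, YR). do {
     a \<leftarrow> get_input dir m;
     M \<leftarrow> get_input A m;
     (Q, G, H) \<leftarrow> middle_tm a M XM YM;
     m' \<leftarrow> add_tm m 1;
     d \<leftarrow> get_input dims m;
     d' \<leftarrow> get_input dims m';
     I \<leftarrow> id_sparse_tm d;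
     I' \<leftarrow> id_sparse_tm d';
     S \<leftarrow> pass_left_tm left I;
     G' \<leftarrow> lift_factor_tm S G;
     XL' \<leftarrow> mul_factor_tm XL G';
     T \<leftarrow> pass_right_tm right I';
     H' \<leftarrow> lift_factor_tm T H;
     YR' \<leftarrow> mul_factor_tm YR H';
     case form of
       Rightward \<Rightarrow> do {
         (es, Y) \<leftarrow> sweep_right_tm ((a, Q) # right) I;
         YR'' \<leftarrow> mul_factor_perm_tm YR' Y;
         es' \<leftarrow> append_tm left es;
         ret (es', XL', YR'')
       }
     | Leftward \<Rightarrow> do {
         es \<leftarrow> append_tm left [(a, Q)];
         (es', Y) \<leftarrow> sweep_left_tm es I';
         XL'' \<leftarrow> mul_factor_perm_tm XL' Y;
         es'' \<leftarrow> append_tm es' right;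
         ret (es'', XL'', YR')
       }
   })"

text \<open>
  \<open>divide_conquer_tm form dir dims A lo k\<close> treats the \<open>k\<close> edges \<open>lo, \<dots>, lo + k - 1\<close>. It returns
  them in the requested form, together with the leftover factors at the vertices \<open>lo\<close> and \<open>lo + k\<close>.
\<close>

function divide_conquer_tm ::
  "form \<Rightarrow> (nat \<Rightarrow> arrow) \<Rightarrow> (nat \<Rightarrow> nat) \<Rightarrow> (nat \<Rightarrow> 'a::field mat) \<Rightarrow> nat \<Rightarrow> nat \<Rightarrow> 'a segment tm"
where
  "divide_conquer_tm form dir dims A lo k = do {
     t \<leftarrow> eq_tm k 0;
     if t then do {
       d \<leftarrow> get_input dims lo;
       I \<leftarrow> id_mat_tm d;
       ret ([], (I, I), (I, I))
     } else do {
       h \<leftarrow> half_tm k;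
       k' \<leftarrow> sub_tm k h;
       k'' \<leftarrow> sub_tm k' 1;
       m \<leftarrow> add_tm lo h;
       m' \<leftarrow> add_tm m 1;
       p \<leftarrow> par (divide_conquer_tm Rightward dir dims A lo h)
               (divide_conquer_tm Leftward dir dims A m' k'');
       conquer_tm form dir dims A m (fst p) (snd p)
     }
   }"
  by pat_completeness auto
termination
  by (relation "measure (\<lambda>(form, dir, dims, A, lo, k). k)")
    (auto simp: half_tm_def sub_tm_def add_tm_def eq_tm_def tick_def)

declare divide_conquer_tm.simps [simp del]

text \<open>
  Forgetting the leftover factors at the vertices \<open>0\<close> and \<open>n\<close> is the change of basis at the two end
  vertices that removes them.
\<close>

definition barcode_tm ::
  "form \<Rightarrow> nat \<Rightarrow> (nat \<Rightarrow> arrow) \<Rightarrow> (nat \<Rightarrow> nat) \<Rightarrow> (nat \<Rightarrow> 'a::field mat) \<Rightarrow> edge list tm" where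
  "barcode_tm form n dir dims A = do {
     (es, X, Y) \<leftarrow> divide_conquer_tm form dir dims A 0 n;
     ret es
   }"

definition rep_of_edges :: "edge list \<Rightarrow> nat \<Rightarrow> 'a::field mat" where
  "rep_of_edges es i = mat_of_sparse (snd (es ! i))"

end

theory Submission
  imports Defs "Jordan_Normal_Form.Determinant"
begin

text \<open>
  Every phase of the algorithm is a change of basis. The relation \<open>transforms\<close> records one: it
  holds between two lists of edges if invertible factors, one at each vertex, carry the first list
  to the second. Such changes of basis can be composed (\<open>transforms_trans\<close>) and glued at a common
  vertex (\<open>transforms_append\<close>), so the correctness of the combination step \<open>conquer\<close> reduces to one
  relation for the middle edge (\<open>middle\<close>), one for each triangular factor that is passed outwards
  (\<open>pass_left\<close>, \<open>pass_right\<close>), and one for the permutations that restore the requested form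
  (\<open>sweep_right\<close>, \<open>sweep_left\<close>). Edge matrices are stored as sparse pivot matrices throughout,
  so what is left at the end is a barcode form.

  The four shapes make it possible to pass triangular factors cheaply. Each shape is a strictly
  increasing partial index map whose domain or whose image is an initial or a final segment. For
  such a map \<open>\<sigma>\<close> and a triangular \<open>X\<close>, the entries of \<open>X\<close> that stand in the way of
  \<open>X \<sigma> = \<sigma> X'\<close> connect the segment with its complement, on the side where triangularity makes
  them vanish (\<open>commute_sparse_right\<close>, \<open>commute_sparse_left\<close>). The matrix \<open>X'\<close> consists of entries
  of \<open>X\<close> moved along \<open>\<sigma>\<close>. It is again triangular, and inverse matrices go to inverse matrices
  because the segment is convex (\<open>lift_mult_inverse\<close>). Hence a factor that travels through many
  edges is described by the composite of their index maps (\<open>lift_mul_sparse\<close>): each edge costs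
  \<open>O(d)\<close>, and dense matrices are touched only at the start and on arrival.

  The shapes themselves come from \<open>factor_EL_P\<close>, which sorts the non-zero columns of a pivot matrix
  by a scan of its rows in time \<open>O(d)\<close>; the other three factorizations follow by symmetry. So
  combining two halves with \<open>k\<close> edges altogether takes time \<open>O(d k + d\<^sup>3)\<close>, and the parallel time
  satisfies \<open>T(k) \<le> max (T(h)) (T(k - h - 1)) + O(d k + d\<^sup>3)\<close> with \<open>h = k div 2\<close>. The linear terms
  form a geometric series and the cubic terms add up over the \<open>O(log n)\<close> levels of the recursion.
  This yields \<open>O(d n + d\<^sup>3 log n)\<close> in \<open>divide_conquer\<close>, which for \<open>d \<ge> 2\<close> is within the bound claimed.
\<close>

section \<open>Values and running times of programs\<close>

text \<open>
  A program is evaluated by projecting with \<open>val\<close> and \<open>time\<close>: both commute with the combinators, so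
  the simplifier computes results and costs of straight-line code and never has to look at a pair
  \<open>TM x t\<close>. Splitting binds into cases would destroy this normal form.
\<close>

declare bind_tm.simps [simp del]

lemma val_bind_tm [simp]: "val (bind_tm p f) = val (f (val p))"
  by (cases p) (simp add: bind_tm.simps split: tm.split)

lemma time_bind_tm [simp]: "time (bind_tm p f) = time p + time (f (val p))"
  by (cases p) (simp add: bind_tm.simps split: tm.split)

lemma par_tm [simp]:
  "val (par p q) = (val p, val q)" "time (par p q) = 1 + max (time p) (time q)"
  by (cases p; cases q; simp)+

lemma elementary_tm [simp]:
  "val (ret x) = x" "time (ret x) = 0"
  "val (tick x) = x" "time (tick x) = 1"
  by (simp_all add: ret_def tick_def)

lemma memory_tm [simp]:
  "val (get v i) = v $ i" "time (get v i) = 1"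
  "val (put v i x) = v |\<^sub>v i \<mapsto> x" "time (put v i x) = 1"
  "val (get_mat M i j) = M $$ (i, j)" "time (get_mat M i j) = 1"
  "val (get_input f i) = f i" "time (get_input f i) = 1"
  by (simp_all add: get_def put_def get_mat_def get_input_def)

lemma arithmetic_tm [simp]:
  "val (add_tm x y) = x + y" "time (add_tm x y) = 1"
  "val (sub_tm x' y') = x' - y'" "time (sub_tm x' y') = 1"
  "val (mul_tm x'' y'') = x'' * y''" "time (mul_tm x'' y'') = 1"
  "val (div_tm u v) = u / v" "time (div_tm u v) = 1"
  "val (half_tm i) = i div 2" "time (half_tm i) = 1"
  "val (eq_tm a b) \<longleftrightarrow> a = b" "time (eq_tm a b) = 1"
  "val (delta_tm i j :: 'b::field tm) = (if i = j then 1 else 0)"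
  "time (delta_tm i j :: 'b::field tm) = 1"
  "val (index_rev_tm k i) = k - 1 - i" "time (index_rev_tm k i) = 2"
  by (simp_all add: add_tm_def sub_tm_def mul_tm_def div_tm_def half_tm_def eq_tm_def delta_tm_def
      index_rev_tm_def)

lemma val_new_vec [simp]: "val (new_vec k f) = vec k (\<lambda>i. val (f i))"
  by (simp add: new_vec_def)

lemma val_new_mat [simp]: "val (new_mat r c f) = mat r c (\<lambda>(i, j). val (f i j))"
  by (simp add: new_mat_def)

lemma time_new_vec_le:
  assumes "\<And>i. i < k \<Longrightarrow> time (f i) \<le> t"
  shows "time (new_vec k f) \<le> 1 + k * (1 + t)"
proof -
  have "(\<Sum>i<k. 1 + time (f i)) \<le> (\<Sum>i<k. 1 + t)"
    by (intro sum_mono) (use assms in auto)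
  then show ?thesis
    by (simp add: new_vec_def)
qed

lemma time_new_mat_le:
  assumes "\<And>i j. i < r \<Longrightarrow> j < c \<Longrightarrow> time (f i j) \<le> t"
  shows "time (new_mat r c f) \<le> 1 + r * (1 + c * (1 + t))"
proof -
  have "(\<Sum>j<c. 1 + time (f i j)) \<le> c * (1 + t)" if "i < r" for i
    using sum_bounded_above[of "{..<c}" "\<lambda>j. 1 + time (f i j)" "1 + t"] assms that by auto
  then have "(\<Sum>i<r. 1 + (\<Sum>j<c. 1 + time (f i j))) \<le> r * (1 + c * (1 + t))"
    using sum_bounded_above[of "{..<r}" "\<lambda>i. 1 + (\<Sum>j<c. 1 + time (f i j))" "1 + c * (1 + t)"]
    by auto
  then show ?thesis
    by (simp add: new_mat_def)
qed

text \<open>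
  Here and below, \<open>w\<close> is a common bound for all dimensions. Assuming \<open>1 \<le> w\<close> allows lower order
  terms to be absorbed into the leading power of \<open>w\<close>.
\<close>

lemma time_new_mat_const:
  assumes "r \<le> w" "c \<le> w" "1 \<le> w" "\<And>i j. i < r \<Longrightarrow> j < c \<Longrightarrow> time (f i j) \<le> s"
  shows "time (new_mat r c f) \<le> (3 + s) * w ^ 2"
proof -
  have "time (new_mat r c f) \<le> 1 + r * (1 + c * (1 + s))"
    using assms(4) by (rule time_new_mat_le)
  also have "\<dots> \<le> w * w + w * (w + w * (1 + s))"
    using assms(1-3) by (intro add_mono mult_mono) auto
  finally show ?thesis
    by (simp add: algebra_simps power2_eq_square)
qed

lemma time_new_mat_linear:
  assumes "r \<le> w" "c \<le> w" "1 \<le> w" "\<And>i j. i < r \<Longrightarrow> j < c \<Longrightarrow> time (f i j) \<le> s * w"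
  shows "time (new_mat r c f) \<le> (3 + s) * w ^ 3"
proof -
  have "time (new_mat r c f) \<le> (3 + s * w) * w ^ 2"
    using assms by (rule time_new_mat_const)
  also have "\<dots> \<le> (3 * w + s * w) * w ^ 2"
    using assms(3) by (intro mult_right_mono add_mono) auto
  finally show ?thesis
    by (simp add: algebra_simps power3_eq_cube power2_eq_square)
qed

text \<open>
  Forward substitution rewrites a matrix in each step, but only one of its rows is expensive to
  compute. A uniform bound for the entries would lose a factor \<open>w\<close> and make inversion quartic.
\<close>

lemma time_new_mat_row:
  assumes "\<And>i j. i < r \<Longrightarrow> j < c \<Longrightarrow> time (f i j) \<le> s + (if i = i0 then t else 0)"
  shows "time (new_mat r c f) \<le> 1 + r * (1 + c * (1 + s)) + c * t"
proof -
  have "1 + (\<Sum>j<c. 1 + time (f i j)) \<le> (1 + c * (1 + s)) + (if i = i0 then c * t else 0)" if "i < r"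
    for i
  proof -
    have "(\<Sum>j<c. 1 + time (f i j)) \<le> (\<Sum>j<c. (1 + s) + (if i = i0 then t else 0))"
      using assms that by (intro sum_mono) (simp add: add.assoc)
    then show ?thesis
      by (auto simp: algebra_simps)
  qed
  then have "(\<Sum>i<r. 1 + (\<Sum>j<c. 1 + time (f i j))) \<le>
      (\<Sum>i<r. (1 + c * (1 + s)) + (if i = i0 then c * t else 0))"
    by (intro sum_mono) auto
  also have "\<dots> \<le> r * (1 + c * (1 + s)) + c * t"
    by (subst sum.distrib) simp
  finally show ?thesis
    by (simp add: new_mat_def)
qed

lemma loop_invariant:
  assumes "I 0 s"
    and "\<And>i s. i < k \<Longrightarrow> I i s \<Longrightarrow> I (Suc i) (val (f i s))"
    and "\<And>i s. i < k \<Longrightarrow> I i s \<Longrightarrow> time (f i s) \<le> t"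
  shows "I k (val (loop k f s)) \<and> time (loop k f s) \<le> 1 + k * (1 + t)"
  using assms
proof (induction k)
  case (Suc k)
  then have "I k (val (loop k f s))" "time (loop k f s) \<le> 1 + k * (1 + t)"
    by auto
  then show ?case
    using Suc.prems(2)[of k] Suc.prems(3)[of k] by fastforce
qed simp

text \<open>The inner loops of matrix multiplication and of forward substitution are scalar products.\<close>

lemma loop_sum:
  fixes g :: "nat \<Rightarrow> 'a::comm_monoid_add"
  assumes "\<And>i s. val (f i s) = s + g i" "\<And>i s. time (f i s) = t"
  shows "val (loop k f 0) = (\<Sum>i<k. g i)" "time (loop k f 0) = 1 + k * (1 + t)"
  by (induction k) (simp_all add: assms)

lemma append_tm: "val (append_tm xs ys) = xs @ ys" "time (append_tm xs ys) = 1 + length xs"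
  by (induction xs) auto

section \<open>Sparse pivot matrices\<close>

text \<open>
  A sparse matrix is reasoned about through the relation of its non-zero positions. In this view
  transposition is the converse, multiplication is relational composition, and a flip is a
  symmetry of the index rectangle.
\<close>

definition entry :: "sparse \<Rightarrow> nat \<Rightarrow> nat \<Rightarrow> bool" where
  "entry S i j \<longleftrightarrow> j < dim_vec (snd S) \<and> snd S $ j = Some i"

definition sparse_in :: "nat \<Rightarrow> nat \<Rightarrow> sparse \<Rightarrow> bool" where
  "sparse_in r c S \<longleftrightarrow> fst S = r \<and> dim_vec (snd S) = c \<and>
     (\<forall>i j. entry S i j \<longrightarrow> i < r) \<and>
     (\<forall>i j j'. entry S i j \<and> entry S i j' \<longrightarrow> j = j')"

lemma entry_bounds:
  assumes "sparse_in r c S" "entry S i j"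
  shows "i < r" "j < c"
  using assms by (auto simp: sparse_in_def entry_def)

lemma entry_row_unique: "entry S i j \<Longrightarrow> entry S i' j \<Longrightarrow> i = i'"
  by (auto simp: entry_def)

lemma entry_column_unique: "sparse_in r c S \<Longrightarrow> entry S i j \<Longrightarrow> entry S i j' \<Longrightarrow> j = j'"
  by (auto simp: sparse_in_def)

lemma sparse_in_dims:
  assumes "sparse_in r c S"
  shows "fst S = r" "dim_vec (snd S) = c"
  using assms by (auto simp: sparse_in_def)

lemma sparse_eqI:
  assumes "sparse_in r c S" "sparse_in r c T" "\<And>i j. entry S i j \<longleftrightarrow> entry T i j"
  shows "S = T"
proof (rule prod_eqI)
  show "fst S = fst T"
    using assms by (simp add: sparse_in_def)
  show "snd S = snd T"
  proof (rule eq_vecI)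
    show "dim_vec (snd S) = dim_vec (snd T)"
      using assms by (simp add: sparse_in_def)
    fix j assume "j < dim_vec (snd T)"
    then have "snd S $ j = Some i \<longleftrightarrow> snd T $ j = Some i" for i
      using assms by (auto simp: sparse_in_def entry_def)
    then show "snd S $ j = snd T $ j"
      by (metis not_None_eq)
  qed
qed

lemma mat_of_sparse_carrier [simp]:
  "sparse_in r c S \<Longrightarrow> mat_of_sparse S \<in> carrier_mat r c"
  by (cases S) (auto simp: mat_of_sparse_def sparse_in_def)

lemma mat_of_sparse_index:
  assumes "sparse_in r c S" "i < r" "j < c"
  shows "mat_of_sparse S $$ (i, j) = (if entry S i j then 1 else 0)"
  using assms by (cases S) (auto simp: mat_of_sparse_def sparse_in_def entry_def)

text \<open>
  Columns contain at most one entry by the way they are stored; for rows this is the injectivity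
  that is part of \<open>sparse_in\<close>.
\<close>

lemma pivot_mat_of_sparse:
  assumes "sparse_in r c S"
  shows "pivot_matrix (mat_of_sparse S :: 'a::field mat)"
proof -
  have "dim_row (mat_of_sparse S :: 'a mat) = r" "dim_col (mat_of_sparse S :: 'a mat) = c"
    using mat_of_sparse_carrier[OF assms] by auto
  then show ?thesis
    unfolding pivot_matrix_def
    using entry_row_unique entry_column_unique[OF assms]
    by (auto simp: mat_of_sparse_index[OF assms] split: if_splits)
qed

lemma id_sparse:
  shows "sparse_in k k (val (id_sparse_tm k))"
    and "entry (val (id_sparse_tm k)) i j \<longleftrightarrow> i = j \<and> j < k"
    and "mat_of_sparse (val (id_sparse_tm k)) = 1\<^sub>m k"
  by (auto simp: id_sparse_tm_def sparse_in_def entry_def mat_of_sparse_def)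

lemma time_id_sparse: "time (id_sparse_tm k) \<le> 1 + k"
  using time_new_vec_le[of k "\<lambda>j. ret (Some j)" 0] by (simp add: id_sparse_tm_def)

abbreviation transpose_sparse :: "sparse \<Rightarrow> sparse" where
  "transpose_sparse S \<equiv> val (transpose_sparse_tm S)"

abbreviation mul_sparse :: "sparse \<Rightarrow> sparse \<Rightarrow> sparse" where
  "mul_sparse S T \<equiv> val (mul_sparse_tm S T)"

abbreviation flip_sparse :: "sparse \<Rightarrow> sparse" where
  "flip_sparse S \<equiv> val (flip_sparse_tm S)"

lemma transpose_sparse:
  assumes S: "sparse_in r c S"
  shows "sparse_in c r (transpose_sparse S)"
    and "entry (transpose_sparse S) j i \<longleftrightarrow> entry S i j"
    and "time (transpose_sparse_tm S) \<le> 2 + r + 3 * c"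
proof -
  obtain q where q: "S = (r, q)"
    using S by (cases S) (auto simp: sparse_in_def)
  define f where "f = (\<lambda>j v. do {
       x \<leftarrow> get q j;
       case x of None \<Rightarrow> ret v | Some i \<Rightarrow> put v i (Some j)
     })"
  define v0 :: "nat option vec" where "v0 = vec r (\<lambda>i. None)"
  define I where "I = (\<lambda>j (v :: nat option vec). dim_vec v = r \<and>
    (\<forall>i j'. i < r \<longrightarrow> (v $ i = Some j' \<longleftrightarrow> j' < j \<and> entry S i j')))"
  have "I c (val (loop c f v0)) \<and> time (loop c f v0) \<le> 1 + c * (1 + 2)"
  proof (rule loop_invariant)
    show "I 0 v0"
      by (simp add: I_def v0_def)
    show "I (Suc j) (val (f j v))" if j: "j < c" and I: "I j v" for j v
    proof (cases "q $ j")
      case None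
      then have "\<not> entry S i j" for i
        by (simp add: q entry_def)
      then show ?thesis
        using I None by (auto simp: I_def f_def less_Suc_eq)
    next
      case (Some i)
      then have e: "entry S i j"
        using j S by (simp add: q entry_def sparse_in_def)
      then have "i < r"
        using entry_bounds[OF S] by blast
      moreover have "entry S i' j \<longleftrightarrow> i' = i" "entry S i j' \<longleftrightarrow> j' = j" for i' j'
        using e entry_row_unique entry_column_unique[OF S] by blast+
      ultimately show ?thesis
        using I Some by (auto simp: I_def f_def less_Suc_eq update_vec_def)
    qed
    show "time (f j v) \<le> 2" for j v
      by (simp add: f_def split: option.split)
  qed
  moreover have "transpose_sparse_tm S = do {
      v \<leftarrow> new_vec r (\<lambda>i. ret None); v \<leftarrow> loop c f v; ret (c, v) }"
    using S by (simp add: q transpose_sparse_tm_def f_def sparse_in_def)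
  moreover have "time (new_vec r (\<lambda>i. ret (None :: nat option))) \<le> 1 + r"
    using time_new_vec_le[of r "\<lambda>i. ret (None :: nat option)" 0] by simp
  ultimately have v: "transpose_sparse S = (c, val (loop c f v0))"
      "I c (val (loop c f v0))" and t: "time (transpose_sparse_tm S) \<le> 2 + r + 3 * c"
    by (auto simp: v0_def)
  show "time (transpose_sparse_tm S) \<le> 2 + r + 3 * c"
    by (rule t)
  show e: "entry (transpose_sparse S) j i \<longleftrightarrow> entry S i j" for i j
    using v entry_bounds[OF S, of i j] by (auto simp: I_def entry_def[of "(c, _)"])
  show "sparse_in c r (transpose_sparse S)"
    unfolding sparse_in_def e using v entry_bounds[OF S] entry_row_unique[of S] by (auto simp: I_def)
qed

lemma mat_of_transpose_sparse:
  assumes "sparse_in r c S"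
  shows "mat_of_sparse (transpose_sparse S) = (mat_of_sparse S)\<^sup>T"
proof (rule eq_matI)
  note T = transpose_sparse[OF assms]
  note [simp] = carrier_matD[OF mat_of_sparse_carrier[OF assms]]
    carrier_matD[OF mat_of_sparse_carrier[OF T(1)]]
  show "dim_row (mat_of_sparse (transpose_sparse S)) = dim_row (mat_of_sparse S)\<^sup>T"
    "dim_col (mat_of_sparse (transpose_sparse S)) = dim_col (mat_of_sparse S)\<^sup>T"
    by simp_all
  fix i j assume "i < dim_row (mat_of_sparse S)\<^sup>T" "j < dim_col (mat_of_sparse S)\<^sup>T"
  then show "mat_of_sparse (transpose_sparse S) $$ (i, j) = (mat_of_sparse S)\<^sup>T $$ (i, j)"
    by (simp add: mat_of_sparse_index[OF T(1)] mat_of_sparse_index[OF assms] T(2))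
qed

lemma mult_mat_of_sparse_index:
  fixes X :: "'a::field mat"
  assumes S: "sparse_in r c S" and X: "X \<in> carrier_mat n r" and "a < n" "b < c"
  shows "(X * mat_of_sparse S) $$ (a, b) = (case snd S $ b of None \<Rightarrow> 0 | Some k \<Rightarrow> X $$ (a, k))"
proof -
  have "(X * mat_of_sparse S) $$ (a, b) = (\<Sum>k\<in>{0..<r}. X $$ (a, k) * mat_of_sparse S $$ (k, b))"
    using X carrier_matD[OF X] carrier_matD[OF mat_of_sparse_carrier[OF S, where 'a = 'a]] assms(3,4)
    by (simp add: scalar_prod_def)
  also have "\<dots> = (\<Sum>k\<in>{0..<r}. if snd S $ b = Some k then X $$ (a, k) else 0)"
    using assms by (intro sum.cong) (auto simp: mat_of_sparse_index[OF S] entry_def sparse_in_def)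
  also have "\<dots> = (case snd S $ b of None \<Rightarrow> 0 | Some k \<Rightarrow> X $$ (a, k))"
    using assms by (auto simp: sparse_in_def entry_def split: option.split)
  finally show ?thesis .
qed

lemma mul_sparse:
  assumes P: "sparse_in l r P" and Q: "sparse_in r c Q"
  shows "sparse_in l c (mul_sparse P Q)"
    and "entry (mul_sparse P Q) i j \<longleftrightarrow> (\<exists>k. entry P i k \<and> entry Q k j)"
    and "mat_of_sparse (mul_sparse P Q) = (mat_of_sparse P * mat_of_sparse Q :: 'a::field mat)"
    and "time (mul_sparse_tm P Q) \<le> 1 + 3 * c"
proof -
  obtain p q where pq: "P = (l, p)" "Q = (r, q)"
    using P Q by (cases P; cases Q) (auto simp: sparse_in_def)
  have d: "dim_vec p = r" "dim_vec q = c"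
    using P Q by (auto simp: pq sparse_in_def)
  show t: "time (mul_sparse_tm P Q) \<le> 1 + 3 * c"
    unfolding mul_sparse_tm_def pq using d
    by (auto split: option.split intro!: order_trans[OF time_new_vec_le[where t = 2]])
  have v: "mul_sparse P Q =
      (l, vec c (\<lambda>j. case q $ j of None \<Rightarrow> None | Some k \<Rightarrow> p $ k))"
    unfolding mul_sparse_tm_def pq using d by (auto split: option.split)
  show e: "entry (mul_sparse P Q) i j \<longleftrightarrow> (\<exists>k. entry P i k \<and> entry Q k j)" for i j
    using entry_bounds(1)[OF Q, of _ j] unfolding v
    by (auto simp: entry_def pq d split: option.splits)
  show s: "sparse_in l c (mul_sparse P Q)"
    unfolding sparse_in_def e using v
      entry_bounds[OF P] entry_column_unique[OF P] entry_column_unique[OF Q] by fastforce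
  show "mat_of_sparse (mul_sparse P Q) = (mat_of_sparse P * mat_of_sparse Q :: 'a mat)"
  proof (rule eq_matI)
    note c = mat_of_sparse_carrier[OF P, where 'a = 'a] mat_of_sparse_carrier[OF Q, where 'a = 'a]
      mat_of_sparse_carrier[OF s, where 'a = 'a]
    show "dim_row (mat_of_sparse (mul_sparse P Q) :: 'a mat) =
          dim_row (mat_of_sparse P * mat_of_sparse Q :: 'a mat)"
      "dim_col (mat_of_sparse (mul_sparse P Q) :: 'a mat) =
          dim_col (mat_of_sparse P * mat_of_sparse Q :: 'a mat)"
      using c by auto
    fix i j assume "i < dim_row (mat_of_sparse P * mat_of_sparse Q :: 'a mat)"
      "j < dim_col (mat_of_sparse P * mat_of_sparse Q :: 'a mat)"
    then have ij: "i < l" "j < c"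
      using c by auto
    show "(mat_of_sparse (mul_sparse P Q) :: 'a mat) $$ (i, j) =
        (mat_of_sparse P * mat_of_sparse Q) $$ (i, j)"
    proof (cases "q $ j")
      case None
      then have "\<not> entry Q k j" for k
        by (simp add: entry_def pq)
      then show ?thesis
        unfolding mult_mat_of_sparse_index[OF Q c(1) ij] mat_of_sparse_index[OF s ij] e
        using None by (simp add: pq)
    next
      case (Some k)
      then have k: "entry Q k' j \<longleftrightarrow> k' = k" for k'
        using ij d by (auto simp: entry_def pq)
      then have "k < r"
        using entry_bounds(1)[OF Q] by blast
      then show ?thesis
        unfolding mult_mat_of_sparse_index[OF Q c(1) ij] mat_of_sparse_index[OF s ij] e k
        using Some ij by (simp add: pq mat_of_sparse_index[OF P, unfolded pq])
    qed
  qed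
qed

lemma flip_sparse:
  assumes S: "sparse_in r c S"
  shows "sparse_in r c (flip_sparse S)"
    and "entry (flip_sparse S) i j \<longleftrightarrow> i < r \<and> j < c \<and> entry S (r - 1 - i) (c - 1 - j)"
    and "time (flip_sparse_tm S) \<le> 1 + 6 * c"
proof -
  obtain q where q: "S = (r, q)"
    using S by (cases S) (auto simp: sparse_in_def)
  have d: "dim_vec q = c"
    using S by (auto simp: q sparse_in_def)
  show "time (flip_sparse_tm S) \<le> 1 + 6 * c"
    unfolding flip_sparse_tm_def q using d
    by (auto split: option.split intro!: order_trans[OF time_new_vec_le[where t = 5]])
  have v: "flip_sparse S =
      (r, vec c (\<lambda>j. case q $ (c - 1 - j) of None \<Rightarrow> None | Some i \<Rightarrow> Some (r - 1 - i)))"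
    unfolding flip_sparse_tm_def q using d by (auto split: option.split)
  show e: "entry (flip_sparse S) i j \<longleftrightarrow>
      i < r \<and> j < c \<and> entry S (r - 1 - i) (c - 1 - j)" for i j
  proof (cases "q $ (c - 1 - j)")
    case None
    then show ?thesis
      unfolding v by (simp add: entry_def q)
  next
    case (Some k)
    show ?thesis
    proof (cases "j < c")
      case True
      then have "entry S k' (c - 1 - j) \<longleftrightarrow> k' = k" for k'
        using Some d by (auto simp: entry_def q)
      moreover from this have "k < r"
        using entry_bounds(1)[OF S] by blast
      moreover from this have "r - 1 - k = i \<longleftrightarrow> i < r \<and> r - 1 - i = k"
        by (auto simp: diff_diff_cancel)
      ultimately show ?thesis
        unfolding v using True Some by (simp add: entry_def[of "(r, vec _ _)"])
    qed (simp add: v entry_def)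
  qed
  show "sparse_in r c (flip_sparse S)"
    unfolding sparse_in_def
  proof (intro conjI allI impI)
    show "fst (flip_sparse S) = r" "dim_vec (snd (flip_sparse S)) = c"
      by (simp_all add: v)
    show "i < r" if "entry (flip_sparse S) i j" for i j
      using that e by blast
    show "j = j'" if "entry (flip_sparse S) i j \<and> entry (flip_sparse S) i j'" for i j j'
    proof -
      have "c - 1 - j = c - 1 - j'" "j < c" "j' < c"
        using that entry_column_unique[OF S] by (auto simp: e)
      then show ?thesis
        by linarith
    qed
  qed
qed

section \<open>Shapes and permutations\<close>

text \<open>
  The four shapes. All of them are strictly increasing partial maps from columns to rows. The
  non-zero columns form an initial segment for \<open>E\<^sub>L\<close> and a final one for \<open>hat E\<^sub>U\<close>; the non-zero rows
  form an initial segment for \<open>E\<^sub>U\<close> and a final one for \<open>hat E\<^sub>L\<close>.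
\<close>

definition increasing :: "sparse \<Rightarrow> bool" where
  "increasing S \<longleftrightarrow> (\<forall>i j i' j'. entry S i j \<and> entry S i' j' \<and> j < j' \<longrightarrow> i < i')"

definition shape_EL :: "sparse \<Rightarrow> bool" where
  "shape_EL S \<longleftrightarrow> increasing S \<and> (\<forall>i j j'. entry S i j \<and> j' < j \<longrightarrow> (\<exists>i'. entry S i' j'))"

definition shape_EU :: "sparse \<Rightarrow> bool" where
  "shape_EU S \<longleftrightarrow> increasing S \<and> (\<forall>i j i'. entry S i j \<and> i' < i \<longrightarrow> (\<exists>j'. entry S i' j'))"

definition shape_HL :: "sparse \<Rightarrow> bool" where
  "shape_HL S \<longleftrightarrow>
     increasing S \<and> (\<forall>i j i'. entry S i j \<and> i < i' \<and> i' < fst S \<longrightarrow> (\<exists>j'. entry S i' j'))"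

definition shape_HU :: "sparse \<Rightarrow> bool" where
  "shape_HU S \<longleftrightarrow> increasing S \<and>
     (\<forall>i j j'. entry S i j \<and> j < j' \<and> j' < dim_vec (snd S) \<longrightarrow> (\<exists>i'. entry S i' j'))"

lemma increasing_transpose:
  assumes "sparse_in r c S" "increasing S"
  shows "increasing (transpose_sparse S)"
proof -
  have "j < j'" if "entry S i j" "entry S i' j'" "i < i'" for i j i' j'
    using assms(2) that entry_row_unique[OF that(1), of i'] unfolding increasing_def
    by (metis less_asym' less_irrefl linorder_cases)
  then show ?thesis
    unfolding increasing_def transpose_sparse(2)[OF assms(1)] by blast
qed

lemma shape_EU_transpose:
  assumes "sparse_in r c S" "shape_EL S"
  shows "shape_EU (transpose_sparse S)"
  using assms increasing_transpose[OF assms(1)]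
  unfolding shape_EU_def shape_EL_def transpose_sparse(2)[OF assms(1)] by blast

lemma increasing_flip:
  assumes "sparse_in r c S" "increasing S"
  shows "increasing (flip_sparse S)"
  unfolding increasing_def flip_sparse(2)[OF assms(1)]
proof (intro allI impI)
  fix i j i' j'
  assume *: "(i < r \<and> j < c \<and> entry S (r - 1 - i) (c - 1 - j)) \<and>
    (i' < r \<and> j' < c \<and> entry S (r - 1 - i') (c - 1 - j')) \<and> j < j'"
  then have "c - 1 - j' < c - 1 - j"
    by linarith
  then have "r - 1 - i' < r - 1 - i"
    using assms(2) * unfolding increasing_def by blast
  then show "i < i'"
    by linarith
qed

lemma entry_flip_flip:
  assumes "sparse_in r c S" "i < r" "j < c"
  shows "entry (flip_sparse S) (r - 1 - i) (c - 1 - j) \<longleftrightarrow> entry S i j"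
proof -
  have "r - 1 - (r - 1 - i) = i" "c - 1 - (c - 1 - j) = j"
    using assms by linarith+
  then show ?thesis
    unfolding flip_sparse(2)[OF assms(1)] using assms(2,3) by auto
qed

lemma shape_HL_flip:
  assumes S: "sparse_in r c S" and "shape_EU S"
  shows "shape_HL (flip_sparse S)"
  unfolding shape_HL_def
proof (intro conjI allI impI)
  show "increasing (flip_sparse S)"
    using assms increasing_flip by (auto simp: shape_EU_def)
  fix i j i'
  assume *: "entry (flip_sparse S) i j \<and> i < i' \<and> i' < fst (flip_sparse S)"
  then have i': "i' < r"
    using flip_sparse(1)[OF S] by (auto simp: sparse_in_def)
  then have "r - 1 - i' < r - 1 - i" and "entry S (r - 1 - i) (c - 1 - j)"
    using * by (auto simp: flip_sparse(2)[OF S])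
  then obtain j' where j': "entry S (r - 1 - i') j'"
    using assms(2) unfolding shape_EU_def by blast
  then have "entry (flip_sparse S) (r - 1 - (r - 1 - i')) (c - 1 - j')"
    using entry_flip_flip[OF S] entry_bounds[OF S j'] by blast
  moreover have "r - 1 - (r - 1 - i') = i'"
    using i' by linarith
  ultimately show "\<exists>j'. entry (flip_sparse S) i' j'"
    by auto
qed

lemma shape_HU_flip:
  assumes S: "sparse_in r c S" and "shape_EL S"
  shows "shape_HU (flip_sparse S)"
  unfolding shape_HU_def
proof (intro conjI allI impI)
  show "increasing (flip_sparse S)"
    using assms increasing_flip by (auto simp: shape_EL_def)
  fix i j j'
  assume *: "entry (flip_sparse S) i j \<and> j < j' \<and> j' < dim_vec (snd (flip_sparse S))"
  then have j': "j' < c"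
    using flip_sparse(1)[OF S] by (auto simp: sparse_in_def)
  then have "c - 1 - j' < c - 1 - j" and "entry S (r - 1 - i) (c - 1 - j)"
    using * by (auto simp: flip_sparse(2)[OF S])
  then obtain i' where i': "entry S i' (c - 1 - j')"
    using assms(2) unfolding shape_EL_def by blast
  then have "entry (flip_sparse S) (r - 1 - i') (c - 1 - (c - 1 - j'))"
    using entry_flip_flip[OF S] entry_bounds[OF S i'] by blast
  moreover have "c - 1 - (c - 1 - j') = j'"
    using j' by linarith
  ultimately show "\<exists>i'. entry (flip_sparse S) i' j'"
    by auto
qed

definition perm_sparse :: "nat \<Rightarrow> sparse \<Rightarrow> bool" where
  "perm_sparse c P \<longleftrightarrow> sparse_in c c P \<and> (\<forall>j<c. \<exists>i. entry P i j)"

text \<open>An injective map of a finite set to itself is onto.\<close>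

lemma perm_sparse_rows:
  assumes "perm_sparse c P" "i < c"
  shows "\<exists>j. entry P i j"
proof -
  have S: "sparse_in c c P"
    using assms by (simp add: perm_sparse_def)
  define f where "f = (\<lambda>j. the (snd P $ j))"
  have f: "entry P (f j) j" if "j < c" for j
    using assms(1) that by (auto simp: perm_sparse_def entry_def f_def)
  moreover from this have "f ` {..<c} \<subseteq> {..<c}"
    using entry_bounds(1)[OF S] by blast
  moreover have "inj_on f {..<c}"
    unfolding inj_on_def using f entry_column_unique[OF S] by (metis lessThan_iff)
  ultimately have "f ` {..<c} = {..<c}"
    by (simp add: endo_inj_surj)
  then obtain j where "j < c" "f j = i"
    using assms(2) by (metis imageE lessThan_iff)
  then show ?thesis
    using f by blast
qed

lemma perm_sparse_transpose:
  assumes "perm_sparse c P"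
  shows "perm_sparse c (transpose_sparse P)"
  using assms transpose_sparse[of c c P] perm_sparse_rows by (auto simp: perm_sparse_def)

lemma perm_sparse_flip:
  assumes "perm_sparse c P"
  shows "perm_sparse c (flip_sparse P)"
proof -
  have S: "sparse_in c c P"
    using assms by (simp add: perm_sparse_def)
  have "\<exists>i. entry (flip_sparse P) i j" if "j < c" for j
  proof -
    have "c - 1 - j < c"
      using that by linarith
    then obtain i where i: "entry P i (c - 1 - j)"
      using assms unfolding perm_sparse_def by blast
    then have "entry (flip_sparse P) (c - 1 - i) (c - 1 - (c - 1 - j))"
      using entry_flip_flip[OF S] entry_bounds[OF S i] by blast
    moreover have "c - 1 - (c - 1 - j) = j"
      using that by linarith
    ultimately show ?thesis
      by auto
  qed
  then show ?thesis
    using flip_sparse(1)[OF S] by (simp add: perm_sparse_def)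
qed

lemma perm_sparse_id: "perm_sparse k (val (id_sparse_tm k))"
  using id_sparse by (auto simp: perm_sparse_def)

section \<open>Factorization of pivot matrices\<close>

text \<open>
  The factorization assigns the labels \<open>0, 1, 2, \<dots>\<close> to columns, one label at a time. The counter
  never leaves the range of valid indices, by the pigeonhole principle: all labels given out so far
  belong to different columns, and a column that is about to get a label has none yet.
\<close>

lemma labels_le:
  assumes "\<And>m. m < k \<Longrightarrow> \<exists>j<c. p $ j = Some m"
  shows "k \<le> c"
proof -
  have "{..<k} \<subseteq> (\<lambda>j. the (p $ j)) ` {..<c}"
    using assms by force
  then show ?thesis
    using surj_card_le[of "{..<c}" "{..<k}"] by simp
qed

lemma labels_less:
  assumes "\<And>m. m < k \<Longrightarrow> \<exists>j<c. p $ j = Some m" "j < c" "p $ j = None"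
  shows "k < c"
proof -
  have "{..<k} \<subseteq> (\<lambda>j. the (p $ j)) ` ({..<c} - {j})"
  proof
    fix m assume "m \<in> {..<k}"
    then obtain j' where "j' < c" "p $ j' = Some m"
      using assms(1) by auto
    moreover from this have "j' \<noteq> j"
      using assms(3) by auto
    ultimately show "m \<in> (\<lambda>j. the (p $ j)) ` ({..<c} - {j})"
      by (intro image_eqI[of _ _ j']) auto
  qed
  then have "k \<le> card ({..<c} - {j})"
    using surj_card_le[of "{..<c} - {j}" "{..<k}"] by simp
  then show ?thesis
    using assms(2) by auto
qed

text \<open>
  The permutation sends a non-zero column to its rank in the order of the rows, and the zero
  columns to the remaining indices. Composing it with \<open>E\<close> therefore recovers \<open>Q\<close>: a non-zero column
  \<open>j\<close> with label \<open>m\<close> finds its row at position \<open>m\<close> of \<open>E\<close>, and a label of a zero column points to a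
  zero column of \<open>E\<close>.
\<close>

lemma factor_EL_P:
  assumes Q: "sparse_in r c Q"
  obtains E P where "val (factor_EL_P_tm Q) = (E, P)"
    and "sparse_in r c E" "perm_sparse c P" "shape_EL E"
    and "\<And>i j. entry Q i j \<longleftrightarrow> (\<exists>k. entry E i k \<and> entry P k j)"
    and "time (factor_EL_P_tm Q) \<le> 6 + 6 * r + 9 * c"
proof -
  obtain q where q: "Q = (r, q)"
    using Q by (cases Q) (auto simp: sparse_in_def)
  have d: "dim_vec q = c"
    using Q by (auto simp: q sparse_in_def)
  have qe: "q $ j = Some i \<longleftrightarrow> entry Q i j" if "j < c" for i j
    using that by (simp add: entry_def q d)
  obtain s t where st: "transpose_sparse Q = (s, t)"
    by fastforce
  have t: "t $ i = Some j \<longleftrightarrow> entry Q i j" if "i < r" for i j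
    using transpose_sparse(2)[OF Q, of j i] sparse_in_dims[OF transpose_sparse(1)[OF Q]] that
    unfolding st by (simp add: entry_def[of "(s, t)"])
  define f1 where "f1 = (\<lambda>t i (k :: nat, e, p). do {
       x \<leftarrow> get t i;
       case x of
         None \<Rightarrow> ret (k, e, p)
       | Some j \<Rightarrow> do {
           e' \<leftarrow> put e k (Some i);
           p' \<leftarrow> put p j (Some k);
           k' \<leftarrow> add_tm k 1;
           ret (k', e', p')
         }
     })"
  define f2 where "f2 = (\<lambda>j (k :: nat, p). do {
       x \<leftarrow> get q j;
       case x of
         Some i \<Rightarrow> ret (k, p)
       | None \<Rightarrow> do {
           p' \<leftarrow> put p j (Some k);
           k' \<leftarrow> add_tm k 1;
           ret (k', p')
         }
     })"
  define none where "none = vec c (\<lambda>j. None :: nat option)"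
  (* After the rows below i: the columns with their entry in one of these rows carry the labels
     below k, label m points to the row e $ m of its column, and e is increasing. *)
  define I1 where "I1 = (\<lambda>i (k, e, p). dim_vec e = c \<and> dim_vec p = c \<and>
      (\<forall>j m. j < c \<longrightarrow> p $ j = Some m \<longrightarrow> m < k \<and> (\<exists>i'<i. entry Q i' j \<and> e $ m = Some i')) \<and>
      (\<forall>i' j. i' < i \<longrightarrow> entry Q i' j \<longrightarrow> p $ j \<noteq> None) \<and>
      (\<forall>m<k. \<exists>j<c. p $ j = Some m) \<and>
      (\<forall>m. k \<le> m \<longrightarrow> m < c \<longrightarrow> e $ m = None) \<and>
      (\<forall>m m' a b. m < m' \<longrightarrow> m' < k \<longrightarrow> e $ m = Some a \<longrightarrow> e $ m' = Some b \<longrightarrow> a < b))"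
  have "I1 r (val (loop r (f1 t) (0, none, none))) \<and> time (loop r (f1 t) (0, none, none)) \<le> 1 +
    r * (1 + 4)"
  proof (rule loop_invariant)
    show "I1 0 (0, none, none)"
      by (auto simp: I1_def none_def)
    show "time (f1 t i s) \<le> 4" for i s
      by (cases s) (simp add: f1_def split: option.split)
    show "I1 (Suc i) (val (f1 t i s))" if i: "i < r" and I: "I1 i s" for i s
    proof -
      obtain k e p where s: "s = (k, e, p)"
        by (cases s)
      from I have dims: "dim_vec e = c" "dim_vec p = c"
        and lab: "\<And>j m. j < c \<Longrightarrow> p $ j = Some m \<Longrightarrow> m < k \<and> (\<exists>i'<i. entry Q i' j \<and> e $ m = Some i')"
        and done1: "\<And>i' j. i' < i \<Longrightarrow> entry Q i' j \<Longrightarrow> p $ j \<noteq> None"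
        and sur: "\<And>m. m < k \<Longrightarrow> \<exists>j<c. p $ j = Some m"
        and rest: "\<And>m. k \<le> m \<Longrightarrow> m < c \<Longrightarrow> e $ m = None"
        and inc: "\<And>m m' a b. m < m' \<Longrightarrow> m' < k \<Longrightarrow> e $ m = Some a \<Longrightarrow> e $ m' = Some b \<Longrightarrow> a < b"
        unfolding I1_def s prod.case by blast+
      show ?thesis
      proof (cases "t $ i")
        case None
        then have n: "\<not> entry Q i j" for j
          using t[OF i, of j] by simp
        have "val (f1 t i s) = s"
          by (simp add: f1_def s None)
        moreover have "I1 (Suc i) (k, e, p)"
          unfolding I1_def prod.case
        proof (intro conjI)
          show "\<forall>j m. j < c \<longrightarrow> p $ j = Some m \<longrightarrow>
              m < k \<and> (\<exists>i'<Suc i. entry Q i' j \<and> e $ m = Some i')"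
            using lab less_SucI by blast
          show "\<forall>i' j. i' < Suc i \<longrightarrow> entry Q i' j \<longrightarrow> p $ j \<noteq> None"
            using done1 n less_SucE by metis
        qed (use dims sur rest inc in blast)+
        ultimately show ?thesis
          by (simp add: s)
      next
        case (Some j)
        then have e0: "entry Q i j"
          using t[OF i] by simp
        then have j: "j < c"
          using entry_bounds[OF Q] by blast
        have pj: "p $ j = None"
        proof (rule ccontr)
          assume "p $ j \<noteq> None"
          then obtain m where "p $ j = Some m"
            by auto
          then obtain i' where "i' < i" "entry Q i' j"
            using lab[OF j] by blast
          then show False
            using entry_row_unique[OF e0] by blast
        qed
        have k: "k < c"
          using labels_less[OF sur j pj] .
        have old: "\<exists>a<i. e $ m = Some a" if "m < k" for m
          using sur[OF that] lab by blast
        define e' p' where "e' = e |\<^sub>v k \<mapsto> Some i" and "p' = p |\<^sub>v j \<mapsto> Some k"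
        have e': "dim_vec e' = c" "e' $ k = Some i" "\<And>m. m \<noteq> k \<Longrightarrow> e' $ m = e $ m"
          using k dims by (auto simp: e'_def)
        have p': "dim_vec p' = c" "p' $ j = Some k" "\<And>m. m \<noteq> j \<Longrightarrow> p' $ m = p $ m"
          using j dims by (auto simp: p'_def)
        have "I1 (Suc i) (Suc k, e', p')"
          unfolding I1_def prod.case
        proof (intro conjI allI impI)
          fix j' m assume *: "j' < c" "p' $ j' = Some m"
          have "m < Suc k \<and> (\<exists>i'<Suc i. entry Q i' j' \<and> e' $ m = Some i')"
          proof (cases "j' = j")
            case True
            then show ?thesis
              using * p' e' e0 by auto
          next
            case False
            then show ?thesis
              using * p'(3)[OF False] lab[of j' m] e'(3)[of m] by (auto intro: less_SucI)
          qed
          then show "m < Suc k" "\<exists>i'<Suc i. entry Q i' j' \<and> e' $ m = Some i'"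
            by auto
        next
          fix i' j' assume "i' < Suc i" "entry Q i' j'"
          then show "p' $ j' \<noteq> None"
            using done1[of i' j'] entry_column_unique[OF Q e0] p'
            by (metis less_SucE option.distinct(1))
        next
          fix m assume "m < Suc k"
          then consider "m = k" | "m < k"
            by linarith
          then show "\<exists>j'<c. p' $ j' = Some m"
          proof cases
            case 1
            then show ?thesis
              using j p' by auto
          next
            case 2
            then obtain j' where "j' < c" "p $ j' = Some m"
              using sur by blast
            moreover from this have "j' \<noteq> j"
              using pj by auto
            ultimately show ?thesis
              using p' by auto
          qed
        next
          fix m assume "Suc k \<le> m" "m < c"
          then show "e' $ m = None"
            using rest e' by simp
        next
          fix m m' a b
          assume *: "m < m'" "m' < Suc k" "e' $ m = Some a" "e' $ m' = Some b"
          then have m: "m < k"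
            by linarith
          then have ea: "e $ m = Some a"
            using * e' by simp
          show "a < b"
          proof (cases "m' = k")
            case True
            then show ?thesis
              using old[OF m] ea * e' by auto
          next
            case False
            then show ?thesis
              using inc[of m m' a b] ea * e' by simp
          qed
        qed (use e' p' in simp)+
        moreover have "val (f1 t i s) = (Suc k, e', p')"
          by (simp add: f1_def s Some e'_def p'_def)
        ultimately show ?thesis
          by simp
      qed
    qed
  qed
  moreover obtain k1 e1 p1 where l1: "val (loop r (f1 t) (0, none, none)) = (k1, e1, p1)"
    by (cases "val (loop r (f1 t) (0, none, none))")
  ultimately have I: "I1 r (k1, e1, p1)" and time1: "time (loop r (f1 t) (0, none, none)) \<le> 1 + 5 * r"
    by auto
  from I have dims: "dim_vec e1 = c" "dim_vec p1 = c"
    and lab: "\<And>j m. j < c \<Longrightarrow> p1 $ j = Some m \<Longrightarrow> m < k1 \<and> (\<exists>i. entry Q i j \<and> e1 $ m = Some i)"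
    and done1: "\<And>i j. i < r \<Longrightarrow> entry Q i j \<Longrightarrow> p1 $ j \<noteq> None"
    and sur: "\<And>m. m < k1 \<Longrightarrow> \<exists>j<c. p1 $ j = Some m"
    and rest: "\<And>m. k1 \<le> m \<Longrightarrow> m < c \<Longrightarrow> e1 $ m = None"
    and inc: "\<And>m m' a b. m < m' \<Longrightarrow> m' < k1 \<Longrightarrow> e1 $ m = Some a \<Longrightarrow> e1 $ m' = Some b \<Longrightarrow> a < b"
    unfolding I1_def prod.case by blast+
  (* The labels from k1 on go to the zero columns below j; the labels of the first loop stay. *)
  define I2 where "I2 = (\<lambda>j (k, p). dim_vec p = c \<and> k1 \<le> k \<and>
      (\<forall>j' m. j' < c \<longrightarrow> p $ j' = Some m \<longrightarrow> m < k) \<and>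
      (\<forall>j' j'' m. j' < c \<longrightarrow> j'' < c \<longrightarrow> p $ j' = Some m \<longrightarrow> p $ j'' = Some m \<longrightarrow> j' = j'') \<and>
      (\<forall>i j'. entry Q i j' \<longrightarrow> p $ j' = p1 $ j') \<and>
      (\<forall>j' m. j' < c \<longrightarrow> (\<nexists>i. entry Q i j') \<longrightarrow> p $ j' = Some m \<longrightarrow> k1 \<le> m) \<and>
      (\<forall>j'<c. (\<nexists>i. entry Q i j') \<longrightarrow> (p $ j' \<noteq> None \<longleftrightarrow> j' < j)) \<and>
      (\<forall>m<k. \<exists>j<c. p $ j = Some m))"
  have "I2 c (val (loop c f2 (k1, p1))) \<and> time (loop c f2 (k1, p1)) \<le> 1 + c * (1 + 3)"
  proof (rule loop_invariant)
    show "I2 0 (k1, p1)"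
      unfolding I2_def prod.case
    proof (intro conjI)
      show "\<forall>j' j'' m. j' < c \<longrightarrow> j'' < c \<longrightarrow> p1 $ j' = Some m \<longrightarrow> p1 $ j'' = Some m \<longrightarrow> j' = j''"
        using lab entry_column_unique[OF Q] by (metis option.inject)
      show "\<forall>j'<c. (\<nexists>i. entry Q i j') \<longrightarrow> (p1 $ j' \<noteq> None \<longleftrightarrow> j' < 0)"
        using lab by blast
      show "\<forall>j' m. j' < c \<longrightarrow> (\<nexists>i. entry Q i j') \<longrightarrow> p1 $ j' = Some m \<longrightarrow> k1 \<le> m"
        using lab by blast
    qed (use dims lab sur in auto)
    show "time (f2 j s) \<le> 3" for j s
      by (cases s) (simp add: f2_def split: option.split)
    show "I2 (Suc j) (val (f2 j s))" if j: "j < c" and I: "I2 j s" for j s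
    proof -
      obtain k p where s: "s = (k, p)"
        by (cases s)
      from I have dim: "dim_vec p = c" and k1k: "k1 \<le> k"
        and bound: "\<And>j' m. j' < c \<Longrightarrow> p $ j' = Some m \<Longrightarrow> m < k"
        and inj: "\<And>j' j'' m. j' < c \<Longrightarrow> j'' < c \<Longrightarrow> p $ j' = Some m \<Longrightarrow> p $ j'' = Some m \<Longrightarrow> j' = j''"
        and agree: "\<And>i j'. entry Q i j' \<Longrightarrow> p $ j' = p1 $ j'"
        and new: "\<And>j' m. j' < c \<Longrightarrow> (\<nexists>i. entry Q i j') \<Longrightarrow> p $ j' = Some m \<Longrightarrow> k1 \<le> m"
        and done2: "\<And>j'. j' < c \<Longrightarrow> (\<nexists>i. entry Q i j') \<Longrightarrow> (p $ j' \<noteq> None \<longleftrightarrow> j' < j)"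
        and surj: "\<And>m. m < k \<Longrightarrow> \<exists>j<c. p $ j = Some m"
        unfolding I2_def s prod.case by blast+
      show ?thesis
      proof (cases "q $ j")
        case (Some i)
        then have "entry Q i j"
          using qe[OF j] by simp
        then have "\<And>j'. j' < c \<Longrightarrow> (\<nexists>i. entry Q i j') \<Longrightarrow> (p $ j' \<noteq> None \<longleftrightarrow> j' < Suc j)"
          using done2 by (metis less_Suc_eq)
        then have "I2 (Suc j) (k, p)"
          unfolding I2_def prod.case using dim k1k bound inj agree new surj by blast
        then show ?thesis
          by (simp add: f2_def s Some)
      next
        case None
        then have n: "\<nexists>i. entry Q i j"
          using qe[OF j] by auto
        then have pj: "p $ j = None"
          using done2[OF j] by simp
        have k: "k < c"
          using labels_less[OF surj j pj] .
        define p' where "p' = p |\<^sub>v j \<mapsto> Some k"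
        have p': "dim_vec p' = c" "p' $ j = Some k" "\<And>m. m \<noteq> j \<Longrightarrow> p' $ m = p $ m"
          using j dim by (auto simp: p'_def)
        have "I2 (Suc j) (Suc k, p')"
          unfolding I2_def prod.case
        proof (intro conjI)
          show "\<forall>j' m. j' < c \<longrightarrow> p' $ j' = Some m \<longrightarrow> m < Suc k"
            using bound p' by (metis less_SucI lessI option.inject)
          show "\<forall>j' j'' m. j' < c \<longrightarrow> j'' < c \<longrightarrow> p' $ j' = Some m \<longrightarrow> p' $ j'' = Some m \<longrightarrow> j' = j''"
            using inj bound p' by (metis less_irrefl option.inject)
          show "\<forall>i j'. entry Q i j' \<longrightarrow> p' $ j' = p1 $ j'"
            using agree n p' by metis
          show "\<forall>j' m. j' < c \<longrightarrow> (\<nexists>i. entry Q i j') \<longrightarrow> p' $ j' = Some m \<longrightarrow> k1 \<le> m"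
            using new k1k p' by (metis option.inject)
          show "\<forall>j'<c. (\<nexists>i. entry Q i j') \<longrightarrow> (p' $ j' \<noteq> None \<longleftrightarrow> j' < Suc j)"
            using done2 p' by (metis less_Suc_eq option.distinct(1))
          show "\<forall>m<Suc k. \<exists>j<c. p' $ j = Some m"
            using surj p' j pj by (metis less_SucE option.distinct(1))
        qed (use p' k1k in auto)
        then show ?thesis
          by (simp add: f2_def s None p'_def)
      qed
    qed
  qed
  moreover obtain k2 p2 where l2: "val (loop c f2 (k1, p1)) = (k2, p2)"
    by fastforce
  ultimately have I: "I2 c (k2, p2)" and time2: "time (loop c f2 (k1, p1)) \<le> 1 + 4 * c"
    by auto
  from I have dim2: "dim_vec p2 = c"
    and bound2: "\<And>j' m. j' < c \<Longrightarrow> p2 $ j' = Some m \<Longrightarrow> m < k2"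
    and inj2: "\<And>j' j'' m. j' < c \<Longrightarrow> j'' < c \<Longrightarrow> p2 $ j' = Some m \<Longrightarrow> p2 $ j'' = Some m \<Longrightarrow> j' = j''"
    and agree2: "\<And>i j'. entry Q i j' \<Longrightarrow> p2 $ j' = p1 $ j'"
    and new2: "\<And>j' m. j' < c \<Longrightarrow> (\<nexists>i. entry Q i j') \<Longrightarrow> p2 $ j' = Some m \<Longrightarrow> k1 \<le> m"
    and done2: "\<And>j'. j' < c \<Longrightarrow> (\<nexists>i. entry Q i j') \<Longrightarrow> p2 $ j' \<noteq> None"
    and surj2: "\<And>m. m < k2 \<Longrightarrow> \<exists>j<c. p2 $ j = Some m"
    unfolding I2_def prod.case by blast+
  have k2: "k2 \<le> c"
    using labels_le[OF surj2] .
  have prog: "factor_EL_P_tm Q = do {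
      (s, t) \<leftarrow> transpose_sparse_tm Q;
      e \<leftarrow> new_vec c (\<lambda>j. ret None);
      p \<leftarrow> new_vec c (\<lambda>j. ret None);
      (k, e, p) \<leftarrow> loop r (f1 t) (0, e, p);
      (k, p) \<leftarrow> loop c f2 (k, p);
      ret ((r, e), (c, p)) }"
    unfolding factor_EL_P_tm_def f1_def f2_def q d prod.case ..
  have tn: "time (new_vec c (\<lambda>j. ret (None :: nat option))) \<le> 1 + c"
    using time_new_vec_le[of c "\<lambda>j. ret (None :: nat option)" 0] by simp
  have vn: "vec c (\<lambda>j. None) = none"
    by (simp add: none_def)
  show thesis
  proof
    show "val (factor_EL_P_tm Q) = ((r, e1), (c, p2))"
      by (simp add: prog st vn l1 l2)
    show "time (factor_EL_P_tm Q) \<le> 6 + 6 * r + 9 * c"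
      using time1 time2 tn transpose_sparse(3)[OF Q] by (simp add: prog st vn l1 l2)
    have e1: "m < k1 \<and> (\<exists>j. entry Q i j \<and> p1 $ j = Some m)" if m: "e1 $ m = Some i" "m < c" for m i
    proof -
      have "m < k1"
        using rest[OF _ m(2)] m(1) by (cases "k1 \<le> m") auto
      moreover from this obtain j where j: "j < c" "p1 $ j = Some m"
        using sur by blast
      ultimately show ?thesis
        using lab[OF j] m(1) by auto
    qed
    have E: "entry (r, e1) i m \<longleftrightarrow> m < c \<and> e1 $ m = Some i" for i m
      by (simp add: entry_def dims)
    have "increasing (r, e1)"
      unfolding increasing_def E using inc e1 by blast
    moreover have "\<exists>i. e1 $ m = Some i" if "m < k1" for m
      using sur[OF that] lab by blast
    ultimately show "shape_EL (r, e1)"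
      unfolding shape_EL_def E using e1 by (meson less_trans)
    have "j = j'" if "entry (r, e1) i j" "entry (r, e1) i j'" for i j j'
      using \<open>increasing (r, e1)\<close> that unfolding increasing_def by (meson less_irrefl
        linorder_neqE_nat)
    moreover have "i < r" if "entry (r, e1) i j" for i j
      using that e1 entry_bounds(1)[OF Q] unfolding E by blast
    ultimately show "sparse_in r c (r, e1)"
      unfolding sparse_in_def fst_conv snd_conv using dims(1) by blast
    have "sparse_in c c (c, p2)"
      unfolding sparse_in_def entry_def fst_conv snd_conv dim2
      using inj2 less_le_trans[OF bound2 k2] by blast
    moreover have "p2 $ j \<noteq> None" if "j < c" for j
    proof (cases "\<exists>i. entry Q i j")
      case True
      then obtain i where i: "entry Q i j"
        by blast
      then show ?thesis
        using agree2[OF i] done1[OF entry_bounds(1)[OF Q i] i] by simp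
    qed (use done2[OF that] in blast)
    ultimately show "perm_sparse c (c, p2)"
      using dim2 by (auto simp: perm_sparse_def entry_def)
    show "entry Q i j \<longleftrightarrow> (\<exists>k. entry (r, e1) i k \<and> entry (c, p2) k j)" for i j
    proof
      assume ij: "entry Q i j"
      then have "i < r" "j < c"
        using entry_bounds[OF Q] by auto
      moreover from this obtain m where m: "p1 $ j = Some m"
        using done1[OF _ ij] by blast
      ultimately have "m < k1" "e1 $ m = Some i"
        using lab[of j m] entry_row_unique[OF ij] by auto
      moreover have "k1 \<le> c"
        by (rule labels_le[OF sur])
      ultimately show "\<exists>k. entry (r, e1) i k \<and> entry (c, p2) k j"
        using m agree2[OF ij] \<open>j < c\<close> dims dim2 by (auto simp: entry_def)
    next
      assume "\<exists>k. entry (r, e1) i k \<and> entry (c, p2) k j"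
      then obtain m where m: "m < c" "e1 $ m = Some i" "j < c" "p2 $ j = Some m"
        using dims dim2 by (auto simp: entry_def)
      have "m < k1"
        using e1[OF m(2,1)] by blast
      then obtain i' where i': "entry Q i' j"
        using new2[OF m(3) _ m(4)] by (meson linorder_not_less)
      then have "p1 $ j = Some m"
        using agree2[OF i'] m(4) by simp
      then show "entry Q i j"
        using lab[OF m(3)] m(2) by auto
    qed
  qed
qed

text \<open>Transposing \<open>Q\<^sup>T = E P\<close> gives \<open>Q = P\<^sup>T E\<^sup>T\<close>.\<close>

lemma factor_P_EU:
  assumes Q: "sparse_in r c Q"
  obtains P E where "val (factor_P_EU_tm Q) = (P, E)"
    and "sparse_in r c E" "perm_sparse r P" "shape_EU E"
    and "\<And>i j. entry Q i j \<longleftrightarrow> (\<exists>k. entry P i k \<and> entry E k j)"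
    and "time (factor_P_EU_tm Q) \<le> 12 + 17 * r + 13 * c"
proof -
  note T = transpose_sparse[OF Q]
  obtain E P where *: "val (factor_EL_P_tm (transpose_sparse Q)) = (E, P)"
    and E: "sparse_in c r E" and P: "perm_sparse r P" and "shape_EL E"
    and e: "\<And>i j. entry (transpose_sparse Q) i j \<longleftrightarrow> (\<exists>k. entry E i k \<and> entry P k j)"
    and t: "time (factor_EL_P_tm (transpose_sparse Q)) \<le> 6 + 6 * c + 9 * r"
    using factor_EL_P[OF T(1)] by metis
  have P': "sparse_in r r P"
    using P by (simp add: perm_sparse_def)
  show thesis
  proof
    show "val (factor_P_EU_tm Q) = (transpose_sparse P, transpose_sparse E)"
      by (simp add: factor_P_EU_tm_def *)
    show "sparse_in r c (transpose_sparse E)"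
      using transpose_sparse(1)[OF E] .
    show "perm_sparse r (transpose_sparse P)"
      using perm_sparse_transpose[OF P] .
    show "shape_EU (transpose_sparse E)"
      using shape_EU_transpose[OF E] \<open>shape_EL E\<close> .
    show "entry Q i j \<longleftrightarrow> (\<exists>k. entry (transpose_sparse P) i k \<and> entry (transpose_sparse E) k j)" for i j
      using e[of j i] T(2) by (auto simp: transpose_sparse(2)[OF E] transpose_sparse(2)[OF P'])
    show "time (factor_P_EU_tm Q) \<le> 12 + 17 * r + 13 * c"
      using t T(3) transpose_sparse(3)[OF E] transpose_sparse(3)[OF P']
      by (simp add: factor_P_EU_tm_def *)
  qed
qed

text \<open>
  Flipping is conjugation by anti-diagonal permutations, hence multiplicative. This reduces the
  shapes with a hat to those without.
\<close>

lemma flip_factorization: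
  assumes Q: "sparse_in r c Q" and M: "sparse_in r l M" and N: "sparse_in l c N"
    and e: "\<And>i j. entry (flip_sparse Q) i j \<longleftrightarrow> (\<exists>k. entry M i k \<and> entry N k j)"
  shows "entry Q i j \<longleftrightarrow> (\<exists>k. entry (flip_sparse M) i k \<and> entry (flip_sparse N) k j)"
proof (cases "i < r \<and> j < c")
  case True
  have k: "l - 1 - (l - 1 - k) = k" "l - 1 - k < l" if "k < l" for k
    using that by linarith+
  have "entry Q i j \<longleftrightarrow> (\<exists>k. entry M (r - 1 - i) k \<and> entry N k (c - 1 - j))"
    using entry_flip_flip[OF Q] e True by blast
  also have "\<dots> \<longleftrightarrow> (\<exists>k<l. entry M (r - 1 - i) (l - 1 - k) \<and> entry N (l - 1 - k) (c - 1 - j))"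
    using entry_bounds(2)[OF M] k by metis
  finally show ?thesis
    unfolding flip_sparse(2)[OF M] flip_sparse(2)[OF N] using True by auto
next
  case False
  then show ?thesis
    unfolding flip_sparse(2)[OF M] flip_sparse(2)[OF N] using entry_bounds[OF Q] by blast
qed

lemma factor_P_HL:
  assumes Q: "sparse_in r c Q"
  obtains P E where "val (factor_P_HL_tm Q) = (P, E)"
    and "sparse_in r c E" "perm_sparse r P" "shape_HL E"
    and "\<And>i j. entry Q i j \<longleftrightarrow> (\<exists>k. entry P i k \<and> entry E k j)"
    and "time (factor_P_HL_tm Q) \<le> 15 + 23 * r + 25 * c"
proof -
  note F = flip_sparse[OF Q]
  obtain P E where *: "val (factor_P_EU_tm (flip_sparse Q)) = (P, E)"
    and E: "sparse_in r c E" and P: "perm_sparse r P" and "shape_EU E"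
    and e: "\<And>i j. entry (flip_sparse Q) i j \<longleftrightarrow> (\<exists>k. entry P i k \<and> entry E k j)"
    and t: "time (factor_P_EU_tm (flip_sparse Q)) \<le> 12 + 17 * r + 13 * c"
    using factor_P_EU[OF F(1)] by metis
  have P': "sparse_in r r P"
    using P by (simp add: perm_sparse_def)
  show thesis
    using flip_sparse(1)[OF E] perm_sparse_flip[OF P] shape_HL_flip[OF E \<open>shape_EU E\<close>]
      flip_factorization[OF Q P' E e] t F(3) flip_sparse(3)[OF E] flip_sparse(3)[OF P']
    by (intro that[of "flip_sparse P" "flip_sparse E"]) (simp_all add: factor_P_HL_tm_def *)
qed

lemma factor_HU_P:
  assumes Q: "sparse_in r c Q"
  obtains E P where "val (factor_HU_P_tm Q) = (E, P)"
    and "sparse_in r c E" "perm_sparse c P" "shape_HU E"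
    and "\<And>i j. entry Q i j \<longleftrightarrow> (\<exists>k. entry E i k \<and> entry P k j)"
    and "time (factor_HU_P_tm Q) \<le> 9 + 6 * r + 27 * c"
proof -
  note F = flip_sparse[OF Q]
  obtain E P where *: "val (factor_EL_P_tm (flip_sparse Q)) = (E, P)"
    and E: "sparse_in r c E" and P: "perm_sparse c P" and "shape_EL E"
    and e: "\<And>i j. entry (flip_sparse Q) i j \<longleftrightarrow> (\<exists>k. entry E i k \<and> entry P k j)"
    and t: "time (factor_EL_P_tm (flip_sparse Q)) \<le> 6 + 6 * r + 9 * c"
    using factor_EL_P[OF F(1)] by metis
  have P': "sparse_in c c P"
    using P by (simp add: perm_sparse_def)
  show thesis
    using flip_sparse(1)[OF E] perm_sparse_flip[OF P] shape_HU_flip[OF E \<open>shape_EL E\<close>]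
      flip_factorization[OF Q E P' e] t F(3) flip_sparse(3)[OF E] flip_sparse(3)[OF P']
    by (intro that[of "flip_sparse E" "flip_sparse P"]) (simp_all add: factor_HU_P_tm_def *)
qed

section \<open>Dense matrices\<close>

lemma index_mult_mat_sum:
  assumes "A \<in> carrier_mat n m" "B \<in> carrier_mat m l" "i < n" "j < l"
  shows "(A * B) $$ (i, j) = (\<Sum>k<m. A $$ (i, k) * B $$ (k, j))"
  using assms by (auto simp: scalar_prod_def lessThan_atLeast0)

lemma id_mat:
  shows "val (id_mat_tm k) = 1\<^sub>m k"
    and "k \<le> w \<Longrightarrow> 1 \<le> w \<Longrightarrow> time (id_mat_tm k :: 'a::field mat tm) \<le> 4 * w ^ 2"
proof -
  show "val (id_mat_tm k) = 1\<^sub>m k"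
    by (auto simp: id_mat_tm_def intro!: eq_matI)
  show "time (id_mat_tm k :: 'a mat tm) \<le> 4 * w ^ 2" if "k \<le> w" "1 \<le> w"
    using time_new_mat_const[OF that(1,1,2), of "delta_tm :: nat \<Rightarrow> nat \<Rightarrow> 'a tm" 1]
    by (simp add: id_mat_tm_def)
qed

lemma mul_mat:
  fixes M N :: "'a::field mat"
  assumes M: "M \<in> carrier_mat l r" and N: "N \<in> carrier_mat r c"
  shows "val (mul_mat_tm M N) = M * N"
    and "l \<le> w \<Longrightarrow> r \<le> w \<Longrightarrow> c \<le> w \<Longrightarrow> 1 \<le> w \<Longrightarrow> time (mul_mat_tm M N) \<le> 9 * w ^ 3"
proof -
  define g where "g = (\<lambda>i j k (s :: 'a). do {
      x \<leftarrow> get_mat M i k; y \<leftarrow> get_mat N k j; z \<leftarrow> mul_tm x y; add_tm s z })"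
  note l = loop_sum[of "g i j" "\<lambda>k. M $$ (i, k) * N $$ (k, j)" 4 for i j]
  have d: "dim_row M = l" "dim_col M = r" "dim_row N = r" "dim_col N = c"
    using M N by auto
  have p: "mul_mat_tm M N = new_mat l c (\<lambda>i j. loop r (g i j) 0)"
    by (simp add: mul_mat_tm_def g_def d)
  have v: "val (loop r (g i j) 0) = (\<Sum>k<r. M $$ (i, k) * N $$ (k, j))"
    and t: "time (loop r (g i j) 0) = 1 + r * 5" for i j
    by (subst l; simp add: g_def)+
  show "val (mul_mat_tm M N) = M * N"
    unfolding p by (rule eq_matI)
      (auto simp: v d scalar_prod_def lessThan_atLeast0 intro!: sum.cong)
  show "time (mul_mat_tm M N) \<le> 9 * w ^ 3" if "l \<le> w" "r \<le> w" "c \<le> w" "1 \<le> w"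
    unfolding p using time_new_mat_linear[OF that(1,3,4), of "\<lambda>i j. loop r (g i j) 0" 6] that
    by (simp add: t)
qed

text \<open>
  Lower and upper triangular matrices are treated alike by making the order a parameter: a matrix
  is lower or upper triangular if its non-zero positions satisfy \<open>\<ge>\<close> or \<open>\<le>\<close>.
\<close>

definition triangular :: "(nat \<Rightarrow> nat \<Rightarrow> bool) \<Rightarrow> 'a::zero mat \<Rightarrow> bool" where
  "triangular R X \<longleftrightarrow> (\<forall>i<dim_row X. \<forall>j<dim_col X. X $$ (i, j) \<noteq> 0 \<longrightarrow> R i j)"

abbreviation lower :: "'a::zero mat \<Rightarrow> bool" where
  "lower \<equiv> triangular (\<lambda>i j. j \<le> i)"

abbreviation upper :: "'a::zero mat \<Rightarrow> bool" where
  "upper \<equiv> triangular (\<lambda>i j. i \<le> j)"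

lemma triangular_zero:
  assumes "triangular R X" "X \<in> carrier_mat n m" "i < n" "j < m" "\<not> R i j"
  shows "X $$ (i, j) = 0"
  using assms by (auto simp: triangular_def)

definition nonzero_diagonal :: "'a::zero mat \<Rightarrow> bool" where
  "nonzero_diagonal X \<longleftrightarrow> (\<forall>i<dim_row X. X $$ (i, i) \<noteq> 0)"

definition flip_mat :: "'a mat \<Rightarrow> 'a mat" where
  "flip_mat M =
     mat (dim_row M) (dim_col M) (\<lambda>(i, j). M $$ (dim_row M - 1 - i, dim_col M - 1 - j))"

lemma val_flip_mat_tm [simp]: "val (flip_mat_tm M) = flip_mat M"
  by (simp add: flip_mat_tm_def flip_mat_def)

lemma time_flip_mat_tm:
  assumes "M \<in> carrier_mat r c" "r \<le> w" "c \<le> w" "1 \<le> w"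
  shows "time (flip_mat_tm M) \<le> 8 * w ^ 2"
  unfolding flip_mat_tm_def using assms
  by (intro order_trans[OF time_new_mat_const[where s = 5 and w = w]]) auto

lemma flip_mat_carrier [simp]: "M \<in> carrier_mat r c \<Longrightarrow> flip_mat M \<in> carrier_mat r c"
  by (auto simp: flip_mat_def)

lemma flip_flip_mat [simp]: "flip_mat (flip_mat M) = M"
  by (rule eq_matI) (auto simp: flip_mat_def)

lemma flip_mat_one [simp]: "flip_mat (1\<^sub>m n) = 1\<^sub>m n"
  by (rule eq_matI) (auto simp: flip_mat_def)

lemma flip_mat_mult:
  fixes M N :: "'a::field mat"
  assumes "M \<in> carrier_mat l r" "N \<in> carrier_mat r c"
  shows "flip_mat (M * N) = flip_mat M * flip_mat N"
proof (rule eq_matI)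
  show "dim_row (flip_mat (M * N)) = dim_row (flip_mat M * flip_mat N)"
    "dim_col (flip_mat (M * N)) = dim_col (flip_mat M * flip_mat N)"
    by (simp_all add: flip_mat_def)
  fix i j
  assume "i < dim_row (flip_mat M * flip_mat N)" "j < dim_col (flip_mat M * flip_mat N)"
  then have ij: "i < l" "j < c"
    using assms by (auto simp: flip_mat_def)
  have "(\<Sum>k<r. M $$ (l - 1 - i, r - 1 - k) * N $$ (r - 1 - k, c - 1 - j)) =
      (\<Sum>k<r. M $$ (l - 1 - i, k) * N $$ (k, c - 1 - j))"
    using sum.nat_diff_reindex[of "\<lambda>k. M $$ (l - 1 - i, k) * N $$ (k, c - 1 - j)" r] by simp
  then show "flip_mat (M * N) $$ (i, j) = (flip_mat M * flip_mat N) $$ (i, j)"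
    using ij assms by (auto simp: flip_mat_def scalar_prod_def lessThan_atLeast0)
qed

lemma flip_mat_of_sparse:
  assumes "sparse_in r c S"
  shows "mat_of_sparse (flip_sparse S) = flip_mat (mat_of_sparse S :: 'a::field mat)"
proof (rule eq_matI)
  note F = flip_sparse[OF assms]
  note d = carrier_matD[OF mat_of_sparse_carrier[OF assms, where 'a = 'a]]
    carrier_matD[OF mat_of_sparse_carrier[OF F(1), where 'a = 'a]]
  show "dim_row (mat_of_sparse (flip_sparse S) :: 'a mat) = dim_row (flip_mat (mat_of_sparse S :: 'a
    mat))"
    "dim_col (mat_of_sparse (flip_sparse S) :: 'a mat) = dim_col (flip_mat (mat_of_sparse S :: 'a
      mat))"
    by (simp_all add: d flip_mat_def)
  fix i j
  assume "i < dim_row (flip_mat (mat_of_sparse S :: 'a mat))"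
    "j < dim_col (flip_mat (mat_of_sparse S :: 'a mat))"
  then have ij: "i < r" "j < c"
    by (simp_all add: d flip_mat_def)
  then have "r - 1 - i < r" "c - 1 - j < c"
    by linarith+
  then show "mat_of_sparse (flip_sparse S) $$ (i, j) = flip_mat (mat_of_sparse S :: 'a mat) $$ (i, j)"
    using ij by (simp add: flip_mat_def d mat_of_sparse_index[OF F(1)] mat_of_sparse_index[OF assms]
      F(2))
qed

lemma triangular_flip_mat:
  assumes X: "X \<in> carrier_mat n n" and "triangular R X"
  shows "triangular (\<lambda>i j. R (n - 1 - i) (n - 1 - j)) (flip_mat X)"
  unfolding triangular_def
proof (intro allI impI)
  fix i j
  assume *: "i < dim_row (flip_mat X)" "j < dim_col (flip_mat X)" "flip_mat X $$ (i, j) \<noteq> 0"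
  then have ij: "i < n" "j < n"
    using X by (auto simp: flip_mat_def)
  then have "n - 1 - i < n" "n - 1 - j < n" "X $$ (n - 1 - i, n - 1 - j) \<noteq> 0"
    using * X by (auto simp: flip_mat_def)
  then show "R (n - 1 - i) (n - 1 - j)"
    using assms by (auto simp: triangular_def)
qed

lemma triangular_mono:
  assumes "triangular R X" "\<And>i j. i < dim_row X \<Longrightarrow> j < dim_col X \<Longrightarrow> R i j \<Longrightarrow> R' i j"
  shows "triangular R' X"
  using assms by (auto simp: triangular_def)

lemma lower_flip_mat:
  assumes "X \<in> carrier_mat n n" "upper X"
  shows "lower (flip_mat X)"
  by (rule triangular_mono[OF triangular_flip_mat[OF assms]])
    (use assms(1) in \<open>auto simp: flip_mat_def\<close>)

lemma upper_flip_mat: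
  assumes "X \<in> carrier_mat n n" "lower X"
  shows "upper (flip_mat X)"
  by (rule triangular_mono[OF triangular_flip_mat[OF assms]])
    (use assms(1) in \<open>auto simp: flip_mat_def\<close>)

lemma nonzero_diagonal_flip_mat:
  assumes "X \<in> carrier_mat n n" "nonzero_diagonal X"
  shows "nonzero_diagonal (flip_mat X)"
  using assms by (auto simp: nonzero_diagonal_def flip_mat_def)

text \<open>
  After step \<open>i\<close> the rows up to \<open>i\<close> of the product \<open>L V\<close> are those of the identity: they involve
  only rows of \<open>V\<close> that are already final, since \<open>L\<close> is lower triangular. Row \<open>i\<close> of \<open>V\<close> solves the
  equation for row \<open>i\<close> of the product, and the diagonal entry by which it divides is non-zero.
\<close>

lemma lower_inverse:
  fixes L :: "'a::field mat"
  assumes L: "L \<in> carrier_mat n n" and low: "lower L" and diag: "nonzero_diagonal L"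
    and w: "n \<le> w" "1 \<le> w"
  obtains V where "val (lower_inverse_tm L) = V" "V \<in> carrier_mat n n" "lower V" "L * V = 1\<^sub>m n"
    and "time (lower_inverse_tm L) \<le> 30 * w ^ 3"
proof -
  define g where "g = (\<lambda>i b V k (s :: 'a). do {
      x \<leftarrow> get_mat L i k; y \<leftarrow> get_mat V k b; z \<leftarrow> mul_tm x y; add_tm s z })"
  define h where "h = (\<lambda>i V a b. do {
         t \<leftarrow> eq_tm a i;
         if t then do {
           s \<leftarrow> loop i (g i b V) 0;
           e \<leftarrow> delta_tm i b;
           x \<leftarrow> sub_tm e s;
           y \<leftarrow> get_mat L i i;
           div_tm x y
         } else get_mat V a b
       })"
  note l = loop_sum[of "g i b V" "\<lambda>k. L $$ (i, k) * V $$ (k, b)" 4 for i b V]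
  have v: "val (loop k (g i b V) 0) = (\<Sum>k<k. L $$ (i, k) * V $$ (k, b))"
    and t: "time (loop k (g i b V) 0) = 1 + k * 5" for k i b V
    by (subst l; simp add: g_def)+
  have hv: "val (h i V a b) = (if a = i then ((if i = b then 1 else 0) - (\<Sum>k<i. L $$ (i, k) * V $$
    (k, b))) / L $$ (i, i)
      else V $$ (a, b))" for i V a b
    by (simp add: h_def v)
  have p: "lower_inverse_tm L = id_mat_tm n \<bind> loop n (\<lambda>i V. new_mat n n (h i V))"
    using L unfolding lower_inverse_tm_def h_def g_def by simp
  define I where "I = (\<lambda>i V. V \<in> carrier_mat n n \<and> (\<forall>a<i. \<forall>b<n.
      (\<Sum>k<Suc a. L $$ (a, k) * V $$ (k, b)) = (if a = b then 1 else 0) \<and>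
      (a < b \<longrightarrow> V $$ (a, b) = 0)))"
  have th: "time (new_mat n n (h i V)) \<le> 1 + n * (1 + n * (1 + 2)) + n * (6 + 5 * n)" if "i < n"
    for i V
    using that by (intro time_new_mat_row[where ?i0.0 = i]) (auto simp: h_def t)
  have lI: "I n (val (loop n (\<lambda>i V. new_mat n n (h i V)) (1\<^sub>m n))) \<and>
      time (loop n (\<lambda>i V. new_mat n n (h i V)) (1\<^sub>m n)) \<le>
        1 + n * (1 + (1 + n * (1 + n * (1 + 2)) + n * (6 + 5 * n)))"
  proof (rule loop_invariant)
    show "I 0 (1\<^sub>m n)"
      by (simp add: I_def)
    fix i V assume i: "i < n" and "I i V"
    then have V: "V \<in> carrier_mat n n"
      and s: "\<And>a b. a < i \<Longrightarrow> b < n \<Longrightarrow>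
        (\<Sum>k<Suc a. L $$ (a, k) * V $$ (k, b)) = (if a = b then 1 else 0)"
      and z: "\<And>a b. a < i \<Longrightarrow> b < n \<Longrightarrow> a < b \<Longrightarrow> V $$ (a, b) = 0"
      by (auto simp: I_def)
    define V' where "V' = val (new_mat n n (h i V))"
    have V': "V' \<in> carrier_mat n n"
      by (simp add: V'_def)
    have same: "V' $$ (a, b) = V $$ (a, b)" if "a < i" "b < n" for a b
      using that i by (simp add: V'_def hv)
    have new: "V' $$ (i, b) =
        ((if i = b then 1 else 0) - (\<Sum>k<i. L $$ (i, k) * V $$ (k, b))) / L $$ (i, i)" if "b < n" for b
      using that i by (simp add: V'_def hv)
    have sums: "(\<Sum>k<m. L $$ (a, k) * V' $$ (k, b)) = (\<Sum>k<m. L $$ (a, k) * V $$ (k, b))"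
      if "m \<le> i" "b < n" for a b m
      using that same by (intro sum.cong) auto
    have "L $$ (i, i) \<noteq> 0"
      using diag i L by (auto simp: nonzero_diagonal_def)
    then have row: "(\<Sum>k<Suc i. L $$ (i, k) * V' $$ (k, b)) = (if i = b then 1 else 0)" if "b < n"
      for b
      using that by (simp add: sums new)
    have zero: "V' $$ (i, b) = 0" if "b < n" "i < b" for b
      using that z by (simp add: new)
    have "I (Suc i) V'"
      unfolding I_def
    proof (intro conjI allI impI)
      fix a b assume a: "a < Suc i" and b: "b < n"
      show "(\<Sum>k<Suc a. L $$ (a, k) * V' $$ (k, b)) = (if a = b then 1 else 0)"
        using a row[OF b] s[of a b] b sums[of "Suc a" b a] by (cases "a = i") auto
      show "V' $$ (a, b) = 0" if "a < b"
        using a b that zero z[of a b] same[of a b] by (cases "a = i") auto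
    qed (rule V')
    then show "I (Suc i) (val (new_mat n n (h i V)))"
      by (simp add: V'_def)
    show "time (new_mat n n (h i V)) \<le> 1 + n * (1 + n * (1 + 2)) + n * (6 + 5 * n)"
      by (rule th[OF i])
  qed
  define V where "V = val (loop n (\<lambda>i V. new_mat n n (h i V)) (1\<^sub>m n))"
  have V: "V \<in> carrier_mat n n"
    and s: "\<And>a b. a < n \<Longrightarrow> b < n \<Longrightarrow>
        (\<Sum>k<Suc a. L $$ (a, k) * V $$ (k, b)) = (if a = b then 1 else 0)"
    and z: "\<And>a b. a < n \<Longrightarrow> b < n \<Longrightarrow> a < b \<Longrightarrow> V $$ (a, b) = 0"
    using lI by (auto simp: I_def V_def)
  show thesis
  proof
    show "val (lower_inverse_tm L) = V"
      by (simp add: p id_mat V_def)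
    show "V \<in> carrier_mat n n"
      by (rule V)
    show "lower V"
      using V z by (auto simp: triangular_def not_less[symmetric])
    show "L * V = 1\<^sub>m n"
    proof (rule eq_matI)
      fix a b assume "a < dim_row (1\<^sub>m n :: 'a mat)" "b < dim_col (1\<^sub>m n :: 'a mat)"
      then have ab: "a < n" "b < n"
        by auto
      have "(L * V) $$ (a, b) = (\<Sum>k<n. L $$ (a, k) * V $$ (k, b))"
        by (rule index_mult_mat_sum[OF L V ab])
      also have "\<dots> = (\<Sum>k<Suc a. L $$ (a, k) * V $$ (k, b))"
      proof (rule sum.mono_neutral_right)
        show "\<forall>k\<in>{..<n} - {..<Suc a}. L $$ (a, k) * V $$ (k, b) = 0"
          using low L ab by (force simp: triangular_def)
      qed (use ab in auto)
      finally show "(L * V) $$ (a, b) = 1\<^sub>m n $$ (a, b)"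
        using s ab by simp
    qed (use L V in auto)
    show "time (lower_inverse_tm L) \<le> 30 * w ^ 3"
    proof -
      have "1 + n * (1 + (1 + n * (1 + n * (1 + 2)) + n * (6 + 5 * n)))
          \<le> w * (w * w) + w * (w * w + (w * w + w * (w + w * (1 + 2)) + w * (6 * w + 5 * w)))"
        using w by (intro add_mono mult_mono) (auto simp: Suc_le_eq)
      also have "\<dots> = 18 * w ^ 3"
        by (simp add: power3_eq_cube algebra_simps)
      finally have "time (loop n (\<lambda>i V. new_mat n n (h i V)) (1\<^sub>m n)) \<le> 18 * w ^ 3"
        using lI by linarith
      moreover have "w ^ 2 \<le> w ^ 3"
        using w by (simp add: power_increasing)
      ultimately show ?thesis
        using id_mat(2)[OF w, where 'a = 'a] by (simp add: p id_mat(1))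
    qed
  qed
qed

lemma upper_inverse:
  fixes U :: "'a::field mat"
  assumes U: "U \<in> carrier_mat n n" and up: "upper U" and diag: "nonzero_diagonal U"
    and w: "n \<le> w" "1 \<le> w"
  obtains V where "val (upper_inverse_tm U) = V" "V \<in> carrier_mat n n" "upper V" "U * V = 1\<^sub>m n"
    and "time (upper_inverse_tm U) \<le> 46 * w ^ 3"
proof -
  obtain V where v: "val (lower_inverse_tm (flip_mat U)) = V"
    and V: "V \<in> carrier_mat n n" and low: "lower V" and inv: "flip_mat U * V = 1\<^sub>m n"
    and t: "time (lower_inverse_tm (flip_mat U)) \<le> 30 * w ^ 3"
    using lower_inverse[OF flip_mat_carrier[OF U] lower_flip_mat[OF U up]
        nonzero_diagonal_flip_mat[OF U diag] w] by metis
  show thesis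
  proof
    show "val (upper_inverse_tm U) = flip_mat V"
      by (simp add: upper_inverse_tm_def v)
    show "flip_mat V \<in> carrier_mat n n" "upper (flip_mat V)"
      using V upper_flip_mat[OF V low] by simp_all
    show "U * flip_mat V = 1\<^sub>m n"
      using flip_mat_mult[OF flip_mat_carrier[OF U] V] inv by simp
    show "time (upper_inverse_tm U) \<le> 46 * w ^ 3"
    proof -
      have "w ^ 2 \<le> w ^ 3"
        using w by (simp add: power_increasing)
      then show ?thesis
        using t time_flip_mat_tm[OF U w(1,1,2)] time_flip_mat_tm[OF V w(1,1,2)]
        by (simp add: upper_inverse_tm_def v)
    qed
  qed
qed

lemma topmost:
  shows "case val (topmost_tm R j) of
      None \<Rightarrow> \<forall>i<dim_row R. R $$ (i, j) = 0
    | Some i \<Rightarrow> i < dim_row R \<and> R $$ (i, j) \<noteq> 0 \<and> (\<forall>i'<i. R $$ (i', j) = 0)"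
    and "time (topmost_tm R j) \<le> 1 + 3 * dim_row R"
proof -
  define f where "f = (\<lambda>i x.
       case x of
         Some k \<Rightarrow> ret x
       | None \<Rightarrow> do { y \<leftarrow> get_mat R i j; z \<leftarrow> eq_tm y 0; ret (if z then None else Some i) })"
  define I where "I = (\<lambda>i0 x. case x of
      None \<Rightarrow> \<forall>i<i0. R $$ (i, j) = 0
    | Some i \<Rightarrow> i < i0 \<and> R $$ (i, j) \<noteq> 0 \<and> (\<forall>i'<i. R $$ (i', j) = 0))"
  have "I (dim_row R) (val (loop (dim_row R) f None)) \<and>
      time (loop (dim_row R) f None) \<le> 1 + dim_row R * (1 + 2)"
    by (rule loop_invariant) (auto simp: I_def f_def less_Suc_eq split: option.splits)
  then show "case val (topmost_tm R j) of
      None \<Rightarrow> \<forall>i<dim_row R. R $$ (i, j) = 0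
    | Some i \<Rightarrow> i < dim_row R \<and> R $$ (i, j) \<noteq> 0 \<and> (\<forall>i'<i. R $$ (i', j) = 0)"
    and "time (topmost_tm R j) \<le> 1 + 3 * dim_row R"
    by (simp_all add: topmost_tm_def f_def I_def)
qed

text \<open>
  The loop keeps \<open>M = R + (sum of the rank-one matrices split off so far)\<close>. Subtracting the rank-one
  matrix through a pivot at \<open>(i, j)\<close> clears row \<open>i\<close> and column \<open>j\<close> of \<open>R\<close>, and cleared rows and
  columns stay zero. So a row is used as a pivot row at most once, column \<open>i\<close> of \<open>L\<close> and row \<open>j\<close> of
  \<open>U\<close> are written once and not disturbed later, and \<open>R = 0\<close> in the end. The new column of \<open>L\<close>
  vanishes above \<open>i\<close> because the pivot is topmost, and the new row of \<open>U\<close> vanishes before \<open>j\<close> because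
  earlier columns of \<open>R\<close> are already zero. Both have a non-zero diagonal entry, namely the pivot
  and \<open>1\<close>.
\<close>

lemma factor_LQU:
  fixes M :: "'a::field mat"
  assumes M: "M \<in> carrier_mat r c" and w: "r \<le> w" "c \<le> w" "1 \<le> w"
  obtains L Q U where "val (factor_LQU_tm M) = (L, Q, U)"
    and "L \<in> carrier_mat r r" "lower L" "nonzero_diagonal L"
    and "U \<in> carrier_mat c c" "upper U" "nonzero_diagonal U"
    and "sparse_in r c Q" "M = L * mat_of_sparse Q * U"
    and "time (factor_LQU_tm M) \<le> 38 * w ^ 3"
proof -
  define newL where "newL = (\<lambda>j i (R :: 'a mat) L. new_mat r r (\<lambda>a b. do {
       t \<leftarrow> eq_tm b i; if t then get_mat R a j else get_mat L a b }))"
  define newU where "newU = (\<lambda>j i x (R :: 'a mat) U. new_mat c c (\<lambda>a b. do {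
       t \<leftarrow> eq_tm a j;
       if t then do { y \<leftarrow> get_mat R i b; div_tm y x } else get_mat U a b }))"
  define newR where "newR = (\<lambda>j i x (R :: 'a mat). new_mat r c (\<lambda>a b. do {
       u \<leftarrow> get_mat R a j;
       v \<leftarrow> get_mat R i b;
       w \<leftarrow> mul_tm u v;
       w' \<leftarrow> div_tm w x;
       y \<leftarrow> get_mat R a b;
       sub_tm y w' }))"
  define f where "f = (\<lambda>j (R, L, U, q). do {
       pos \<leftarrow> topmost_tm R j;
       case pos of
         None \<Rightarrow> ret (R, L, U, q)
       | Some i \<Rightarrow> do {
           x \<leftarrow> get_mat R i j;
           L' \<leftarrow> newL j i R L;
           U' \<leftarrow> newU j i x R U;
           R' \<leftarrow> newR j i x R;
           q' \<leftarrow> put q j (Some i);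
           ret (R', L', U', q')
         } })"
  have p: "factor_LQU_tm M = do {
      L \<leftarrow> id_mat_tm r;
      U \<leftarrow> id_mat_tm c;
      q \<leftarrow> new_vec c (\<lambda>j. ret None);
      (R, L, U, q) \<leftarrow> loop c f (M, L, U, q);
      ret (L, (r, q), U) }"
    using M unfolding factor_LQU_tm_def f_def newL_def newU_def newR_def by simp
  define I where "I = (\<lambda>j (R, L, U, q :: nat option vec).
     R \<in> carrier_mat r c \<and> L \<in> carrier_mat r r \<and> U \<in> carrier_mat c c \<and> dim_vec q = c \<and>
     lower L \<and> nonzero_diagonal L \<and> upper U \<and> nonzero_diagonal U \<and>
     (\<forall>j'<c. q $ j' \<noteq> None \<longrightarrow> j' < j) \<and>
     (\<forall>j' i. j' < c \<longrightarrow> q $ j' = Some i \<longrightarrow> i < r \<and> (\<forall>b<c. R $$ (i, b) = 0)) \<and>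
     (\<forall>j' j'' i. j' < c \<longrightarrow> j'' < c \<longrightarrow> q $ j' = Some i \<longrightarrow> q $ j'' = Some i \<longrightarrow> j' = j'') \<and>
     (\<forall>a<r. \<forall>b<c. b < j \<longrightarrow> R $$ (a, b) = 0) \<and>
     (\<forall>a<r. \<forall>b<c. M $$ (a, b) = R $$ (a, b) +
        (\<Sum>j'<j. case q $ j' of None \<Rightarrow> 0 | Some i \<Rightarrow> L $$ (a, i) * U $$ (j', b))))"
  define none where "none = vec c (\<lambda>j. None :: nat option)"
  have loop: "I c (val (loop c f (M, 1\<^sub>m r, 1\<^sub>m c, none))) \<and>
      time (loop c f (M, 1\<^sub>m r, 1\<^sub>m c, none)) \<le> 1 + c * (1 + 26 * w ^ 2)"
  proof (rule loop_invariant)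
    show "I 0 (M, 1\<^sub>m r, 1\<^sub>m c, none)"
      using M by (auto simp: I_def none_def triangular_def nonzero_diagonal_def split: if_splits)
    show "I (Suc j) (val (f j s))" if j: "j < c" and I: "I j s" for j s
    proof -
      obtain R L U q where s: "s = (R, L, U, q)"
        by (cases s)
      from I have R: "R \<in> carrier_mat r c" and L: "L \<in> carrier_mat r r"
        and U: "U \<in> carrier_mat c c" and q: "dim_vec q = c"
        and tri: "lower L" "nonzero_diagonal L" "upper U" "nonzero_diagonal U"
        and qj: "\<And>j'. j' < c \<Longrightarrow> q $ j' \<noteq> None \<Longrightarrow> j' < j"
        and qr: "\<And>j' i. j' < c \<Longrightarrow> q $ j' = Some i \<Longrightarrow> i < r"
        and qR: "\<And>j' i b. j' < c \<Longrightarrow> q $ j' = Some i \<Longrightarrow> b < c \<Longrightarrow> R $$ (i, b) = 0"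
        and qinj: "\<And>j' j'' i. j' < c \<Longrightarrow> j'' < c \<Longrightarrow> q $ j' = Some i \<Longrightarrow> q $ j'' = Some i \<Longrightarrow> j' = j''"
        and Rz: "\<And>a b. a < r \<Longrightarrow> b < c \<Longrightarrow> b < j \<Longrightarrow> R $$ (a, b) = 0"
        and sum: "\<And>a b. a < r \<Longrightarrow> b < c \<Longrightarrow> M $$ (a, b) = R $$ (a, b) +
          (\<Sum>j'<j. case q $ j' of None \<Rightarrow> 0 | Some i \<Rightarrow> L $$ (a, i) * U $$ (j', b))"
        unfolding I_def s prod.case by blast+
      have qj0: "q $ j = None"
        using qj[OF j] by blast
      show ?thesis
      proof (cases "val (topmost_tm R j)")
        case None
        then have z: "R $$ (a, j) = 0" if "a < r" for a
          using topmost(1)[of R j] R that by auto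
        have "I (Suc j) (R, L, U, q)"
          unfolding I_def prod.case
        proof (intro conjI)
          show "\<forall>a<r. \<forall>b<c. b < Suc j \<longrightarrow> R $$ (a, b) = 0"
            using Rz z by (auto simp: less_Suc_eq)
          show "\<forall>a<r. \<forall>b<c. M $$ (a, b) = R $$ (a, b) +
              (\<Sum>j'<Suc j. case q $ j' of None \<Rightarrow> 0 | Some i \<Rightarrow> L $$ (a, i) * U $$ (j', b))"
            using sum qj0 by simp
          show "\<forall>j'<c. q $ j' \<noteq> None \<longrightarrow> j' < Suc j"
            using qj less_SucI by blast
        qed (use R L U q tri qr qR qinj in blast)+
        moreover have "val (f j s) = (R, L, U, q)"
          by (simp add: f_def s None)
        ultimately show ?thesis
          by simp
      next
        case (Some i)
        define x where "x = R $$ (i, j)"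
        have i: "i < r" and x: "x \<noteq> 0" and top: "\<And>a. a < i \<Longrightarrow> R $$ (a, j) = 0"
          using topmost(1)[of R j] R Some by (auto simp: x_def)
        define L' where "L' = mat r r (\<lambda>(a, b). if b = i then R $$ (a, j) else L $$ (a, b))"
        define U' where "U' = mat c c (\<lambda>(a, b). if a = j then R $$ (i, b) / x else U $$ (a, b))"
        define R' where "R' = mat r c (\<lambda>(a, b). R $$ (a, b) - R $$ (a, j) * R $$ (i, b) / x)"
        define q' where "q' = q |\<^sub>v j \<mapsto> Some i"
        have q': "dim_vec q' = c" "q' $ j = Some i" "\<And>j'. j' \<noteq> j \<Longrightarrow> q' $ j' = q $ j'"
          using j q by (auto simp: q'_def)
        have fresh: "q $ j' \<noteq> Some i" if "j' < c" for j'
          using qR[OF that _ j] x by (auto simp: x_def)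
        have v: "val (f j s) = (R', L', U', q')"
          using R by (simp add: f_def s Some newL_def newU_def newR_def L'_def U'_def R'_def q'_def
              x_def if_distrib cong: if_cong)
        have "I (Suc j) (R', L', U', q')"
          unfolding I_def prod.case
        proof (intro conjI)
          show "R' \<in> carrier_mat r c" "L' \<in> carrier_mat r r" "U' \<in> carrier_mat c c" "dim_vec q' = c"
            by (simp_all add: R'_def L'_def U'_def q'_def q)
          show "lower L'"
            using tri(1) L top by (force simp: triangular_def L'_def not_less[symmetric])
          show "nonzero_diagonal L'"
            using tri(2) L x by (auto simp: nonzero_diagonal_def L'_def x_def)
          show "upper U'"
            using tri(3) U Rz[OF i] by (force simp: triangular_def U'_def not_less[symmetric])
          show "nonzero_diagonal U'"
            using tri(4) U x by (auto simp: nonzero_diagonal_def U'_def x_def)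
          show "\<forall>j'<c. q' $ j' \<noteq> None \<longrightarrow> j' < Suc j"
            using qj q' by (metis less_Suc_eq)
          show "\<forall>j' i'. j' < c \<longrightarrow> q' $ j' = Some i' \<longrightarrow> i' < r \<and> (\<forall>b<c. R' $$ (i', b) = 0)"
          proof (intro allI impI)
            fix j' i' assume *: "j' < c" "q' $ j' = Some i'"
            show "i' < r \<and> (\<forall>b<c. R' $$ (i', b) = 0)"
            proof (cases "j' = j")
              case True
              then show ?thesis
                using * q' i x j by (auto simp: R'_def x_def)
            next
              case False
              then have "q $ j' = Some i'"
                using * q' by simp
              then show ?thesis
                using qr[OF *(1)] qR[OF *(1)] j by (auto simp: R'_def)
            qed
          qed
          show "\<forall>j' j'' i. j' < c \<longrightarrow> j'' < c \<longrightarrow> q' $ j' = Some i \<longrightarrow> q' $ j'' = Some i \<longrightarrow> j' = j''"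
            using qinj fresh q' by metis
          show "\<forall>a<r. \<forall>b<c. b < Suc j \<longrightarrow> R' $$ (a, b) = 0"
            using Rz i x by (auto simp: R'_def x_def less_Suc_eq)
          show "\<forall>a<r. \<forall>b<c. M $$ (a, b) = R' $$ (a, b) +
              (\<Sum>j'<Suc j. case q' $ j' of None \<Rightarrow> 0 | Some i \<Rightarrow> L' $$ (a, i) * U' $$ (j', b))"
          proof (intro allI impI)
            fix a b assume ab: "a < r" "b < c"
            have "(\<Sum>j'<j. case q' $ j' of None \<Rightarrow> 0 | Some i \<Rightarrow> L' $$ (a, i) * U' $$ (j', b)) =
                (\<Sum>j'<j. case q $ j' of None \<Rightarrow> 0 | Some i \<Rightarrow> L $$ (a, i) * U $$ (j', b))"
            proof (rule sum.cong)
              fix j' assume "j' \<in> {..<j}"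
              then have j': "j' < j" "j' < c"
                using j by auto
              then show "(case q' $ j' of None \<Rightarrow> 0 | Some i \<Rightarrow> L' $$ (a, i) * U' $$ (j', b)) =
                  (case q $ j' of None \<Rightarrow> 0 | Some i \<Rightarrow> L $$ (a, i) * U $$ (j', b))"
                using q' fresh[OF j'(2)] qr[OF j'(2)] ab
                by (auto simp: L'_def U'_def split: option.split)
            qed simp
            then show "M $$ (a, b) = R' $$ (a, b) +
              (\<Sum>j'<Suc j. case q' $ j' of None \<Rightarrow> 0 | Some i \<Rightarrow> L' $$ (a, i) * U' $$ (j', b))"
              using sum[OF ab] q'(2) ab i j by (simp add: L'_def U'_def R'_def)
          qed
        qed
        then show ?thesis
          by (simp add: v)
      qed
    qed
    show "time (f j s) \<le> 26 * w ^ 2" if "j < c" "I j s" for j s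
    proof -
      obtain R L U q where s: "s = (R, L, U, q)"
        by (cases s)
      have R: "dim_row R = r"
        using \<open>I j s\<close> by (auto simp: s I_def)
      have t: "time (topmost_tm R j) \<le> 1 + 3 * w"
        using topmost(2)[of R j] R w by linarith
      have tL: "time (newL j i R L) \<le> 5 * w ^ 2" for i
        unfolding newL_def by (rule order_trans[OF time_new_mat_const[OF w(1,1,3), where s = 2]]) auto
      have tU: "time (newU j i x R U) \<le> 6 * w ^ 2" for i x
        unfolding newU_def by (rule order_trans[OF time_new_mat_const[OF w(2,2,3), where s = 3]]) auto
      have tR: "time (newR j i x R) \<le> 9 * w ^ 2" for i x
        unfolding newR_def by (rule order_trans[OF time_new_mat_const[OF w(1,2,3), where s = 6]]) auto
      have pow: "1 \<le> w ^ 2" "w \<le> w ^ 2"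
        using w by (simp_all add: power2_eq_square)
      show ?thesis
      proof (cases "val (topmost_tm R j)")
        case None
        then show ?thesis
          using t pow by (simp add: f_def s)
      next
        case (Some i)
        then show ?thesis
          using t pow tL[of i] tU[of i "R $$ (i, j)"] tR[of i "R $$ (i, j)"] by (simp add: f_def s)
      qed
    qed
  qed
  obtain R L U q where l: "val (loop c f (M, 1\<^sub>m r, 1\<^sub>m c, none)) = (R, L, U, q)"
    by (cases "val (loop c f (M, 1\<^sub>m r, 1\<^sub>m c, none))")
  have vn: "vec c (\<lambda>j. None) = none"
    by (simp add: none_def)
  have inv: "I c (val (loop c f (M, 1\<^sub>m r, 1\<^sub>m c, none)))"
    using loop by blast
  from inv have R: "R \<in> carrier_mat r c" and L: "L \<in> carrier_mat r r"
    and U: "U \<in> carrier_mat c c" and q: "dim_vec q = c"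
    and tri: "lower L" "nonzero_diagonal L" "upper U" "nonzero_diagonal U"
    and qr: "\<And>j' i. j' < c \<Longrightarrow> q $ j' = Some i \<Longrightarrow> i < r"
    and qinj: "\<And>j' j'' i. j' < c \<Longrightarrow> j'' < c \<Longrightarrow> q $ j' = Some i \<Longrightarrow> q $ j'' = Some i \<Longrightarrow> j' = j''"
    and Rz: "\<And>a b. a < r \<Longrightarrow> b < c \<Longrightarrow> R $$ (a, b) = 0"
    and sum: "\<And>a b. a < r \<Longrightarrow> b < c \<Longrightarrow> M $$ (a, b) = R $$ (a, b) +
      (\<Sum>j'<c. case q $ j' of None \<Rightarrow> 0 | Some i \<Rightarrow> L $$ (a, i) * U $$ (j', b))"
    unfolding I_def l prod.case by blast+
  show thesis
  proof
    show "val (factor_LQU_tm M) = (L, (r, q), U)"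
      by (simp add: p id_mat(1) vn l)
    show "L \<in> carrier_mat r r" "lower L" "nonzero_diagonal L"
      "U \<in> carrier_mat c c" "upper U" "nonzero_diagonal U"
      by (fact L U tri)+
    show Q: "sparse_in r c (r, q)"
      unfolding sparse_in_def entry_def fst_conv snd_conv q using qr qinj by blast
    show "M = L * mat_of_sparse (r, q) * U"
    proof (rule eq_matI)
      note QC = mat_of_sparse_carrier[OF Q, where 'a = 'a]
      have LQ: "L * mat_of_sparse (r, q) \<in> carrier_mat r c"
        using L QC by simp
      fix a b assume "a < dim_row (L * mat_of_sparse (r, q) * U)"
        "b < dim_col (L * mat_of_sparse (r, q) * U)"
      then have ab: "a < r" "b < c"
        using L U by auto
      have "(L * mat_of_sparse (r, q) * U) $$ (a, b) =
          (\<Sum>k<c. (L * mat_of_sparse (r, q)) $$ (a, k) * U $$ (k, b))"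
        by (rule index_mult_mat_sum[OF LQ U ab])
      also have "\<dots> = (\<Sum>k<c. case q $ k of None \<Rightarrow> 0 | Some i \<Rightarrow> L $$ (a, i) * U $$ (k, b))"
        using ab mult_mat_of_sparse_index[OF Q L]
        by (intro sum.cong) (auto split: option.split)
      finally show "M $$ (a, b) = (L * mat_of_sparse (r, q) * U) $$ (a, b)"
        using sum[OF ab] Rz[OF ab] by simp
    qed (use M L U in auto)
    show "time (factor_LQU_tm M) \<le> 38 * w ^ 3"
    proof -
      have "1 + c * (1 + 26 * w ^ 2) \<le> w ^ 3 + w * (w ^ 2 + 26 * w ^ 2)"
        using w by (intro add_mono mult_mono) (auto simp: Suc_le_eq)
      then have "time (loop c f (M, 1\<^sub>m r, 1\<^sub>m c, none)) \<le> 28 * w ^ 3"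
        using loop by (simp add: power3_eq_cube power2_eq_square)
      moreover have "time (new_vec c (\<lambda>j. ret (None :: nat option))) \<le> 1 + w"
        using time_new_vec_le[of c "\<lambda>j. ret (None :: nat option)" 0] w by simp
      moreover have "1 \<le> w ^ 3" "w \<le> w ^ 3" "w ^ 2 \<le> w ^ 3"
        using w power_increasing[of 1 3 w] by (simp_all add: power_increasing)
      moreover note id_mat(2)[OF w(1,3), where 'a = 'a] id_mat(2)[OF w(2,3), where 'a = 'a]
      ultimately show ?thesis
        by (simp add: p id_mat(1) vn l)
    qed
  qed
qed

lemma factor_UQL:
  fixes M :: "'a::field mat"
  assumes M: "M \<in> carrier_mat r c" and w: "r \<le> w" "c \<le> w" "1 \<le> w"
  obtains U Q L where "val (factor_UQL_tm M) = (U, Q, L)"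
    and "U \<in> carrier_mat r r" "upper U" "nonzero_diagonal U"
    and "L \<in> carrier_mat c c" "lower L" "nonzero_diagonal L"
    and "sparse_in r c Q" "M = U * mat_of_sparse Q * L"
    and "time (factor_UQL_tm M) \<le> 69 * w ^ 3"
proof -
  obtain L Q U where v: "val (factor_LQU_tm (flip_mat M)) = (L, Q, U)"
    and L: "L \<in> carrier_mat r r" "lower L" "nonzero_diagonal L"
    and U: "U \<in> carrier_mat c c" "upper U" "nonzero_diagonal U"
    and Q: "sparse_in r c Q" and e: "flip_mat M = L * mat_of_sparse Q * U"
    and t: "time (factor_LQU_tm (flip_mat M)) \<le> 38 * w ^ 3"
    using factor_LQU[OF flip_mat_carrier[OF M] w] by metis
  have p: "val (factor_UQL_tm M) = (flip_mat L, flip_sparse Q, flip_mat U)"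
    by (simp add: factor_UQL_tm_def v)
  show thesis
  proof (rule that[OF p])
    show "flip_mat L \<in> carrier_mat r r" "upper (flip_mat L)" "nonzero_diagonal (flip_mat L)"
      using L upper_flip_mat nonzero_diagonal_flip_mat by auto
    show "flip_mat U \<in> carrier_mat c c" "lower (flip_mat U)" "nonzero_diagonal (flip_mat U)"
      using U lower_flip_mat nonzero_diagonal_flip_mat by auto
    show "sparse_in r c (flip_sparse Q)"
      using flip_sparse(1)[OF Q] .
    have "M = flip_mat (L * mat_of_sparse Q * U)"
      using e by (metis flip_flip_mat)
    also have "\<dots> = flip_mat (L * mat_of_sparse Q) * flip_mat U"
      by (rule flip_mat_mult[OF mult_carrier_mat[OF L(1) mat_of_sparse_carrier[OF Q]] U(1)])
    also have "\<dots> = flip_mat L * mat_of_sparse (flip_sparse Q) * flip_mat U"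
      using flip_mat_mult[OF L(1) mat_of_sparse_carrier[OF Q]] by (simp add: flip_mat_of_sparse[OF Q])
    finally show "M = flip_mat L * mat_of_sparse (flip_sparse Q) * flip_mat U" .
    show "time (factor_UQL_tm M) \<le> 69 * w ^ 3"
    proof -
      have "1 \<le> w ^ 3" "w \<le> w ^ 3" "w ^ 2 \<le> w ^ 3"
        using w power_increasing[of 1 3 w] by (simp_all add: power_increasing)
      then show ?thesis
        using t time_flip_mat_tm[OF M w] time_flip_mat_tm[OF L(1) w(1,1,3)]
          time_flip_mat_tm[OF U(1) w(2,2,3)] flip_sparse(3)[OF Q] w
        by (simp add: factor_UQL_tm_def v)
    qed
  qed
qed

section \<open>Moving triangular factors past shapes\<close>

text \<open>
  The matrix \<open>X'\<close> in \<open>X \<sigma> = \<sigma> X'\<close>, for a partial index map \<open>\<sigma>\<close> stored as \<open>S\<close>. Outside the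
  domain of \<open>\<sigma>\<close> it is filled up with entries of the identity, which makes \<open>X'\<close> invertible.
\<close>

definition lift :: "sparse \<Rightarrow> 'a::field mat \<Rightarrow> 'a mat" where
  "lift S X = mat (dim_vec (snd S)) (dim_vec (snd S)) (\<lambda>(a, b).
     case (snd S $ a, snd S $ b) of
       (Some i, Some j) \<Rightarrow> X $$ (i, j)
     | _ \<Rightarrow> if a = b then 1 else 0)"

lemma lift_carrier: "sparse_in n m S \<Longrightarrow> lift S X \<in> carrier_mat m m"
  by (simp add: lift_def sparse_in_dims)

lemma val_lift_tm [simp]: "val (lift_tm S X) = lift S X"
  by (cases S) (auto simp: lift_tm_def lift_def intro!: eq_matI split: option.split)

lemma time_lift_tm:
  assumes "sparse_in n m S" "m \<le> w" "1 \<le> w"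
  shows "time (lift_tm S X) \<le> 6 * w ^ 2"
  using sparse_in_dims[OF assms(1)] assms(2,3)
  by (cases S) (auto simp: lift_tm_def split: option.split
      intro!: order_trans[OF time_new_mat_const[where s = 3 and w = w]])

lemma lift_entry:
  assumes "entry S i a" "entry S j b"
  shows "lift S X $$ (a, b) = X $$ (i, j)"
  using assms by (simp add: lift_def entry_def)

lemma lift_no_entry:
  assumes "sparse_in n m S" "a < m" "b < m" "(\<nexists>i. entry S i a) \<or> (\<nexists>j. entry S j b)"
  shows "lift S X $$ (a, b) = (if a = b then 1 else 0)"
  using assms sparse_in_dims[OF assms(1)]
  by (auto simp: lift_def entry_def split: option.split)

lemma lift_id:
  assumes "X \<in> carrier_mat n n"
  shows "lift (val (id_sparse_tm n)) X = X"
  using assms by (auto simp: lift_def id_sparse_tm_def intro!: eq_matI)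

lemma lift_transpose:
  assumes "sparse_in n m S" "X \<in> carrier_mat n n"
  shows "lift S X\<^sup>T = (lift S X)\<^sup>T"
proof (rule eq_matI)
  fix a b assume "a < dim_row (lift S X)\<^sup>T" "b < dim_col (lift S X)\<^sup>T"
  then have ab: "a < m" "b < m"
    using lift_carrier[OF assms(1), of X] by auto
  show "lift S X\<^sup>T $$ (a, b) = (lift S X)\<^sup>T $$ (a, b)"
  proof (cases "(\<nexists>i. entry S i a) \<or> (\<nexists>j. entry S j b)")
    case True
    then show ?thesis
      using ab lift_carrier[OF assms(1), of X] lift_no_entry[OF assms(1) ab True, of "X\<^sup>T"]
        lift_no_entry[OF assms(1) ab(2,1), of X] by auto
  next
    case False
    then obtain i j where e: "entry S i a" "entry S j b"
      by blast
    then show ?thesis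
      using ab lift_carrier[OF assms(1), of X] lift_entry[OF e, of "X\<^sup>T"] lift_entry[OF e(2,1), of X]
        entry_bounds(1)[OF assms(1) e(1)] entry_bounds(1)[OF assms(1) e(2)] assms(2) by auto
  qed
qed (use lift_carrier[OF assms(1)] in \<open>auto simp: lift_def\<close>)

text \<open>
  Lifting is functorial, so a factor on its way through several edges can be represented by the
  composed index map.
\<close>

lemma lift_mul_sparse:
  assumes S: "sparse_in n m S" and T: "sparse_in m l T"
  shows "lift (mul_sparse S T) X = lift T (lift S X)"
proof (rule eq_matI)
  note ST = mul_sparse(1,2)[OF S T]
  fix a b assume "a < dim_row (lift T (lift S X))" "b < dim_col (lift T (lift S X))"
  then have ab: "a < l" "b < l"
    using lift_carrier[OF T, of "lift S X"] by auto
  show "lift (mul_sparse S T) X $$ (a, b) = lift T (lift S X) $$ (a, b)"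
  proof (cases "(\<nexists>i. entry T i a) \<or> (\<nexists>j. entry T j b)")
    case True
    then have "(\<nexists>i. entry (mul_sparse S T) i a) \<or> (\<nexists>j. entry (mul_sparse S T) j b)"
      unfolding ST(2) by blast
    then show ?thesis
      using lift_no_entry[OF ST(1) ab, of X] lift_no_entry[OF T ab True, of "lift S X"] by simp
  next
    case False
    then obtain k k' where k: "entry T k a" "entry T k' b"
      by blast
    have kb: "k < m" "k' < m"
      using entry_bounds[OF T k(1)] entry_bounds[OF T k(2)] by auto
    show ?thesis
    proof (cases "(\<nexists>i. entry S i k) \<or> (\<nexists>j. entry S j k')")
      case True
      then have *: "(\<nexists>i. entry (mul_sparse S T) i a) \<or> (\<nexists>j. entry (mul_sparse S T) j b)"
        unfolding ST(2) using k entry_row_unique by metis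
      have "k = k' \<longleftrightarrow> a = b"
        using k entry_row_unique entry_column_unique[OF T] by metis
      then show ?thesis
        using lift_no_entry[OF ST(1) ab *, of X] lift_no_entry[OF S kb True, of X]
          lift_entry[OF k, of "lift S X"] by simp
    next
      case False
      then obtain i j where e: "entry S i k" "entry S j k'"
        by blast
      then have "entry (mul_sparse S T) i a" "entry (mul_sparse S T) j b"
        unfolding ST(2) using k by blast+
      then show ?thesis
        using lift_entry[of _ i a j b X] lift_entry[OF k, of "lift S X"] lift_entry[OF e, of X]
          by simp
    qed
  qed
qed (use lift_carrier[OF mul_sparse(1)[OF S T], of X] lift_carrier[OF T, of "lift S X"] in auto)

text \<open>
  Initial and final segments have the property that is needed to lift inverse matrices: they are
  convex.
\<close>

definition rows_convex :: "sparse \<Rightarrow> bool" where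
  "rows_convex S \<longleftrightarrow>
     (\<forall>i a j b k. entry S i a \<and> entry S j b \<and> i \<le> k \<and> k \<le> j \<longrightarrow> (\<exists>c. entry S k c))"

lemma triangular_lift:
  assumes S: "sparse_in n m S" and inc: "increasing S" and X: "X \<in> carrier_mat n n"
    and R: "R \<in> {(\<le>), (\<ge>)}" and tri: "triangular R X"
  shows "triangular R (lift S X)"
  unfolding triangular_def
proof (intro allI impI)
  fix a b assume "a < dim_row (lift S X)" "b < dim_col (lift S X)" and nz: "lift S X $$ (a, b) \<noteq> 0"
  then have ab: "a < m" "b < m"
    using lift_carrier[OF S, of X] by auto
  show "R a b"
  proof (cases "(\<nexists>i. entry S i a) \<or> (\<nexists>j. entry S j b)")
    case True
    then have "a = b"
      using lift_no_entry[OF S ab True, of X] nz by (auto split: if_splits)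
    then show ?thesis
      using R by auto
  next
    case False
    then obtain i j where e: "entry S i a" "entry S j b"
      by blast
    then have "R i j"
      using nz lift_entry[OF e, of X] entry_bounds(1)[OF S e(1)] entry_bounds(1)[OF S e(2)] tri X
      by (auto simp: triangular_def)
    moreover have "a < b \<Longrightarrow> i < j" "b < a \<Longrightarrow> j < i"
      using inc e unfolding increasing_def by blast+
    ultimately show ?thesis
      using R by (auto simp: not_less[symmetric])
  qed
qed

text \<open>
  On the domain of \<open>\<sigma>\<close>, an entry of the product of the lifted matrices is the partial sum of
  \<open>(X X')\<^sub>i\<^sub>j\<close> over the indices \<open>k\<close> in the image of \<open>\<sigma>\<close>, where \<open>i\<close> and \<open>j\<close> belong to the image as
  well. No term is lost: if \<open>X\<^sub>i\<^sub>k X'\<^sub>k\<^sub>j\<close> is non-zero, then triangularity puts \<open>k\<close> between \<open>i\<close> and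
  \<open>j\<close>, hence into the image by convexity.
\<close>

lemma lift_mult_inverse:
  assumes S: "sparse_in n m S" and conv: "rows_convex S"
    and X: "X \<in> carrier_mat n n" and X': "X' \<in> carrier_mat n n" and inv: "X * X' = 1\<^sub>m n"
    and R: "R \<in> {(\<le>), (\<ge>)}" and tri: "triangular R X" "triangular R X'"
  shows "lift S X * lift S X' = 1\<^sub>m m"
proof (rule eq_matI)
  note c = lift_carrier[OF S, of X] lift_carrier[OF S, of X']
  fix a b assume "a < dim_row (1\<^sub>m m :: 'a mat)" "b < dim_col (1\<^sub>m m :: 'a mat)"
  then have ab: "a < m" "b < m"
    by auto
  have sum: "(lift S X * lift S X') $$ (a, b) = (\<Sum>k<m. lift S X $$ (a, k) * lift S X' $$ (k, b))"
    by (rule index_mult_mat_sum[OF c ab])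
  show "(lift S X * lift S X') $$ (a, b) = 1\<^sub>m m $$ (a, b)"
  proof (cases "\<exists>i. entry S i a")
    case False
    then have "lift S X $$ (a, k) = (if a = k then 1 else 0)" if "k < m" for k
      using lift_no_entry[OF S ab(1) that] by blast
    then have "(lift S X * lift S X') $$ (a, b) = (\<Sum>k<m. if a = k then lift S X' $$ (k, b) else 0)"
      unfolding sum by (intro sum.cong) auto
    also have "\<dots> = lift S X' $$ (a, b)"
      using ab by simp
    finally show ?thesis
      using lift_no_entry[OF S ab, of X] lift_no_entry[OF S ab, of X'] False ab by auto
  next
    case a: True
    show ?thesis
    proof (cases "\<exists>j. entry S j b")
      case False
      then have "lift S X' $$ (k, b) = (if k = b then 1 else 0)" if "k < m" for k
        using lift_no_entry[OF S that ab(2)] by blast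
      then have "(lift S X * lift S X') $$ (a, b) = (\<Sum>k<m. if k = b then lift S X $$ (a, k) else 0)"
        unfolding sum by (intro sum.cong) auto
      also have "\<dots> = lift S X $$ (a, b)"
        using ab by simp
      finally show ?thesis
        using lift_no_entry[OF S ab, of X] lift_no_entry[OF S ab, of X'] False ab by auto
    next
      case True
      then obtain i j where ij: "entry S i a" "entry S j b"
        using a by blast
      then have ijn: "i < n" "j < n"
        using entry_bounds[OF S] by blast+
      define D where "D = {k. \<exists>i. entry S i k}"
      define r where "r = (\<lambda>k. the (snd S $ k))"
      have r: "entry S (r k) k" if "k \<in> D" for k
        using that by (auto simp: D_def r_def entry_def)
      have D: "D \<subseteq> {..<m}"
        using entry_bounds[OF S] by (auto simp: D_def)
      have "(\<Sum>k<m. lift S X $$ (a, k) * lift S X' $$ (k, b)) =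
          (\<Sum>k\<in>D. lift S X $$ (a, k) * lift S X' $$ (k, b))"
      proof (rule sum.mono_neutral_right)
        show "\<forall>k\<in>{..<m} - D. lift S X $$ (a, k) * lift S X' $$ (k, b) = 0"
        proof
          fix k assume k: "k \<in> {..<m} - D"
          then have "lift S X $$ (a, k) = (if a = k then 1 else 0)"
            using lift_no_entry[OF S ab(1), of k X] by (auto simp: D_def)
          moreover have "a \<noteq> k"
            using k ij by (auto simp: D_def)
          ultimately show "lift S X $$ (a, k) * lift S X' $$ (k, b) = 0"
            by simp
        qed
      qed (use D in auto)
      also have "\<dots> = (\<Sum>k\<in>D. X $$ (i, r k) * X' $$ (r k, j))"
        by (intro sum.cong) (simp_all add: lift_entry[OF ij(1) r] lift_entry[OF r ij(2)])
      also have "\<dots> = (\<Sum>k\<in>r ` D. X $$ (i, k) * X' $$ (k, j))"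
      proof (subst sum.reindex)
        show "inj_on r D"
          using r entry_column_unique[OF S] by (metis inj_onI)
      qed simp
      also have "\<dots> = (\<Sum>k<n. X $$ (i, k) * X' $$ (k, j))"
      proof (rule sum.mono_neutral_left)
        show "r ` D \<subseteq> {..<n}"
          using r entry_bounds[OF S] by blast
        show "\<forall>k\<in>{..<n} - r ` D. X $$ (i, k) * X' $$ (k, j) = 0"
        proof (rule ballI, rule ccontr)
          fix k assume k: "k \<in> {..<n} - r ` D" and nz: "X $$ (i, k) * X' $$ (k, j) \<noteq> 0"
          then have "R i k" "R k j"
            using tri X X' ijn by (auto simp: triangular_def)
          then have "\<exists>c. entry S k c"
            using R ij conv unfolding rows_convex_def by auto
          then obtain c where c: "entry S k c"
            by blast
          then have "c \<in> D"
            by (auto simp: D_def)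
          then have "k = r c"
            using r c entry_row_unique by blast
          then show False
            using k \<open>c \<in> D\<close> by blast
        qed
      qed simp
      also have "\<dots> = (X * X') $$ (i, j)"
        by (rule index_mult_mat_sum[OF X X' ijn, symmetric])
      also have "\<dots> = (if i = j then 1 else 0)"
        using ijn by (simp add: inv)
      also have "\<dots> = 1\<^sub>m m $$ (a, b)"
      proof -
        have "i = j \<longleftrightarrow> a = b"
          using ij entry_row_unique entry_column_unique[OF S] by metis
        then show ?thesis
          using ab by simp
      qed
      finally show ?thesis
        unfolding sum .
    qed
  qed
qed (use lift_carrier[OF S, of X] lift_carrier[OF S, of X'] in auto)

lemma mat_of_sparse_mult_index:
  fixes X :: "'a::field mat"
  assumes S: "sparse_in r c S" and X: "X \<in> carrier_mat c n" and ab: "a < r" "b < n"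
  shows "entry S a k \<Longrightarrow> (mat_of_sparse S * X) $$ (a, b) = X $$ (k, b)"
    and "(\<nexists>k. entry S a k) \<Longrightarrow> (mat_of_sparse S * X) $$ (a, b) = 0"
proof -
  have *: "(mat_of_sparse S * X) $$ (a, b) = (\<Sum>k<c. if entry S a k then X $$ (k, b) else 0)"
    unfolding index_mult_mat_sum[OF mat_of_sparse_carrier[OF S] X ab]
    using ab by (intro sum.cong) (auto simp: mat_of_sparse_index[OF S])
  show "(mat_of_sparse S * X) $$ (a, b) = X $$ (k, b)" if e: "entry S a k"
  proof -
    have "entry S a k' \<longleftrightarrow> k' = k" for k'
      using e entry_column_unique[OF S] by blast
    then show ?thesis
      unfolding * using entry_bounds(2)[OF S e] by simp
  qed
  show "(mat_of_sparse S * X) $$ (a, b) = 0" if "\<nexists>k. entry S a k"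
    unfolding * using that by (auto intro: sum.neutral)
qed

text \<open>
  Both sides contain the columns of \<open>X\<close> that lie in the image of \<open>S\<close>, moved to their new places. They
  could differ only in rows outside the image, where the right-hand side is zero.
\<close>

lemma commute_sparse_right:
  fixes X :: "'a::field mat"
  assumes S: "sparse_in n m S" and X: "X \<in> carrier_mat n n"
    and zero: "\<And>k i b. k < n \<Longrightarrow> (\<nexists>a. entry S k a) \<Longrightarrow> entry S i b \<Longrightarrow> X $$ (k, i) = 0"
  shows "X * mat_of_sparse S = mat_of_sparse S * lift S X"
proof (rule eq_matI)
  note SC = mat_of_sparse_carrier[OF S, where 'a = 'a]
  note LC = lift_carrier[OF S, of X]
  show "dim_row (X * mat_of_sparse S) = dim_row (mat_of_sparse S * lift S X)"
    "dim_col (X * mat_of_sparse S) = dim_col (mat_of_sparse S * lift S X)"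
    using SC LC X by auto
  fix a b assume "a < dim_row (mat_of_sparse S * lift S X)" "b < dim_col (mat_of_sparse S * lift S X)"
  then have ab: "a < n" "b < m"
    using SC LC by auto
  note l = mult_mat_of_sparse_index[OF S X ab]
  show "(X * mat_of_sparse S) $$ (a, b) = (mat_of_sparse S * lift S X) $$ (a, b)"
  proof (cases "snd S $ b")
    case None
    then have n: "\<nexists>i. entry S i b"
      by (simp add: entry_def)
    show ?thesis
    proof (cases "\<exists>c. entry S a c")
      case True
      then obtain c where c: "entry S a c"
        by blast
      then have "c < m" "c \<noteq> b"
        using entry_bounds[OF S] n by blast+
      then show ?thesis
        using mat_of_sparse_mult_index(1)[OF S LC ab c] lift_no_entry[OF S _ ab(2), of c X] n l None
        by simp
    next
      case False
      then show ?thesis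
        using mat_of_sparse_mult_index(2)[OF S LC ab] l None by simp
    qed
  next
    case (Some i)
    then have e: "entry S i b"
      using ab sparse_in_dims[OF S] by (simp add: entry_def)
    show ?thesis
    proof (cases "\<exists>c. entry S a c")
      case True
      then obtain c where c: "entry S a c"
        by blast
      then show ?thesis
        using mat_of_sparse_mult_index(1)[OF S LC ab c] lift_entry[OF c e, of X] l Some by simp
    next
      case False
      then show ?thesis
        using mat_of_sparse_mult_index(2)[OF S LC ab] l Some zero[OF ab(1) False e] by simp
    qed
  qed
qed

text \<open>The transpose of \<open>commute_sparse_right\<close>.\<close>

lemma commute_sparse_left:
  fixes X :: "'a::field mat"
  assumes S: "sparse_in m n S" and X: "X \<in> carrier_mat n n"
    and zero: "\<And>k i b. k < n \<Longrightarrow> (\<nexists>a. entry S a k) \<Longrightarrow> entry S b i \<Longrightarrow> X $$ (i, k) = 0"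
  shows "mat_of_sparse S * X = lift (transpose_sparse S) X * mat_of_sparse S"
proof -
  note T = transpose_sparse[OF S]
  have XT: "X\<^sup>T \<in> carrier_mat n n"
    using X by simp
  have "X\<^sup>T * mat_of_sparse (transpose_sparse S) =
      mat_of_sparse (transpose_sparse S) * lift (transpose_sparse S) X\<^sup>T"
  proof (rule commute_sparse_right[OF T(1) XT])
    fix k i b assume *: "k < n" "\<nexists>a. entry (transpose_sparse S) k a" "entry (transpose_sparse S) i b"
    then have "i < n"
      using entry_bounds[OF T(1)] by blast
    then show "X\<^sup>T $$ (k, i) = 0"
      using * zero[of k b i] X unfolding T(2) by auto
  qed
  then have "(mat_of_sparse S * X)\<^sup>T = (lift (transpose_sparse S) X * mat_of_sparse S)\<^sup>T"
    unfolding lift_transpose[OF T(1) X] mat_of_transpose_sparse[OF S]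
      transpose_mult[OF mat_of_sparse_carrier[OF S] X]
      transpose_mult[OF lift_carrier[OF T(1)] mat_of_sparse_carrier[OF S]] .
  from arg_cong[OF this, of transpose_mat] show ?thesis
    unfolding Matrix.transpose_transpose .
qed

text \<open>
  A factor carries its inverse, which is updated along with it. Changes of basis therefore never
  require the inversion of a matrix other than the triangular ones of the middle edge.
\<close>

definition factor_at :: "nat \<Rightarrow> 'a::field factor \<Rightarrow> bool" where
  "factor_at n F \<longleftrightarrow> fst F \<in> carrier_mat n n \<and> snd F \<in> carrier_mat n n \<and>
     fst F * snd F = 1\<^sub>m n \<and> snd F * fst F = 1\<^sub>m n"

definition triangular_factor :: "(nat \<Rightarrow> nat \<Rightarrow> bool) \<Rightarrow> nat \<Rightarrow> 'a::field factor \<Rightarrow> bool" where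
  "triangular_factor R n F \<longleftrightarrow> factor_at n F \<and> triangular R (fst F) \<and> triangular R (snd F)"

definition lift_factor :: "sparse \<Rightarrow> 'a::field factor \<Rightarrow> 'a factor" where
  "lift_factor S F = (lift S (fst F), lift S (snd F))"

lemma factor_atI:
  fixes X :: "'a::field mat"
  assumes "X \<in> carrier_mat n n" "X' \<in> carrier_mat n n" "X * X' = 1\<^sub>m n"
  shows "factor_at n (X, X')" "factor_at n (X', X)"
  using assms mat_mult_left_right_inverse[OF assms] by (simp_all add: factor_at_def)

lemma val_lift_factor_tm [simp]: "val (lift_factor_tm S F) = lift_factor S F"
  by (cases F) (simp add: lift_factor_tm_def lift_factor_def)

lemma time_lift_factor_tm:
  assumes "sparse_in n m S" "m \<le> w" "1 \<le> w"
  shows "time (lift_factor_tm S F) \<le> 12 * w ^ 2"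
  using time_lift_tm[OF assms, of "fst F"] time_lift_tm[OF assms, of "snd F"]
  by (cases F) (simp add: lift_factor_tm_def)

lemma lift_factor_id:
  "factor_at n F \<Longrightarrow> lift_factor (val (id_sparse_tm n)) F = F"
  by (simp add: lift_factor_def factor_at_def lift_id)

lemma lift_factor_mul_sparse:
  assumes "sparse_in n m S" "sparse_in m l T"
  shows "lift_factor (mul_sparse S T) F = lift_factor T (lift_factor S F)"
  by (simp add: lift_factor_def lift_mul_sparse[OF assms])

lemma triangular_factor_lift:
  assumes "sparse_in n m S" "increasing S" "rows_convex S"
    and R: "R \<in> {(\<le>), (\<ge>)}" and F: "triangular_factor R n F"
  shows "triangular_factor R m (lift_factor S F)"
proof -
  have c: "fst F \<in> carrier_mat n n" "snd F \<in> carrier_mat n n" "fst F * snd F = 1\<^sub>m n"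
    and tri: "triangular R (fst F)" "triangular R (snd F)"
    using F by (auto simp: triangular_factor_def factor_at_def)
  have "factor_at m (lift_factor S F)"
    unfolding lift_factor_def
    using lift_mult_inverse[OF assms(1,3) c R tri] lift_carrier[OF assms(1)] by (intro factor_atI)
  then show ?thesis
    using triangular_lift[OF assms(1,2) c(1) R tri(1)] triangular_lift[OF assms(1,2) c(2) R tri(2)]
    by (simp add: triangular_factor_def lift_factor_def)
qed

definition mul_factor :: "'a::field factor \<Rightarrow> 'a factor \<Rightarrow> 'a factor" where
  "mul_factor F G = (fst F * fst G, snd G * snd F)"

lemma factor_at_mul:
  assumes "factor_at n F" "factor_at n G"
  shows "factor_at n (mul_factor F G)"
proof -
  have c: "fst F \<in> carrier_mat n n" "snd F \<in> carrier_mat n n"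
    "fst G \<in> carrier_mat n n" "snd G \<in> carrier_mat n n"
    using assms by (auto simp: factor_at_def)
  have "(fst F * fst G) * (snd G * snd F) = fst F * ((fst G * snd G) * snd F)"
    using c by (simp add: assoc_mult_mat[of _ n n _ n _ n])
  also have "\<dots> = 1\<^sub>m n"
    using assms c by (simp add: factor_at_def)
  finally show ?thesis
    unfolding mul_factor_def using c by (intro factor_atI) auto
qed

lemma mul_factor_tm:
  assumes "factor_at n F" "factor_at n G"
  shows "val (mul_factor_tm F G) = mul_factor F G"
    and "n \<le> w \<Longrightarrow> 1 \<le> w \<Longrightarrow> time (mul_factor_tm F G) \<le> 18 * w ^ 3"
proof -
  have c: "fst F \<in> carrier_mat n n" "snd F \<in> carrier_mat n n"
    "fst G \<in> carrier_mat n n" "snd G \<in> carrier_mat n n"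
    using assms by (auto simp: factor_at_def)
  show "val (mul_factor_tm F G) = mul_factor F G"
    using mul_mat(1)[OF c(1,3)] mul_mat(1)[OF c(4,2)]
    by (cases F; cases G) (simp add: mul_factor_tm_def mul_factor_def)
  show "time (mul_factor_tm F G) \<le> 18 * w ^ 3" if "n \<le> w" "1 \<le> w"
    using mul_mat(2)[OF c(1,3), of w] mul_mat(2)[OF c(4,2), of w] that
    by (cases F; cases G) (simp add: mul_factor_tm_def)
qed

lemma mul_factor_one: "factor_at n F \<Longrightarrow> mul_factor F (1\<^sub>m n, 1\<^sub>m n) = F"
  by (cases F) (auto simp: mul_factor_def factor_at_def)

definition perm_factor :: "sparse \<Rightarrow> 'a::field factor" where
  "perm_factor P = (mat_of_sparse P, (mat_of_sparse P)\<^sup>T)"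

lemma perm_factor_at:
  assumes "perm_sparse c P"
  shows "factor_at c (perm_factor P :: 'a::field factor)"
proof -
  have P: "sparse_in c c P"
    using assms by (simp add: perm_sparse_def)
  note C = mat_of_sparse_carrier[OF P, where 'a = 'a]
  note T = transpose_sparse[OF P]
  have CT: "(mat_of_sparse P :: 'a mat)\<^sup>T \<in> carrier_mat c c"
    using C by simp
  have "mat_of_sparse P * (mat_of_sparse P)\<^sup>T = (1\<^sub>m c :: 'a mat)"
  proof (rule eq_matI)
    fix a b assume "a < dim_row (1\<^sub>m c :: 'a mat)" "b < dim_col (1\<^sub>m c :: 'a mat)"
    then have ab: "a < c" "b < c"
      by auto
    obtain k where k: "entry P a k"
      using perm_sparse_rows[OF assms ab(1)] by blast
    have "(mat_of_sparse P * (mat_of_sparse P)\<^sup>T) $$ (a, b) = (mat_of_sparse P :: 'a mat)\<^sup>T $$ (k, b)"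
      by (rule mat_of_sparse_mult_index(1)[OF P CT ab k])
    also have "\<dots> = (if entry P b k then 1 else 0)"
      using mat_of_sparse_index[OF P ab(2), where 'a = 'a] entry_bounds(2)[OF P k] C ab(2) by auto
    also have "\<dots> = 1\<^sub>m c $$ (a, b)"
      using ab k by (auto dest: entry_row_unique)
    finally show "(mat_of_sparse P * (mat_of_sparse P)\<^sup>T) $$ (a, b) = (1\<^sub>m c :: 'a mat) $$ (a, b)" .
  qed (use C in auto)
  then show ?thesis
    unfolding perm_factor_def using C CT by (intro factor_atI)
qed

lemma mul_factor_perm_tm:
  fixes F :: "'a::field factor"
  assumes F: "factor_at n F" and P: "perm_sparse n P"
  shows "val (mul_factor_perm_tm F P) = mul_factor F (perm_factor P)"
    and "n \<le> w \<Longrightarrow> 1 \<le> w \<Longrightarrow> time (mul_factor_perm_tm F P) \<le> 10 * w ^ 2"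
proof -
  have S: "sparse_in n n P"
    using P by (simp add: perm_sparse_def)
  have c: "fst F \<in> carrier_mat n n" "snd F \<in> carrier_mat n n"
    using F by (auto simp: factor_at_def)
  obtain X X' where F': "F = (X, X')"
    by (cases F)
  obtain r p where p: "P = (r, p)"
    by (cases P)
  have d: "dim_vec p = n"
    using sparse_in_dims[OF S] by (simp add: p)
  note C = mat_of_sparse_carrier[OF S, where 'a = 'a]
  have 1: "val (mul_perm_tm X P) = X * mat_of_sparse P"
  proof (rule eq_matI)
    fix a b assume "a < dim_row (X * mat_of_sparse P)" "b < dim_col (X * mat_of_sparse P)"
    then have ab: "a < n" "b < n"
      using c C by (auto simp: F')
    then show "val (mul_perm_tm X P) $$ (a, b) = (X * mat_of_sparse P) $$ (a, b)"
      using mult_mat_of_sparse_index[OF S c(1) ab] c d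
      by (simp add: F' p mul_perm_tm_def split: option.split)
  qed (use c C d in \<open>auto simp: F' p mul_perm_tm_def\<close>)
  have 2: "val (perm_transpose_mul_tm P X') = (mat_of_sparse P)\<^sup>T * X'"
  proof (rule eq_matI)
    fix a b assume "a < dim_row ((mat_of_sparse P)\<^sup>T * X')" "b < dim_col ((mat_of_sparse P)\<^sup>T * X')"
    then have ab: "a < n" "b < n"
      using c C by (auto simp: F')
    then obtain k where k: "entry P k a"
      using P by (auto simp: perm_sparse_def)
    then have "entry (transpose_sparse P) a k"
      by (simp add: transpose_sparse(2)[OF S])
    then have "((mat_of_sparse P)\<^sup>T * X') $$ (a, b) = X' $$ (k, b)"
      using mat_of_sparse_mult_index(1)[OF transpose_sparse(1)[OF S] c(2) ab]
      by (simp add: mat_of_transpose_sparse[OF S] F')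
    then show "val (perm_transpose_mul_tm P X') $$ (a, b) = ((mat_of_sparse P)\<^sup>T * X') $$ (a, b)"
      using k ab c d by (simp add: F' p perm_transpose_mul_tm_def entry_def)
  qed (use c C d in \<open>auto simp: F' p perm_transpose_mul_tm_def\<close>)
  show "val (mul_factor_perm_tm F P) = mul_factor F (perm_factor P)"
    using 1 2 by (simp add: F' mul_factor_perm_tm_def mul_factor_def perm_factor_def)
  show "time (mul_factor_perm_tm F P) \<le> 10 * w ^ 2" if w: "n \<le> w" "1 \<le> w"
  proof -
    have "time (mul_perm_tm X P) \<le> 5 * w ^ 2"
      unfolding mul_perm_tm_def p using c d w
      by (auto simp: F' split: option.split intro!: order_trans[OF time_new_mat_const[where s = 2
        and w = w]])
    moreover have "time (perm_transpose_mul_tm P X') \<le> 5 * w ^ 2"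
      unfolding perm_transpose_mul_tm_def p using c d w
      by (auto simp: F' split: option.split intro!: order_trans[OF time_new_mat_const[where s = 2
        and w = w]])
    ultimately show ?thesis
      by (simp add: F' mul_factor_perm_tm_def)
  qed
qed

section \<open>Changes of basis along a line of edges\<close>

definition edge_mat :: "arrow \<Rightarrow> nat \<Rightarrow> nat \<Rightarrow> 'a mat \<Rightarrow> bool" where
  "edge_mat a d d' M \<longleftrightarrow>
     M \<in> (case a of LArr \<Rightarrow> carrier_mat d d' | RArr \<Rightarrow> carrier_mat d' d)"

text \<open>
  \<open>X\<close> and \<open>Y\<close> are the factors at the left and the right end of an edge with old matrix \<open>M\<close> and new
  matrix \<open>N\<close>. Written without inverses, the condition composes by associativity alone.
\<close>

definition intertwines :: "arrow \<Rightarrow> 'a::field mat \<Rightarrow> 'a mat \<Rightarrow> 'a mat \<Rightarrow> 'a mat \<Rightarrow> bool" where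
  "intertwines a M X Y N \<longleftrightarrow>
     (case a of LArr \<Rightarrow> M * Y = X * N | RArr \<Rightarrow> M * X = Y * N)"

text \<open>
  \<open>transforms dims lo Ms X Y Ns\<close>: the edges \<open>Ms\<close>, starting at vertex \<open>lo\<close>, become \<open>Ns\<close> by a change of
  basis with factor \<open>X\<close> at the first and \<open>Y\<close> at the last vertex. The factors at the inner vertices are
  hidden, because the algorithm never computes them.
\<close>

inductive transforms ::
  "(nat \<Rightarrow> nat) \<Rightarrow> nat \<Rightarrow> (arrow \<times> 'a::field mat) list \<Rightarrow> 'a factor \<Rightarrow> 'a factor \<Rightarrow>
     (arrow \<times> 'a mat) list \<Rightarrow> bool" for dims
where
  Nil: "factor_at (dims lo) X \<Longrightarrow> transforms dims lo [] X X []"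
| Cons: "factor_at (dims lo) X \<Longrightarrow>
    edge_mat a (dims lo) (dims (Suc lo)) M \<Longrightarrow> edge_mat a (dims lo) (dims (Suc lo)) N \<Longrightarrow>
    intertwines a M (fst X) (fst Y) N \<Longrightarrow> transforms dims (Suc lo) Ms Y Z Ns \<Longrightarrow>
    transforms dims lo ((a, M) # Ms) X Z ((a, N) # Ns)"

inductive_cases transforms_ConsE: "transforms dims lo (e # Ms) X Z Ns"
inductive_cases transforms_NilE: "transforms dims lo [] X Z Ns"

lemma transforms_start: "transforms dims lo Ms X Y Ns \<Longrightarrow> factor_at (dims lo) X"
  by (induction rule: transforms.induct) auto

lemma transforms_end:
  "transforms dims lo Ms X Y Ns \<Longrightarrow> factor_at (dims (lo + length Ms)) Y \<and> length Ns = length Ms"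
  by (induction rule: transforms.induct) auto

lemma transforms_append:
  "transforms dims lo Ms X Y Ns \<Longrightarrow> transforms dims (lo + length Ms) Ms' Y Z Ns' \<Longrightarrow>
   transforms dims lo (Ms @ Ms') X Z (Ns @ Ns')"
  by (induction rule: transforms.induct) (auto intro: transforms.Cons)

lemma intertwines_mul:
  assumes "edge_mat a d d' M" "edge_mat a d d' N" "edge_mat a d d' K"
    and "X \<in> carrier_mat d d" "X' \<in> carrier_mat d d"
    and "Y \<in> carrier_mat d' d'" "Y' \<in> carrier_mat d' d'"
    and "intertwines a M X Y N" "intertwines a N X' Y' K"
  shows "intertwines a M (X * X') (Y * Y') K"
proof (cases a)
  case LArr
  then have M: "M \<in> carrier_mat d d'" and N: "N \<in> carrier_mat d d'" and K: "K \<in> carrier_mat d d'"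
    and e: "M * Y = X * N" "N * Y' = X' * K"
    using assms by (auto simp: edge_mat_def intertwines_def)
  have "M * (Y * Y') = X * (N * Y')"
    using e(1) assoc_mult_mat[OF M assms(6,7)] assoc_mult_mat[OF assms(4) N assms(7)] by simp
  then show ?thesis
    using LArr e(2) assoc_mult_mat[OF assms(4,5) K] by (simp add: intertwines_def)
next
  case RArr
  then have M: "M \<in> carrier_mat d' d" and N: "N \<in> carrier_mat d' d" and K: "K \<in> carrier_mat d' d"
    and e: "M * X = Y * N" "N * X' = Y' * K"
    using assms by (auto simp: edge_mat_def intertwines_def)
  have "M * (X * X') = Y * (N * X')"
    using e(1) assoc_mult_mat[OF M assms(4,5)] assoc_mult_mat[OF assms(6) N assms(5)] by simp
  then show ?thesis
    using RArr e(2) assoc_mult_mat[OF assms(6,7) K] by (simp add: intertwines_def)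
qed

lemma transforms_trans:
  assumes "transforms dims lo Ms X Y Ns" "transforms dims lo Ns X' Y' Ks"
  shows "transforms dims lo Ms (mul_factor X X') (mul_factor Y Y') Ks"
  using assms
proof (induction arbitrary: X' Ks rule: transforms.induct)
  case (Nil lo X)
  then show ?case
    by (auto elim!: transforms_NilE intro!: transforms.Nil factor_at_mul)
next
  case (Cons lo X a M N Y Ms Z Ns)
  from Cons.prems obtain K Y2 Ks' where Ks: "Ks = (a, K) # Ks'"
    and X': "factor_at (dims lo) X'" and K: "edge_mat a (dims lo) (dims (Suc lo)) K"
    and i: "intertwines a N (fst X') (fst Y2) K" and t: "transforms dims (Suc lo) Ns Y2 Y' Ks'"
    by (auto elim: transforms_ConsE)
  have Y: "factor_at (dims (Suc lo)) Y" and Y2: "factor_at (dims (Suc lo)) Y2"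
    using transforms_start Cons.hyps(5) t by blast+
  have "intertwines a M (fst X * fst X') (fst Y * fst Y2) K"
    using Cons.hyps X' Y Y2 i K
    by (intro intertwines_mul[of a "dims lo" "dims (Suc lo)" M N]) (auto simp: factor_at_def)
  then show ?case
    unfolding Ks
    by (intro transforms.Cons[OF factor_at_mul[OF Cons.hyps(1) X'] Cons.hyps(2) K _ Cons.IH[OF t]])
      (simp add: mul_factor_def)
qed

section \<open>Passing triangular factors\<close>

definition edge_in :: "nat \<Rightarrow> nat \<Rightarrow> edge \<Rightarrow> bool" where
  "edge_in d d' e \<longleftrightarrow>
     (case fst e of LArr \<Rightarrow> sparse_in d d' (snd e) | RArr \<Rightarrow> sparse_in d' d (snd e))"

primrec fits :: "(nat \<Rightarrow> nat) \<Rightarrow> nat \<Rightarrow> edge list \<Rightarrow> bool" where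
  "fits dims lo [] \<longleftrightarrow> True"
| "fits dims lo (e # es) \<longleftrightarrow> edge_in (dims lo) (dims (Suc lo)) e \<and> fits dims (Suc lo) es"

lemma fits_append:
  "fits dims lo (es @ es') \<longleftrightarrow> fits dims lo es \<and> fits dims (lo + length es) es'"
  by (induction es arbitrary: lo) auto

fun has_shape :: "form \<Rightarrow> edge \<Rightarrow> bool" where
  "has_shape Rightward (LArr, E) \<longleftrightarrow> shape_EL E"
| "has_shape Rightward (RArr, E) \<longleftrightarrow> shape_HL E"
| "has_shape Leftward (LArr, E) \<longleftrightarrow> shape_EU E"
| "has_shape Leftward (RArr, E) \<longleftrightarrow> shape_HU E"

definition mats :: "edge list \<Rightarrow> (arrow \<times> 'a::field mat) list" where
  "mats es = map (\<lambda>(a, S). (a, mat_of_sparse S)) es"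

lemma mats_simps [simp]:
  "mats [] = []" "mats ((a, S) # es) = (a, mat_of_sparse S) # mats es"
  "mats (es @ es') = mats es @ mats es'" "length (mats es) = length es"
  by (simp_all add: mats_def)

lemma edge_mat_of_sparse: "edge_in d d' (a, S) \<Longrightarrow> edge_mat a d d' (mat_of_sparse S :: 'a::field mat)"
  by (cases a) (auto simp: edge_in_def edge_mat_def)

text \<open>
  Triangularity enters as a closure property of the segment. In \<open>X S\<close>, a non-zero entry of \<open>X\<close> in a
  column from the image of \<open>S\<close> must lie in a row from the image; in \<open>S X\<close>, a non-zero entry in a row
  from the domain must lie in a column from the domain. For a segment, either property also gives
  the convexity that keeps the lifted factor invertible.
\<close>

lemma commute_forward:
  fixes F :: "'a::field factor"
  assumes S: "sparse_in n m S" "increasing S" and R: "R \<in> {(\<le>), (\<ge>)}"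
    and F: "triangular_factor R n F"
    and closed: "\<And>i b k. entry S i b \<Longrightarrow> k < n \<Longrightarrow> R k i \<Longrightarrow> \<exists>c. entry S k c"
  shows "triangular_factor R m (lift_factor S F)"
    and "fst F * mat_of_sparse S = mat_of_sparse S * fst (lift_factor S F)"
proof -
  have X: "fst F \<in> carrier_mat n n" and tri: "triangular R (fst F)"
    using F by (auto simp: triangular_factor_def factor_at_def)
  have "\<exists>c. entry S k c" if "entry S i a" "entry S j b" "i \<le> k" "k \<le> j" for i a j b k
    using closed[OF that(1), of k] closed[OF that(2), of k] that(3,4) R
      entry_bounds(1)[OF S(1) that(2)] by auto
  then have "rows_convex S"
    unfolding rows_convex_def by blast
  then show "triangular_factor R m (lift_factor S F)"
    by (intro triangular_factor_lift[OF S _ R F])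
  show "fst F * mat_of_sparse S = mat_of_sparse S * fst (lift_factor S F)"
    unfolding lift_factor_def fst_conv
    by (rule commute_sparse_right[OF S(1) X], rule triangular_zero[OF tri X])
      (use closed entry_bounds(1)[OF S(1)] in blast)+
qed

lemma commute_backward:
  fixes F :: "'a::field factor"
  assumes S: "sparse_in m n S" "increasing S" and R: "R \<in> {(\<le>), (\<ge>)}"
    and F: "triangular_factor R n F"
    and closed: "\<And>i b k. entry S b i \<Longrightarrow> k < n \<Longrightarrow> R i k \<Longrightarrow> \<exists>c. entry S c k"
  shows "triangular_factor R m (lift_factor (transpose_sparse S) F)"
    and "mat_of_sparse S * fst F = fst (lift_factor (transpose_sparse S) F) * mat_of_sparse S"
proof -
  note T = transpose_sparse[OF S(1)]
  have X: "fst F \<in> carrier_mat n n" and tri: "triangular R (fst F)"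
    using F by (auto simp: triangular_factor_def factor_at_def)
  have "\<exists>c. entry S c k" if "entry S a i" "entry S b j" "i \<le> k" "k \<le> j" for i a j b k
    using closed[OF that(1), of k] closed[OF that(2), of k] that(3,4) R
      entry_bounds(2)[OF S(1) that(2)] by auto
  then have "rows_convex (transpose_sparse S)"
    unfolding rows_convex_def T(2) by blast
  then show "triangular_factor R m (lift_factor (transpose_sparse S) F)"
    by (intro triangular_factor_lift[OF T(1) increasing_transpose[OF S] _ R F])
  show "mat_of_sparse S * fst F = fst (lift_factor (transpose_sparse S) F) * mat_of_sparse S"
    unfolding lift_factor_def fst_conv
    by (rule commute_sparse_left[OF S(1) X], rule triangular_zero[OF tri X])
      (use closed entry_bounds(2)[OF S(1)] in blast)+
qed

text \<open>
  A lower triangular factor goes from the right to the left end of an edge in rightward form. For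
  \<open>E\<^sub>L\<close> the relevant segment consists of the first columns: a row in it has no entry of the factor
  beyond it. For \<open>hat E\<^sub>L\<close> it consists of the last rows: a column in it has no entry of the factor
  above it.
\<close>

lemma pass_left_edge:
  fixes F :: "'a::field factor"
  assumes e: "edge_in d d' (a, E)" and shape: "has_shape Rightward (a, E)"
    and F: "triangular_factor (\<ge>) d' F"
  defines "s \<equiv> (case a of LArr \<Rightarrow> transpose_sparse E | RArr \<Rightarrow> E)"
  shows "sparse_in d' d s \<and> triangular_factor (\<ge>) d (lift_factor s F) \<and>
      intertwines a (mat_of_sparse E) (fst (lift_factor s F)) (fst F) (mat_of_sparse E)"
proof (cases a)
  case LArr
  then have E: "sparse_in d d' E" and sh: "shape_EL E" and s: "s = transpose_sparse E"
    using e shape by (auto simp: edge_in_def s_def)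
  have inc: "increasing E"
    using sh by (simp add: shape_EL_def)
  have closed: "\<exists>c. entry E c k" if "entry E b i" "k < d'" "k \<le> i" for i b k
    using sh that sparse_in_dims[OF E] unfolding shape_EL_def by (metis le_neq_implies_less)
  show ?thesis
    using commute_backward[OF E inc _ F closed] transpose_sparse(1)[OF E]
    by (simp add: LArr s intertwines_def)
next
  case RArr
  then have E: "sparse_in d' d E" and sh: "shape_HL E" and s: "s = E"
    using e shape by (auto simp: edge_in_def s_def)
  have inc: "increasing E"
    using sh by (simp add: shape_HL_def)
  have closed: "\<exists>c. entry E k c" if "entry E i b" "k < d'" "i \<le> k" for i b k
    using sh that sparse_in_dims[OF E] unfolding shape_HL_def by (metis le_neq_implies_less)
  show ?thesis
    using commute_forward[OF E inc _ F closed] E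
    by (simp add: RArr s intertwines_def)
qed

text \<open>
  The mirror image for upper triangular factors and leftward form, with the first rows of \<open>E\<^sub>U\<close> and
  the last columns of \<open>hat E\<^sub>U\<close>.
\<close>

lemma pass_right_edge:
  fixes F :: "'a::field factor"
  assumes e: "edge_in d d' (a, E)" and shape: "has_shape Leftward (a, E)"
    and F: "triangular_factor (\<le>) d F"
  defines "s \<equiv> (case a of LArr \<Rightarrow> E | RArr \<Rightarrow> transpose_sparse E)"
  shows "sparse_in d d' s \<and> triangular_factor (\<le>) d' (lift_factor s F) \<and>
      intertwines a (mat_of_sparse E) (fst F) (fst (lift_factor s F)) (mat_of_sparse E)"
proof (cases a)
  case LArr
  then have E: "sparse_in d d' E" and sh: "shape_EU E" and s: "s = E"
    using e shape by (auto simp: edge_in_def s_def)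
  have inc: "increasing E"
    using sh by (simp add: shape_EU_def)
  have closed: "\<exists>c. entry E k c" if "entry E i b" "k < d" "k \<le> i" for i b k
    using sh that sparse_in_dims[OF E] unfolding shape_EU_def by (metis le_neq_implies_less)
  show ?thesis
    using commute_forward[OF E inc _ F closed] E
    by (simp add: LArr s intertwines_def)
next
  case RArr
  then have E: "sparse_in d' d E" and sh: "shape_HU E" and s: "s = transpose_sparse E"
    using e shape by (auto simp: edge_in_def s_def)
  have inc: "increasing E"
    using sh by (simp add: shape_HU_def)
  have closed: "\<exists>c. entry E c k" if "entry E b i" "k < d" "i \<le> k" for i b k
    using sh that sparse_in_dims[OF E] unfolding shape_HU_def by (metis le_neq_implies_less)
  show ?thesis
    using commute_backward[OF E inc _ F closed] transpose_sparse(1)[OF E]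
    by (simp add: RArr s intertwines_def)
qed

text \<open>
  Passing a factor leaves all edges as they are; \<open>transforms\<close> relates the list of edges to itself.
\<close>

lemma pass_left:
  fixes F :: "'a::field factor"
  assumes "fits dims lo es" "\<And>e. e \<in> set es \<Longrightarrow> has_shape Rightward e"
    and "sparse_in k (dims (lo + length es)) S"
    and "triangular_factor (\<ge>) (dims (lo + length es)) (lift_factor S F)"
    and "\<And>i. lo \<le> i \<Longrightarrow> i \<le> lo + length es \<Longrightarrow> dims i \<le> w" "1 \<le> w"
  shows "sparse_in k (dims lo) (val (pass_left_tm es S)) \<and>
    triangular_factor (\<ge>) (dims lo) (lift_factor (val (pass_left_tm es S)) F) \<and>
    transforms dims lo (mats es) (lift_factor (val (pass_left_tm es S)) F) (lift_factor S F)
      (mats es) \<and>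
    time (pass_left_tm es S) \<le> 1 + 11 * w * length es"
  using assms
proof (induction es arbitrary: lo)
  case Nil
  then show ?case
    by (auto simp: triangular_factor_def intro: transforms.Nil)
next
  case (Cons e es)
  obtain a E where aE: "e = (a, E)"
    by (cases e)
  define S' where "S' = val (pass_left_tm es S)"
  define s where "s = (case a of LArr \<Rightarrow> transpose_sparse E | RArr \<Rightarrow> E)"
  have IH: "sparse_in k (dims (Suc lo)) S'" "triangular_factor (\<ge>) (dims (Suc lo)) (lift_factor S' F)"
    "transforms dims (Suc lo) (mats es) (lift_factor S' F) (lift_factor S F) (mats es)"
    "time (pass_left_tm es S) \<le> 1 + 11 * w * length es"
    using Cons.IH[of "Suc lo"] Cons.prems by (auto simp: S'_def)
  have e: "edge_in (dims lo) (dims (Suc lo)) (a, E)" and sh: "has_shape Rightward (a, E)"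
    using Cons.prems(1,2) by (auto simp: aE)
  note passed = pass_left_edge[OF e sh IH(2), folded s_def]
  note edge = passed[THEN conjunct1] passed[THEN conjunct2, THEN conjunct1]
    passed[THEN conjunct2, THEN conjunct2]
  have v: "val (pass_left_tm (e # es) S) = mul_sparse S' s"
    by (simp add: aE S'_def s_def split: arrow.split)
  have w: "dims lo \<le> w" "dims (Suc lo) \<le> w"
    using Cons.prems(5) by auto
  have "time (pass_left_tm (e # es) S) \<le> 1 + 11 * w * length es + 11 * w"
  proof (cases a)
    case LArr
    then have "sparse_in (dims lo) (dims (Suc lo)) E"
      using e by (simp add: edge_in_def)
    from transpose_sparse(3)[OF this] mul_sparse(4)[OF IH(1) edge(1)] show ?thesis
      using IH(4) w \<open>1 \<le> w\<close> by (simp add: aE S'_def[symmetric] LArr s_def)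
  next
    case RArr
    with mul_sparse(4)[OF IH(1) edge(1)] show ?thesis
      using IH(4) w \<open>1 \<le> w\<close> by (simp add: aE S'_def[symmetric] s_def)
  qed
  moreover have "lift_factor (mul_sparse S' s) F = lift_factor s (lift_factor S' F)"
    by (rule lift_factor_mul_sparse[OF IH(1) edge(1)])
  moreover have "transforms dims lo (mats (e # es)) (lift_factor s (lift_factor S' F))
      (lift_factor S F) (mats (e # es))"
    unfolding aE mats_simps
    using edge edge_mat_of_sparse[OF e] IH(3) by (intro transforms.Cons)
      (auto simp: triangular_factor_def)
  ultimately show ?case
    using mul_sparse(1)[OF IH(1) edge(1)] edge(2) unfolding v by (simp add: algebra_simps)
qed

lemma pass_right:
  fixes F :: "'a::field factor"
  assumes "fits dims lo es" "\<And>e. e \<in> set es \<Longrightarrow> has_shape Leftward e"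
    and "sparse_in k (dims lo) S"
    and "triangular_factor (\<le>) (dims lo) (lift_factor S F)"
    and "\<And>i. lo \<le> i \<Longrightarrow> i \<le> lo + length es \<Longrightarrow> dims i \<le> w" "1 \<le> w"
  shows "sparse_in k (dims (lo + length es)) (val (pass_right_tm es S)) \<and>
    transforms dims lo (mats es) (lift_factor S F) (lift_factor (val (pass_right_tm es S)) F)
      (mats es) \<and>
    time (pass_right_tm es S) \<le> 1 + 11 * w * length es"
  using assms
proof (induction es arbitrary: lo S)
  case Nil
  then show ?case
    by (auto simp: triangular_factor_def intro: transforms.Nil)
next
  case (Cons e es)
  obtain a E where aE: "e = (a, E)"
    by (cases e)
  define s where "s = (case a of LArr \<Rightarrow> E | RArr \<Rightarrow> transpose_sparse E)"
  define S' where "S' = mul_sparse S s"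
  have e: "edge_in (dims lo) (dims (Suc lo)) (a, E)" and sh: "has_shape Leftward (a, E)"
    using Cons.prems(1,2) by (auto simp: aE)
  note passed = pass_right_edge[OF e sh Cons.prems(4), folded s_def]
  note edge = passed[THEN conjunct1] passed[THEN conjunct2, THEN conjunct1]
    passed[THEN conjunct2, THEN conjunct2]
  have S': "sparse_in k (dims (Suc lo)) S'"
    unfolding S'_def by (rule mul_sparse(1)[OF Cons.prems(3) edge(1)])
  have l: "lift_factor S' F = lift_factor s (lift_factor S F)"
    unfolding S'_def by (rule lift_factor_mul_sparse[OF Cons.prems(3) edge(1)])
  have IH: "sparse_in k (dims (Suc lo + length es)) (val (pass_right_tm es S'))"
    "transforms dims (Suc lo) (mats es) (lift_factor S' F) (lift_factor (val (pass_right_tm es S'))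
      F) (mats es)"
    "time (pass_right_tm es S') \<le> 1 + 11 * w * length es"
    using Cons.IH[of "Suc lo" S'] Cons.prems edge(2) S' by (auto simp: l)
  have v: "val (pass_right_tm (e # es) S) = val (pass_right_tm es S')"
    by (simp add: aE S'_def s_def split: arrow.split)
  have w: "dims lo \<le> w" "dims (Suc lo) \<le> w"
    using Cons.prems(5) by auto
  have "time (pass_right_tm (e # es) S) \<le> 1 + 11 * w * length es + 11 * w"
  proof (cases a)
    case LArr
    with mul_sparse(4)[OF Cons.prems(3) edge(1)] show ?thesis
      using IH(3) w \<open>1 \<le> w\<close> by (simp add: aE S'_def s_def)
  next
    case RArr
    then have "sparse_in (dims (Suc lo)) (dims lo) E"
      using e by (simp add: edge_in_def)
    from transpose_sparse(3)[OF this] mul_sparse(4)[OF Cons.prems(3) edge(1)] show ?thesis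
      using IH(3) w \<open>1 \<le> w\<close> by (simp add: aE S'_def s_def RArr)
  qed
  moreover have "transforms dims lo (mats (e # es)) (lift_factor S F)
      (lift_factor (val (pass_right_tm es S')) F) (mats (e # es))"
    unfolding aE mats_simps
    using edge edge_mat_of_sparse[OF e] IH(2) Cons.prems(4)
    by (intro transforms.Cons) (auto simp: triangular_factor_def l)
  ultimately show ?case
    using IH(1) unfolding v by (simp add: algebra_simps)
qed

section \<open>Restoring a form by passing permutations\<close>

lemma mat_of_sparse_factorization:
  assumes "sparse_in r c Q" "sparse_in r l M" "sparse_in l c N"
    and "\<And>i j. entry Q i j \<longleftrightarrow> (\<exists>k. entry M i k \<and> entry N k j)"
  shows "mat_of_sparse Q = (mat_of_sparse M * mat_of_sparse N :: 'a::field mat)"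
proof -
  have "Q = mul_sparse M N"
    using assms(1) mul_sparse(1,2)[OF assms(2,3)] assms(4) by (intro sparse_eqI) auto
  then show ?thesis
    using mul_sparse(3)[OF assms(2,3)] by metis
qed

lemma perm_sparse_in: "perm_sparse c P \<Longrightarrow> sparse_in c c P"
  by (simp add: perm_sparse_def)

text \<open>
  The case in which the permutation meets the target of an edge. From \<open>Y\<^sup>T Q = E P\<close> and the
  orthogonality of permutation matrices, \<open>Q P\<^sup>T = Y E\<close>. If it meets the source, \<open>Q Y = P E\<close> already
  has the required form.
\<close>

lemma backward_permutation:
  fixes d d' :: nat
  assumes Y: "perm_sparse d Y" and Q: "sparse_in d d' Q"
    and E: "sparse_in d d' E" and P: "perm_sparse d' P"
    and e: "\<And>i j. entry (mul_sparse (transpose_sparse Y) Q) i j \<longleftrightarrow>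
      (\<exists>k. entry E i k \<and> entry P k j)"
  shows "mat_of_sparse Q * mat_of_sparse (transpose_sparse P) =
    (mat_of_sparse Y * mat_of_sparse E :: 'a::field mat)"
proof -
  note Y' = perm_sparse_in[OF Y] and P' = perm_sparse_in[OF P]
  note T = transpose_sparse(1)[OF Y'] and TP = transpose_sparse(1)[OF P']
  let ?Y = "mat_of_sparse Y :: 'a mat" and ?Q = "mat_of_sparse Q :: 'a mat"
  let ?E = "mat_of_sparse E :: 'a mat" and ?P = "mat_of_sparse P :: 'a mat"
  have c: "?Y \<in> carrier_mat d d" "?Q \<in> carrier_mat d d'" "?E \<in> carrier_mat d d'"
    "?P \<in> carrier_mat d' d'"
    "?Y\<^sup>T \<in> carrier_mat d d" "?P\<^sup>T \<in> carrier_mat d' d'"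
    using Y' Q E P' by auto
  have inv: "?Y * ?Y\<^sup>T = 1\<^sub>m d" "?P * ?P\<^sup>T = 1\<^sub>m d'"
    using perm_factor_at[OF Y, where 'a = 'a] perm_factor_at[OF P, where 'a = 'a]
    by (auto simp: factor_at_def perm_factor_def)
  have "?Y\<^sup>T * ?Q = ?E * ?P"
    using mat_of_sparse_factorization[OF mul_sparse(1)[OF T Q] E P' e, where 'a = 'a]
      mul_sparse(3)[OF T Q, where 'a = 'a] mat_of_transpose_sparse[OF Y', where 'a = 'a] by simp
  then have "?Y * (?Y\<^sup>T * ?Q) * ?P\<^sup>T = ?Y * (?E * ?P) * ?P\<^sup>T"
    by simp
  moreover have "?Y * (?Y\<^sup>T * ?Q) = ?Q"
    using assoc_mult_mat[OF c(1,5,2)] inv(1) c(2) by simp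
  moreover have "?Y * (?E * ?P) * ?P\<^sup>T = ?Y * ?E"
    using assoc_mult_mat[OF c(1) mult_carrier_mat[OF c(3,4)] c(6)] assoc_mult_mat[OF c(3,4,6)]
      inv(2) c(3)
    by simp
  ultimately show ?thesis
    by (simp add: mat_of_transpose_sparse[OF P'])
qed

text \<open>The step of a sweep at a single edge, which leaves only bookkeeping for the induction.\<close>

definition sweep_right_edge_tm :: "sparse \<Rightarrow> edge \<Rightarrow> (edge \<times> sparse) tm" where
  "sweep_right_edge_tm Y e = (case e of
       (LArr, Q) \<Rightarrow> do {
         T \<leftarrow> transpose_sparse_tm Y;
         Q' \<leftarrow> mul_sparse_tm T Q;
         (E, P) \<leftarrow> factor_EL_P_tm Q';
         P' \<leftarrow> transpose_sparse_tm P;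
         ret ((LArr, E), P')
       }
     | (RArr, Q) \<Rightarrow> do {
         Q' \<leftarrow> mul_sparse_tm Q Y;
         (P, E) \<leftarrow> factor_P_HL_tm Q';
         ret ((RArr, E), P)
       })"

lemma sweep_right_edge:
  assumes e: "edge_in d d' (a, Q)" and Y: "perm_sparse d Y" and w: "d \<le> w" "d' \<le> w" "1 \<le> w"
  obtains E P where "val (sweep_right_edge_tm Y (a, Q)) = ((a, E), P)" "edge_in d d' (a, E)"
    "has_shape Rightward (a, E)"
    "perm_sparse d' P"
    "intertwines a (mat_of_sparse Q :: 'a::field mat) (mat_of_sparse Y) (mat_of_sparse P)
      (mat_of_sparse E)"
    "time (sweep_right_edge_tm Y (a, Q)) \<le> 68 * w"
proof (cases a)
  case LArr
  note Y' = perm_sparse_in[OF Y]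
  note T = transpose_sparse[OF Y']
  have Q: "sparse_in d d' Q"
    using e by (simp add: edge_in_def LArr)
  note TQ = mul_sparse[OF T(1) Q]
  obtain E P where v: "val (factor_EL_P_tm (mul_sparse (transpose_sparse Y) Q)) = (E, P)"
    and E: "sparse_in d d' E" and P: "perm_sparse d' P" and sh: "shape_EL E"
    and en: "\<And>i j. entry (mul_sparse (transpose_sparse Y) Q) i j \<longleftrightarrow>
      (\<exists>k. entry E i k \<and> entry P k j)"
    and t: "time (factor_EL_P_tm (mul_sparse (transpose_sparse Y) Q)) \<le> 6 + 6 * d + 9 * d'"
    by (rule factor_EL_P[OF TQ(1)]) (rule that; blast)
  show thesis
    using E sh perm_sparse_transpose[OF P] backward_permutation[OF Y Q E P en, where 'a = 'a] t T(3)
      TQ(4)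
      transpose_sparse(3)[OF perm_sparse_in[OF P]] w
    by (intro that[of E "transpose_sparse P"])
      (simp_all add: sweep_right_edge_tm_def LArr v edge_in_def intertwines_def)
next
  case RArr
  note Y' = perm_sparse_in[OF Y]
  have Q: "sparse_in d' d Q"
    using e by (simp add: edge_in_def RArr)
  note QY = mul_sparse[OF Q Y']
  obtain P E where v: "val (factor_P_HL_tm (mul_sparse Q Y)) = (P, E)"
    and E: "sparse_in d' d E" and P: "perm_sparse d' P" and sh: "shape_HL E"
    and en: "\<And>i j. entry (mul_sparse Q Y) i j \<longleftrightarrow> (\<exists>k. entry P i k \<and> entry E k j)"
    and t: "time (factor_P_HL_tm (mul_sparse Q Y)) \<le> 15 + 23 * d' + 25 * d"
    by (rule factor_P_HL[OF QY(1)]) (rule that; blast)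
  show thesis
    using E sh P mat_of_sparse_factorization[OF QY(1) perm_sparse_in[OF P] E en, where 'a = 'a]
      QY(3)[where 'a = 'a] t QY(4) w
    by (intro that[of E P])
      (simp_all add: sweep_right_edge_tm_def RArr v edge_in_def intertwines_def)
qed

definition sweep_left_edge_tm :: "sparse \<Rightarrow> edge \<Rightarrow> (edge \<times> sparse) tm" where
  "sweep_left_edge_tm Y e = (case e of
       (LArr, Q) \<Rightarrow> do {
         Q' \<leftarrow> mul_sparse_tm Q Y;
         (P, E) \<leftarrow> factor_P_EU_tm Q';
         ret ((LArr, E), P)
       }
     | (RArr, Q) \<Rightarrow> do {
         T \<leftarrow> transpose_sparse_tm Y;
         Q' \<leftarrow> mul_sparse_tm T Q;
         (E, P) \<leftarrow> factor_HU_P_tm Q';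
         P' \<leftarrow> transpose_sparse_tm P;
         ret ((RArr, E), P')
       })"

lemma sweep_left_edge:
  assumes e: "edge_in d d' (a, Q)" and Y: "perm_sparse d' Y" and w: "d \<le> w" "d' \<le> w" "1 \<le> w"
  obtains E P where "val (sweep_left_edge_tm Y (a, Q)) = ((a, E), P)" "edge_in d d' (a, E)"
    "has_shape Leftward (a, E)"
    "perm_sparse d P"
    "intertwines a (mat_of_sparse Q :: 'a::field mat) (mat_of_sparse P) (mat_of_sparse Y)
      (mat_of_sparse E)"
    "time (sweep_left_edge_tm Y (a, Q)) \<le> 68 * w"
proof (cases a)
  case LArr
  note Y' = perm_sparse_in[OF Y]
  have Q: "sparse_in d d' Q"
    using e by (simp add: edge_in_def LArr)
  note QY = mul_sparse[OF Q Y']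
  obtain P E where v: "val (factor_P_EU_tm (mul_sparse Q Y)) = (P, E)"
    and E: "sparse_in d d' E" and P: "perm_sparse d P" and sh: "shape_EU E"
    and en: "\<And>i j. entry (mul_sparse Q Y) i j \<longleftrightarrow> (\<exists>k. entry P i k \<and> entry E k j)"
    and t: "time (factor_P_EU_tm (mul_sparse Q Y)) \<le> 12 + 17 * d + 13 * d'"
    by (rule factor_P_EU[OF QY(1)]) (rule that; blast)
  show thesis
    using E sh P mat_of_sparse_factorization[OF QY(1) perm_sparse_in[OF P] E en, where 'a = 'a]
      QY(3)[where 'a = 'a] t QY(4) w
    by (intro that[of E P])
      (simp_all add: sweep_left_edge_tm_def LArr v edge_in_def intertwines_def)
next
  case RArr
  note Y' = perm_sparse_in[OF Y]
  note T = transpose_sparse[OF Y']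
  have Q: "sparse_in d' d Q"
    using e by (simp add: edge_in_def RArr)
  note TQ = mul_sparse[OF T(1) Q]
  obtain E P where v: "val (factor_HU_P_tm (mul_sparse (transpose_sparse Y) Q)) = (E, P)"
    and E: "sparse_in d' d E" and P: "perm_sparse d P" and sh: "shape_HU E"
    and en: "\<And>i j. entry (mul_sparse (transpose_sparse Y) Q) i j \<longleftrightarrow>
      (\<exists>k. entry E i k \<and> entry P k j)"
    and t: "time (factor_HU_P_tm (mul_sparse (transpose_sparse Y) Q)) \<le> 9 + 6 * d' + 27 * d"
    by (rule factor_HU_P[OF TQ(1)]) (rule that; blast)
  show thesis
    using E sh perm_sparse_transpose[OF P] backward_permutation[OF Y Q E P en, where 'a = 'a] t T(3)
      TQ(4)
      transpose_sparse(3)[OF perm_sparse_in[OF P]] w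
    by (intro that[of E "transpose_sparse P"])
      (simp_all add: sweep_left_edge_tm_def RArr v edge_in_def intertwines_def)
qed

lemma sweep_right:
  assumes "fits dims lo es" "perm_sparse (dims lo) Y"
    and "\<And>i. lo \<le> i \<Longrightarrow> i \<le> lo + length es \<Longrightarrow> dims i \<le> w" "1 \<le> w"
  obtains es' Z where "val (sweep_right_tm es Y) = (es', Z)"
    and "fits dims lo es'" "\<And>e. e \<in> set es' \<Longrightarrow> has_shape Rightward e"
    and "perm_sparse (dims (lo + length es)) Z"
    and "transforms dims lo (mats es) (perm_factor Y) (perm_factor Z :: 'a::field factor) (mats es')"
    and "time (sweep_right_tm es Y) \<le> 1 + 69 * w * length es"
  using assms
proof (induction es arbitrary: lo Y thesis)
  case Nil
  then show ?case
    by (auto intro: transforms.Nil perm_factor_at)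
next
  case (Cons e es)
  obtain a Q where aQ: "e = (a, Q)"
    by (cases e)
  have w: "dims lo \<le> w" "dims (Suc lo) \<le> w"
    using Cons.prems(4) by auto
  have e: "edge_in (dims lo) (dims (Suc lo)) (a, Q)"
    using Cons.prems(2) by (simp add: aQ)
  define p where "p = sweep_right_edge_tm Y (a, Q)"
  obtain E P where v: "val p = ((a, E), P)" and E: "edge_in (dims lo) (dims (Suc lo)) (a, E)"
    "has_shape Rightward (a, E)" and P: "perm_sparse (dims (Suc lo)) P"
    and i: "intertwines a (mat_of_sparse Q :: 'a mat) (mat_of_sparse Y) (mat_of_sparse P)
      (mat_of_sparse E)"
    and t: "time p \<le> 68 * w"
    by (rule sweep_right_edge[OF e Cons.prems(3) w \<open>1 \<le> w\<close>, folded p_def, where 'a = 'a])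
      (rule that; blast)
  obtain es' Z where v': "val (sweep_right_tm es P) = (es', Z)"
    and es': "fits dims (Suc lo) es'" "\<And>e. e \<in> set es' \<Longrightarrow> has_shape Rightward e"
    and Z: "perm_sparse (dims (Suc lo + length es)) Z"
    and tr: "transforms dims (Suc lo) (mats es) (perm_factor P) (perm_factor Z :: 'a factor)
      (mats es')"
    and t': "time (sweep_right_tm es P) \<le> 1 + 69 * w * length es"
    using Cons.IH[where lo = "Suc lo" and Y = P] Cons.prems(2,4,5) P by auto
  have prog: "sweep_right_tm (e # es) Y = do {
      (e', Y') \<leftarrow> p; (es', Y'') \<leftarrow> sweep_right_tm es Y'; tick (e' # es', Y'') }"
    by (simp add: aQ p_def sweep_right_edge_tm_def)
  have "transforms dims lo (mats (e # es)) (perm_factor Y) (perm_factor Z :: 'a factor)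
    (mats ((a, E) # es'))"
    unfolding aQ mats_simps
    using edge_mat_of_sparse[OF e] edge_mat_of_sparse[OF E(1)] i tr perm_factor_at[OF Cons.prems(3)]
    by (intro transforms.Cons) (auto simp: perm_factor_def)
  moreover have "has_shape Rightward f" if "f \<in> set ((a, E) # es')" for f
    using that E(2) es'(2)[of f] by auto
  ultimately show ?case
    using E es' Z t t' \<open>1 \<le> w\<close>
    by (intro Cons.prems(1)[of "(a, E) # es'" Z])
      (simp_all add: prog v v' algebra_simps del: sweep_right_tm.simps)
qed

lemma sweep_left:
  assumes "fits dims lo es" "perm_sparse (dims (lo + length es)) Y"
    and "\<And>i. lo \<le> i \<Longrightarrow> i \<le> lo + length es \<Longrightarrow> dims i \<le> w" "1 \<le> w"
  obtains es' Z where "val (sweep_left_tm es Y) = (es', Z)"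
    and "fits dims lo es'" "\<And>e. e \<in> set es' \<Longrightarrow> has_shape Leftward e"
    and "perm_sparse (dims lo) Z"
    and "transforms dims lo (mats es) (perm_factor Z) (perm_factor Y :: 'a::field factor) (mats es')"
    and "time (sweep_left_tm es Y) \<le> 1 + 69 * w * length es"
  using assms
proof (induction es arbitrary: lo thesis)
  case Nil
  then show ?case
    by (auto intro: transforms.Nil perm_factor_at)
next
  case (Cons e es)
  obtain a Q where aQ: "e = (a, Q)"
    by (cases e)
  have w: "dims lo \<le> w" "dims (Suc lo) \<le> w"
    using Cons.prems(4) by auto
  have e: "edge_in (dims lo) (dims (Suc lo)) (a, Q)"
    using Cons.prems(2) by (simp add: aQ)
  obtain es' Z where v': "val (sweep_left_tm es Y) = (es', Z)"
    and es': "fits dims (Suc lo) es'" "\<And>e. e \<in> set es' \<Longrightarrow> has_shape Leftward e"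
    and Z: "perm_sparse (dims (Suc lo)) Z"
    and tr: "transforms dims (Suc lo) (mats es) (perm_factor Z) (perm_factor Y :: 'a factor)
      (mats es')"
    and t': "time (sweep_left_tm es Y) \<le> 1 + 69 * w * length es"
    using Cons.IH[where lo = "Suc lo"] Cons.prems(2-5) by auto
  define p where "p = sweep_left_edge_tm Z (a, Q)"
  obtain E P where v: "val p = ((a, E), P)" and E: "edge_in (dims lo) (dims (Suc lo)) (a, E)"
    "has_shape Leftward (a, E)" and P: "perm_sparse (dims lo) P"
    and i: "intertwines a (mat_of_sparse Q :: 'a mat) (mat_of_sparse P) (mat_of_sparse Z)
      (mat_of_sparse E)"
    and t: "time p \<le> 68 * w"
    by (rule sweep_left_edge[OF e Z w \<open>1 \<le> w\<close>, folded p_def, where 'a = 'a]) (rule that; blast)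
  have prog: "val (sweep_left_tm (e # es) Y) = (fst (val p) # es', snd (val p))"
    "time (sweep_left_tm (e # es) Y) = time (sweep_left_tm es Y) + time p + 1"
    by (simp_all add: aQ v' p_def sweep_left_edge_tm_def split: prod.splits)
  have "transforms dims lo (mats (e # es)) (perm_factor P) (perm_factor Y :: 'a factor)
    (mats ((a, E) # es'))"
    unfolding aQ mats_simps
    using edge_mat_of_sparse[OF e] edge_mat_of_sparse[OF E(1)] i tr perm_factor_at[OF P]
    by (intro transforms.Cons) (auto simp: perm_factor_def)
  moreover have "has_shape Leftward f" if "f \<in> set ((a, E) # es')" for f
    using that E(2) es'(2)[of f] by auto
  ultimately show ?case
    using E es' P t t' \<open>1 \<le> w\<close>
    by (intro Cons.prems(1)[of "(a, E) # es'" P])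
      (simp_all add: prog v v' algebra_simps del: sweep_left_tm.simps)
qed

section \<open>Combining two halves\<close>

lemma cancel_outer_factors:
  fixes M :: "'a::field mat"
  assumes c: "A \<in> carrier_mat n n" "A' \<in> carrier_mat n n" "M \<in> carrier_mat n m"
    "B \<in> carrier_mat m m" "C \<in> carrier_mat n n" "Q \<in> carrier_mat n m"
    "D \<in> carrier_mat m m" "V \<in> carrier_mat m m"
    and "A * A' = 1\<^sub>m n" "D * V = 1\<^sub>m m" "A' * M * B = C * Q * D"
  shows "M * (B * V) = (A * C) * Q"
proof -
  have CQ: "C * Q \<in> carrier_mat n m" and MB: "M * B \<in> carrier_mat n m"
    using c by auto
  have "M * (B * V) = (M * B) * V"
    using assoc_mult_mat[OF c(3,4,8)] by simp
  also have "M * B = A * (A' * (M * B))"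
    using assoc_mult_mat[OF c(1,2) MB] left_mult_one_mat[OF MB] \<open>A * A' = 1\<^sub>m n\<close> by simp
  also have "A' * (M * B) = C * Q * D"
    using assoc_mult_mat[OF c(2,3,4)] \<open>A' * M * B = C * Q * D\<close> by simp
  also have "A * (C * Q * D) * V = A * (C * Q * D * V)"
    using assoc_mult_mat[OF c(1) mult_carrier_mat[OF CQ c(7)] c(8)] .
  also have "C * Q * D * V = C * Q"
    using assoc_mult_mat[OF CQ c(7,8)] \<open>D * V = 1\<^sub>m m\<close> right_mult_one_mat[OF CQ] by simp
  also have "A * (C * Q) = A * C * Q"
    using assoc_mult_mat[OF c(1,5,6)] by simp
  finally show ?thesis .
qed

lemma lower_inverse_factor:
  assumes L: "L \<in> carrier_mat n n" "lower L" "nonzero_diagonal L" and w: "n \<le> w" "1 \<le> w"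
  shows "triangular_factor (\<ge>) n (L, val (lower_inverse_tm L))"
    and "triangular_factor (\<ge>) n (val (lower_inverse_tm L), L)"
    and "time (lower_inverse_tm L) \<le> 30 * w ^ 3"
proof -
  obtain V where V: "val (lower_inverse_tm L) = V" "V \<in> carrier_mat n n" "lower V" "L * V = 1\<^sub>m n"
    and t: "time (lower_inverse_tm L) \<le> 30 * w ^ 3"
    using lower_inverse[OF L w] by metis
  show "triangular_factor (\<ge>) n (L, val (lower_inverse_tm L))"
    "triangular_factor (\<ge>) n (val (lower_inverse_tm L), L)"
    using V L factor_atI[OF L(1) V(2,4)] by (simp_all add: triangular_factor_def)
  show "time (lower_inverse_tm L) \<le> 30 * w ^ 3"
    by (rule t)
qed

lemma upper_inverse_factor:
  assumes U: "U \<in> carrier_mat n n" "upper U" "nonzero_diagonal U" and w: "n \<le> w" "1 \<le> w"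
  shows "triangular_factor (\<le>) n (U, val (upper_inverse_tm U))"
    and "triangular_factor (\<le>) n (val (upper_inverse_tm U), U)"
    and "time (upper_inverse_tm U) \<le> 46 * w ^ 3"
proof -
  obtain V where V: "val (upper_inverse_tm U) = V" "V \<in> carrier_mat n n" "upper V" "U * V = 1\<^sub>m n"
    and t: "time (upper_inverse_tm U) \<le> 46 * w ^ 3"
    using upper_inverse[OF U w] by metis
  show "triangular_factor (\<le>) n (U, val (upper_inverse_tm U))"
    "triangular_factor (\<le>) n (val (upper_inverse_tm U), U)"
    using V U factor_atI[OF U(1) V(2,4)] by (simp_all add: triangular_factor_def)
  show "time (upper_inverse_tm U) \<le> 46 * w ^ 3"
    by (rule t)
qed

text \<open>
  Absorbing \<open>X\<close> and \<open>Y\<close> gives \<open>M'' = X\<^sup>-\<^sup>1 M Y = L Q U\<close> for an edge \<open>LArr\<close>, that is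
  \<open>M (Y U\<^sup>-\<^sup>1) = (X L) Q\<close>. So the factor at the source of the edge gets the inverse of its triangular
  matrix and the one at the target the matrix itself, which explains the order in the pairs returned.
\<close>

lemma middle:
  fixes M :: "'a::field mat"
  assumes M: "edge_mat a d d' M" and F: "factor_at d F" and G: "factor_at d' G"
    and w: "d \<le> w" "d' \<le> w" "1 \<le> w"
  obtains Q K H where "val (middle_tm a M F G) = (Q, K, H)"
    and "edge_in d d' (a, Q)" "triangular_factor (\<ge>) d K" "triangular_factor (\<le>) d' H"
    and "intertwines a M (fst (mul_factor F K)) (fst (mul_factor G H)) (mat_of_sparse Q)"
    and "time (middle_tm a M F G) \<le> 163 * w ^ 3"
proof -
  obtain X X' Y Y' where FG: "F = (X, X')" "G = (Y, Y')"
    by fastforce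
  have X: "X \<in> carrier_mat d d" "X' \<in> carrier_mat d d" "X * X' = 1\<^sub>m d"
    and Y: "Y \<in> carrier_mat d' d'" "Y' \<in> carrier_mat d' d'" "Y * Y' = 1\<^sub>m d'"
    using F G by (auto simp: FG factor_at_def)
  show thesis
  proof (cases a)
    case LArr
    then have M: "M \<in> carrier_mat d d'"
      using M by (simp add: edge_mat_def)
    note AM = mult_carrier_mat[OF X(2) M]
    note m1 = mul_mat[OF X(2) M] and m2 = mul_mat[OF AM Y(1)]
    obtain L Q U where v: "val (factor_LQU_tm (X' * M * Y)) = (L, Q, U)"
      and L: "L \<in> carrier_mat d d" "lower L" "nonzero_diagonal L"
      and U: "U \<in> carrier_mat d' d'" "upper U" "nonzero_diagonal U"
      and Q: "sparse_in d d' Q" and e: "X' * M * Y = L * mat_of_sparse Q * U"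
      and t: "time (factor_LQU_tm (X' * M * Y)) \<le> 38 * w ^ 3"
      using factor_LQU[OF mult_carrier_mat[OF AM Y(1)] w] by metis
    let ?V = "val (lower_inverse_tm L)" and ?W = "val (upper_inverse_tm U)"
    note iL = lower_inverse_factor[OF L w(1,3)] and iU = upper_inverse_factor[OF U w(2,3)]
    have inv: "?W \<in> carrier_mat d' d'" "U * ?W = 1\<^sub>m d'"
      using iU(2) by (auto simp: triangular_factor_def factor_at_def)
    show thesis
    proof (rule that)
      show "val (middle_tm a M F G) = (Q, (L, ?V), (?W, U))"
        by (simp add: middle_tm_def FG LArr m1(1) m2(1) v)
      show "edge_in d d' (a, Q)"
        using Q by (simp add: edge_in_def LArr)
      show "triangular_factor (\<ge>) d (L, ?V)" "triangular_factor (\<le>) d' (?W, U)"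
        by (fact iL iU)+
      show "intertwines a M (fst (mul_factor F (L, ?V))) (fst (mul_factor G (?W, U)))
        (mat_of_sparse Q)"
        using cancel_outer_factors[OF X(1,2) M Y(1) L(1) mat_of_sparse_carrier[OF Q] U(1) inv(1)
          X(3) inv(2) e]
        by (simp add: intertwines_def LArr mul_factor_def FG)
      show "time (middle_tm a M F G) \<le> 163 * w ^ 3"
        using m1(2)[OF w(1,1,2,3)] m2(2)[OF w(1,2,2,3)] t iL(3) iU(3)
        by (simp add: middle_tm_def FG LArr m1(1) m2(1) v)
    qed
  next
    case RArr
    then have M: "M \<in> carrier_mat d' d"
      using M by (simp add: edge_mat_def)
    note AM = mult_carrier_mat[OF Y(2) M]
    note m1 = mul_mat[OF Y(2) M] and m2 = mul_mat[OF AM X(1)]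
    obtain U Q L where v: "val (factor_UQL_tm (Y' * M * X)) = (U, Q, L)"
      and U: "U \<in> carrier_mat d' d'" "upper U" "nonzero_diagonal U"
      and L: "L \<in> carrier_mat d d" "lower L" "nonzero_diagonal L"
      and Q: "sparse_in d' d Q" and e: "Y' * M * X = U * mat_of_sparse Q * L"
      and t: "time (factor_UQL_tm (Y' * M * X)) \<le> 69 * w ^ 3"
      using factor_UQL[OF mult_carrier_mat[OF AM X(1)] w(2,1,3)] by metis
    let ?V = "val (lower_inverse_tm L)" and ?W = "val (upper_inverse_tm U)"
    note iL = lower_inverse_factor[OF L w(1,3)] and iU = upper_inverse_factor[OF U w(2,3)]
    have inv: "?V \<in> carrier_mat d d" "L * ?V = 1\<^sub>m d"
      using iL(2) by (auto simp: triangular_factor_def factor_at_def)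
    show thesis
    proof (rule that)
      show "val (middle_tm a M F G) = (Q, (?V, L), (U, ?W))"
        by (simp add: middle_tm_def FG RArr m1(1) m2(1) v)
      show "edge_in d d' (a, Q)"
        using Q by (simp add: edge_in_def RArr)
      show "triangular_factor (\<ge>) d (?V, L)" "triangular_factor (\<le>) d' (U, ?W)"
        by (fact iL iU)+
      show "intertwines a M (fst (mul_factor F (?V, L))) (fst (mul_factor G (U, ?W)))
        (mat_of_sparse Q)"
        using cancel_outer_factors[OF Y(1,2) M X(1) U(1) mat_of_sparse_carrier[OF Q] L(1) inv(1)
          Y(3) inv(2) e]
        by (simp add: intertwines_def RArr mul_factor_def FG)
      show "time (middle_tm a M F G) \<le> 163 * w ^ 3"
        using m1(2)[OF w(2,2,1,3)] m2(2)[OF w(2,1,1,3)] t iL(3) iU(3)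
        by (simp add: middle_tm_def FG RArr m1(1) m2(1) v)
    qed
  qed
qed

text \<open>The invariant of the recursion.\<close>

definition segment_in_form ::
  "(nat \<Rightarrow> nat) \<Rightarrow> form \<Rightarrow> nat \<Rightarrow> (arrow \<times> 'a::field mat) list \<Rightarrow> 'a segment \<Rightarrow> bool" where
  "segment_in_form dims form lo Ms = (\<lambda>(es, X, Y).
     fits dims lo es \<and> (\<forall>e\<in>set es. has_shape form e) \<and> transforms dims lo Ms X Y (mats es))"

text \<open>
  On the left of the middle edge, the changes of basis to be composed are the one of the recursive
  call, the passing of \<open>G\<close>, and for leftward form a permutation sweep; the right side is symmetric.
  The sweep starts with the identity permutation at the vertex where the middle edge meets the half
  that is already in the requested form. So it leaves the factor at this vertex alone, and the two
  parts can be glued there.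
\<close>

lemma conquer:
  fixes A :: "nat \<Rightarrow> 'a::field mat"
  assumes left: "segment_in_form dims Rightward lo Ms S" and right: "segment_in_form dims Leftward
    (Suc m) Ms' S'"
    and m: "m = lo + length Ms" and M: "edge_mat (dir m) (dims m) (dims (Suc m)) (A m)"
    and dims: "\<And>i. lo \<le> i \<Longrightarrow> i \<le> Suc m + length Ms' \<Longrightarrow> dims i \<le> w" and w: "1 \<le> w"
  shows "segment_in_form dims form lo (Ms @ (dir m, A m) # Ms') (val (conquer_tm form dir dims A m S
    S'))"
    and "time (conquer_tm form dir dims A m S S') \<le>
      82 * w * Suc (length Ms + length Ms') + 250 * w ^ 3"
proof -
  let ?p = "conquer_tm form dir dims A m S S'" and ?Ms = "Ms @ (dir m, A m) # Ms'"
  obtain es XL XM where S: "S = (es, XL, XM)"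
    by (cases S)
  obtain es' YM YR where S': "S' = (es', YM, YR)"
    by (cases S')
  define hi where "hi = Suc m + length Ms'"
  from left have fl: "fits dims lo es" and sl: "\<And>e. e \<in> set es \<Longrightarrow> has_shape Rightward e"
    and tl: "transforms dims lo Ms XL XM (mats es)"
    by (auto simp: segment_in_form_def S)
  from right have fr: "fits dims (Suc m) es'" and sr: "\<And>e. e \<in> set es' \<Longrightarrow> has_shape Leftward e"
    and tr: "transforms dims (Suc m) Ms' YM YR (mats es')"
    by (auto simp: segment_in_form_def S')
  have len: "length es = length Ms" "length es' = length Ms'"
    using transforms_end[OF tl] transforms_end[OF tr] by auto
  have f: "factor_at (dims lo) XL" "factor_at (dims m) XM"
      "factor_at (dims (Suc m)) YM" "factor_at (dims hi) YR"
    using transforms_start[OF tl] transforms_end[OF tl] transforms_start[OF tr] transforms_end[OF tr]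
    by (auto simp: m hi_def)
  have dw: "dims lo \<le> w" "dims m \<le> w" "dims (Suc m) \<le> w" "dims hi \<le> w"
    by (auto simp: m hi_def intro: dims)
  obtain Q G H where vm: "val (middle_tm (dir m) (A m) XM YM) = (Q, G, H)"
    and Q: "edge_in (dims m) (dims (Suc m)) (dir m, Q)"
    and G: "triangular_factor (\<ge>) (dims m) G" and H: "triangular_factor (\<le>) (dims (Suc m)) H"
    and i: "intertwines (dir m) (A m) (fst (mul_factor XM G)) (fst (mul_factor YM H))
      (mat_of_sparse Q)"
    and tm: "time (middle_tm (dir m) (A m) XM YM) \<le> 163 * w ^ 3"
    using middle[OF M f(2,3) dw(2,3) w] by metis
  define I I' where "I = val (id_sparse_tm (dims m))" and "I' = val (id_sparse_tm (dims (Suc m)))"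
  have fG: "factor_at (dims m) G" and fH: "factor_at (dims (Suc m)) H"
    using G H by (auto simp: triangular_factor_def)
  have lG: "lift_factor I G = G" and lH: "lift_factor I' H = H"
    using lift_factor_id[OF fG] lift_factor_id[OF fH] by (simp_all add: I_def I'_def)
  define P where "P = val (pass_left_tm es I)"
  define R where "R = val (pass_right_tm es' I')"
  have P: "sparse_in (dims m) (dims lo) P" 
    "transforms dims lo (mats es) (lift_factor P G) G (mats es)"
    "time (pass_left_tm es I) \<le> 1 + 11 * (w * length Ms)"
    using pass_left[OF fl sl, where k = "dims m" and S = I and F = G and w = w] id_sparse(1) G dims w
    unfolding len lG m[symmetric] by (auto simp: P_def I_def)
  have R: "sparse_in (dims (Suc m)) (dims hi) R"
    "transforms dims (Suc m) (mats es') H (lift_factor R H) (mats es')"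
    "time (pass_right_tm es' I') \<le> 1 + 11 * (w * length Ms')"
    using pass_right[OF fr sr, where k = "dims (Suc m)" and S = I' and F = H and w = w] id_sparse(1)
      H dims w m
    unfolding len lH hi_def[symmetric] by (auto simp: R_def I'_def)
  define XL' where "XL' = mul_factor XL (lift_factor P G)"
  define YR' where "YR' = mul_factor YR (lift_factor R H)"
  have fP: "factor_at (dims lo) (lift_factor P G)" and fR: "factor_at (dims hi) (lift_factor R H)"
    using transforms_start[OF P(2)] transforms_end[OF R(2)] by (simp_all add: len hi_def)
  have fX: "factor_at (dims lo) XL'" and fY: "factor_at (dims hi) YR'"
    unfolding XL'_def YR'_def by (rule factor_at_mul[OF f(1) fP], rule factor_at_mul[OF f(4) fR])
  have TL: "transforms dims lo Ms XL' (mul_factor XM G) (mats es)"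
    unfolding XL'_def by (rule transforms_trans[OF tl P(2)])
  have TR: "transforms dims (Suc m) Ms' (mul_factor YM H) YR' (mats es')"
    unfolding YR'_def by (rule transforms_trans[OF tr R(2)])
  have TM: "transforms dims m ((dir m, A m) # Ms') (mul_factor XM G) YR' ((dir m, mat_of_sparse Q) #
    mats es')"
    using factor_at_mul[OF f(2) fG] M edge_mat_of_sparse[OF Q] i TR by (rule transforms.Cons)
  have fits': "fits dims m ((dir m, Q) # es')"
    using Q fr by simp
  have idI: "perm_factor I = (1\<^sub>m (dims m), 1\<^sub>m (dims m) :: 'a mat)"
    "perm_factor I' = (1\<^sub>m (dims (Suc m)), 1\<^sub>m (dims (Suc m)) :: 'a mat)"
    by (simp_all add: perm_factor_def I_def I'_def id_sparse(3))
  have permI: "perm_sparse (dims m) I" "perm_sparse (dims (Suc m)) I'"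
    by (simp_all add: I_def I'_def perm_sparse_id)
  have pow: "1 \<le> w ^ 3" "w \<le> w ^ 3" "w ^ 2 \<le> w ^ 3"
    using w power_increasing[of 1 3 w] by (simp_all add: power_increasing)
  note mX = mul_factor_tm[OF f(1) fP, folded XL'_def] and mY = mul_factor_tm[OF f(4) fR, folded
    YR'_def]
  note times = tm time_id_sparse[of "dims m"] time_id_sparse[of "dims (Suc m)"] P(3) R(3)
    time_lift_factor_tm[OF P(1) dw(1) w, of G] time_lift_factor_tm[OF R(1) dw(4) w, of H]
    mX(2)[OF dw(1) w] mY(2)[OF dw(4) w]
  define outer where "outer = time (middle_tm (dir m) (A m) XM YM) +
    time (id_sparse_tm (dims m)) + time (id_sparse_tm (dims (Suc m))) +
    time (pass_left_tm es I) + time (pass_right_tm es' I') +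
    time (lift_factor_tm P G) + time (lift_factor_tm R H) +
    time (mul_factor_tm XL (lift_factor P G)) + time (mul_factor_tm YR (lift_factor R H))"
  have bound: "length Ms \<le> w * length Ms" "length Ms' \<le> w * length Ms'"
    using w by simp_all
  have distrib: "82 * w * Suc (length Ms + length Ms') =
      82 * w + 82 * (w * length Ms) + 82 * (w * length Ms')"
    by (simp add: algebra_simps)
  have goal: "segment_in_form dims form lo ?Ms (val ?p) \<and>
    time ?p \<le> 82 * w * Suc (length Ms + length Ms') + 250 * w ^ 3"
  proof (cases form)
    case Rightward
    have dm: "dims i \<le> w" if "m \<le> i" "i \<le> m + length ((dir m, Q) # es')" for i
      using that by (intro dims) (auto simp: m len)
    obtain es2 Z where vs: "val (sweep_right_tm ((dir m, Q) # es') I) = (es2, Z)"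
      and es2: "fits dims m es2" "\<And>e. e \<in> set es2 \<Longrightarrow> has_shape Rightward e"
      and Z: "perm_sparse (dims (m + length ((dir m, Q) # es'))) Z"
      and ts: "transforms dims m (mats ((dir m, Q) # es')) (perm_factor I) (perm_factor Z :: 'a
        factor) (mats es2)"
      and tms: "time (sweep_right_tm ((dir m, Q) # es') I) \<le> 1 + 69 * w * length ((dir m, Q) # es')"
      by (rule sweep_right[OF fits' permI(1) _ w, where 'a = 'a]) ((rule dm; assumption),
        (rule that; blast))
    have Z: "perm_sparse (dims hi) Z"
      using Z by (simp add: len hi_def)
    note mZ = mul_factor_perm_tm[OF fY Z]
    have v: "val ?p = (es @ es2, XL', mul_factor YR' (perm_factor Z))"
      by (simp add: conquer_tm_def S S' vm I_def[symmetric] I'_def[symmetric] P_def[symmetric]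
        R_def[symmetric]
          mX(1) mY(1) Rightward vs mZ(1) append_tm del: sweep_right_tm.simps)
    have "transforms dims m ((dir m, A m) # Ms') (mul_factor XM G) (mul_factor YR' (perm_factor Z))
      (mats es2)"
      using transforms_trans[OF TM ts[unfolded mats_simps]] mul_factor_one[OF factor_at_mul[OF f(2)
        fG]]
      by (simp add: idI)
    then have "transforms dims lo ?Ms XL' (mul_factor YR' (perm_factor Z))
        (mats es @ mats es2)"
      using transforms_append[OF TL] by (simp add: m)
    then have "segment_in_form dims form lo ?Ms (val ?p)"
      unfolding v segment_in_form_def using fl sl es2 by (auto simp: fits_append len m Rightward)
    moreover have "time ?p \<le>
        82 * w * Suc (length Ms + length Ms') + 250 * w ^ 3"
    proof -
      have "time ?p = 6 + length Ms + outer +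
          time (sweep_right_tm ((dir m, Q) # es') I) + time (mul_factor_perm_tm YR' Z)"
        by (simp add: conquer_tm_def S S' vm I_def[symmetric] I'_def[symmetric] P_def[symmetric]
            R_def[symmetric] mX(1) mY(1) Rightward vs append_tm len outer_def
              del: sweep_right_tm.simps)
      moreover have "time (sweep_right_tm ((dir m, Q) # es') I) \<le> 1 + 69 * w + 69 * (w * length Ms')"
        using tms by (simp add: len algebra_simps del: sweep_right_tm.simps)
      ultimately show ?thesis
        using times mZ(2)[OF dw(4) w] pow dw bound unfolding distrib outer_def by linarith
    qed
    ultimately show ?thesis
      by blast
  next
    case Leftward
    have fits': "fits dims lo (es @ [(dir m, Q)])"
      using fl Q by (simp add: fits_append len m)
    have last: "lo + length (es @ [(dir m, Q)]) = Suc m"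
      by (simp add: len m)
    have dm: "dims i \<le> w" if "lo \<le> i" "i \<le> lo + length (es @ [(dir m, Q)])" for i
      using that by (intro dims) (auto simp: m len)
    obtain es2 Z where vs: "val (sweep_left_tm (es @ [(dir m, Q)]) I') = (es2, Z)"
      and es2: "fits dims lo es2" "\<And>e. e \<in> set es2 \<Longrightarrow> has_shape Leftward e"
      and Z: "perm_sparse (dims lo) Z"
      and ts: "transforms dims lo (mats (es @ [(dir m, Q)])) (perm_factor Z) (perm_factor I' :: 'a
        factor) (mats es2)"
      and tms: "time (sweep_left_tm (es @ [(dir m, Q)]) I') \<le> 1 + 69 * w * length (es @ [(dir m, Q)])"
      by (rule sweep_left[OF fits' permI(2)[folded last] _ w, where 'a = 'a]) ((rule dm;
        assumption), (rule that; blast))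
    note mZ = mul_factor_perm_tm[OF fX Z]
    have v: "val ?p = (es2 @ es', mul_factor XL' (perm_factor Z), YR')"
      by (simp add: conquer_tm_def S S' vm I_def[symmetric] I'_def[symmetric] P_def[symmetric]
        R_def[symmetric]
          mX(1) mY(1) Leftward vs mZ(1) append_tm del: sweep_left_tm.simps)
    have fH': "factor_at (dims (Suc m)) (mul_factor YM H)"
      by (rule factor_at_mul[OF f(3) fH])
    have "transforms dims m [(dir m, A m)] (mul_factor XM G) (mul_factor YM H)
      [(dir m, mat_of_sparse Q)]"
      using factor_at_mul[OF f(2) fG] M edge_mat_of_sparse[OF Q] i transforms.Nil[where dims = dims
        and lo = "Suc m", OF fH']
      by (rule transforms.Cons)
    then have "transforms dims lo (Ms @ [(dir m, A m)]) XL' (mul_factor YM H)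
      (mats (es @ [(dir m, Q)]))"
      using transforms_append[OF TL] by (simp add: m)
    then have T2: "transforms dims lo (Ms @ [(dir m, A m)]) (mul_factor XL' (perm_factor Z))
      (mul_factor YM H) (mats es2)"
      using transforms_trans[OF _ ts] mul_factor_one[OF fH'] by (fastforce simp: idI)
    have len2: "length es2 = Suc (length Ms)"
      using transforms_end[OF ts] by (simp add: len)
    have "transforms dims lo ?Ms (mul_factor XL' (perm_factor Z)) YR' (mats es2 @ mats es')"
      using transforms_append[OF T2] TR by (simp add: m)
    then have "segment_in_form dims form lo ?Ms (val ?p)"
      unfolding v segment_in_form_def using fr sr es2 by (auto simp: fits_append len2 m Leftward)
    moreover have "time ?p \<le>
        82 * w * Suc (length Ms + length Ms') + 250 * w ^ 3"
    proof -
      have "time ?p = 8 + 2 * length Ms + outer +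
          time (sweep_left_tm (es @ [(dir m, Q)]) I') + time (mul_factor_perm_tm XL' Z)"
        by (simp add: conquer_tm_def S S' vm I_def[symmetric] I'_def[symmetric] P_def[symmetric]
            R_def[symmetric] mX(1) mY(1) Leftward vs append_tm len len2 outer_def)
      moreover have "time (sweep_left_tm (es @ [(dir m, Q)]) I') \<le> 1 + 69 * w + 69 * (w * length Ms)"
        using tms by (simp add: len algebra_simps)
      ultimately show ?thesis
        using times mZ(2)[OF dw(1) w] pow dw bound unfolding distrib outer_def by linarith
    qed
    ultimately show ?thesis
      by blast
  qed
  show "segment_in_form dims form lo ?Ms (val ?p)"
    and "time ?p \<le>
      82 * w * Suc (length Ms + length Ms') + 250 * w ^ 3"
    using goal by auto
qed

section \<open>The recursion\<close>

abbreviation input_edges :: "(nat \<Rightarrow> arrow) \<Rightarrow> (nat \<Rightarrow> 'a mat) \<Rightarrow> nat \<Rightarrow> nat \<Rightarrow> (arrow \<times> 'a mat) list" where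
  "input_edges dir A lo hi \<equiv> map (\<lambda>i. (dir i, A i)) [lo..<hi]"

lemma divide_conquer_zero:
  fixes A :: "nat \<Rightarrow> 'a::field mat"
  assumes "dims lo \<le> w" "1 \<le> w"
  shows "segment_in_form dims form lo [] (val (divide_conquer_tm form dir dims A lo 0))"
    and "time (divide_conquer_tm form dir dims A lo 0) \<le> 6 * w ^ 3"
proof -
  have "factor_at (dims lo) (1\<^sub>m (dims lo), 1\<^sub>m (dims lo) :: 'a mat)"
    by (intro factor_atI) auto
  then show "segment_in_form dims form lo [] (val (divide_conquer_tm form dir dims A lo 0))"
    by (subst divide_conquer_tm.simps) (auto simp: segment_in_form_def id_mat(1)
      intro: transforms.Nil)
  have "time (divide_conquer_tm form dir dims A lo 0) = 2 + time (id_mat_tm (dims lo) :: 'a mat tm)"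
    by (subst divide_conquer_tm.simps) simp
  moreover have "1 \<le> w ^ 3" "w ^ 2 \<le> w ^ 3"
    using assms(2) by (simp_all add: power_increasing)
  ultimately show "time (divide_conquer_tm form dir dims A lo 0) \<le> 6 * w ^ 3"
    using id_mat(2)[OF assms, where 'a = 'a] by linarith
qed

text \<open>
  Each half has at most \<open>k div 2\<close> edges, so the linear term of the slower one is at most \<open>82 w k\<close>; the
  combination step adds \<open>82 w k\<close> more, which gives \<open>164 w k\<close> again. Each of the \<open>j + 1\<close> possible levels
  contributes one cubic term, whose constant also pays for the index arithmetic of the recursion.
\<close>

lemma divide_conquer:
  fixes A :: "nat \<Rightarrow> 'a::field mat"
  assumes "k < 2 ^ j"
    and "\<And>i. lo \<le> i \<Longrightarrow> i < lo + k \<Longrightarrow> edge_mat (dir i) (dims i) (dims (Suc i)) (A i)"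
    and "\<And>i. lo \<le> i \<Longrightarrow> i \<le> lo + k \<Longrightarrow> dims i \<le> w" "1 \<le> w"
  shows "segment_in_form dims form lo (input_edges dir A lo (lo + k))
      (val (divide_conquer_tm form dir dims A lo k)) \<and>
    time (divide_conquer_tm form dir dims A lo k) \<le> 164 * w * k + 257 * w ^ 3 * Suc j"
  using assms
proof (induction j arbitrary: form lo k)
  case (0 form lo k)
  then show ?case
    using divide_conquer_zero[of dims lo w form dir A] by simp
next
  case (Suc j form lo k)
  have pow: "1 \<le> w ^ 3" "w ^ 2 \<le> w ^ 3"
    using \<open>1 \<le> w\<close> by (simp_all add: power_increasing)
  show ?case
  proof (cases "k = 0")
    case True
    then show ?thesis
      using divide_conquer_zero[of dims lo w form dir A] Suc.prems pow by simp
  next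
    case False
    define h where "h = k div 2"
    define r where "r = k - h - 1"
    define m where "m = lo + h"
    have k: "k = Suc (h + r)" "h < 2 ^ j" "r < 2 ^ j" "2 * h \<le> k" "2 * r \<le> k"
      using False Suc.prems(1) by (auto simp: h_def r_def)
    define left where "left = divide_conquer_tm Rightward dir dims A lo h"
    define right where "right = divide_conquer_tm Leftward dir dims A (Suc m) r"
    have l: "segment_in_form dims Rightward lo (input_edges dir A lo (lo + h)) (val left)"
      "time left \<le> 164 * w * h + 257 * w ^ 3 * Suc j"
      unfolding left_def using Suc.IH[of h lo Rightward] Suc.prems k by auto
    have r: "segment_in_form dims Leftward (Suc m) (input_edges dir A (Suc m) (Suc m + r))
      (val right)"
      "time right \<le> 164 * w * r + 257 * w ^ 3 * Suc j"
      unfolding right_def using Suc.IH[of r "Suc m" Leftward] Suc.prems k by (auto simp: m_def)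
    have M: "edge_mat (dir m) (dims m) (dims (Suc m)) (A m)"
      using Suc.prems(2) k by (simp add: m_def)
    have prog: "val (divide_conquer_tm form dir dims A lo k) =
        val (conquer_tm form dir dims A m (val left) (val right))"
      "time (divide_conquer_tm form dir dims A lo k) =
        7 + max (time left) (time right) + time (conquer_tm form dir dims A m (val left) (val right))"
      by (subst divide_conquer_tm.simps;
          use False in \<open>simp add: left_def right_def m_def r_def h_def\<close>)+
    have "[lo..<lo + k] = [lo..<m] @ m # [Suc m..<Suc m + r]"
      using upt_add_eq_append[of lo m "Suc r"] upt_conv_Cons[of m "m + Suc r"] k by (simp add: m_def
        add.assoc)
    then have list: "input_edges dir A lo (lo + k) =
        input_edges dir A lo (lo + h) @ (dir m, A m) # input_edges dir A (Suc m) (Suc m + r)"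
      by (simp add: m_def)
    have m: "m = lo + length (input_edges dir A lo (lo + h))"
      by (simp add: m_def)
    have dims: "dims i \<le> w" if "lo \<le> i" "i \<le> Suc m + length (input_edges dir A (Suc m) (Suc m + r))"
      for i
      using that k(1) by (intro Suc.prems(3)) (simp_all add: m_def del: upt_Suc)
    note conquer' = conquer[where dims = dims and dir = dir and A = A and w = w and m = m and form
      = form,
        OF l(1) r(1) m M _ \<open>1 \<le> w\<close>]
    have seg: "segment_in_form dims form lo (input_edges dir A lo (lo + k))
        (val (divide_conquer_tm form dir dims A lo k))"
      unfolding list prog(1) using dims by (rule conquer'(1))
    have "time (conquer_tm form dir dims A m (val left) (val right)) \<le>
        82 * w * Suc (length (input_edges dir A lo (lo + h)) +
          length (input_edges dir A (Suc m) (Suc m + r))) + 250 * w ^ 3"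
      using dims by (rule conquer'(2))
    then have t: "time (conquer_tm form dir dims A m (val left) (val right)) \<le> 82 * w * k +
      250 * w ^ 3"
      using k(1) by (simp del: upt_Suc)
    have "164 * w * h \<le> 82 * w * k" "164 * w * r \<le> 82 * w * k"
      using mult_le_mono2[OF k(4), of "82 * w"] mult_le_mono2[OF k(5), of "82 * w"] by simp_all
    then have "max (time left) (time right) \<le> 82 * w * k + 257 * w ^ 3 * Suc j"
      using l(2) r(2) by linarith
    with t have "time (divide_conquer_tm form dir dims A lo k) \<le> 164 * w * k + 257 * w ^ 3 * Suc
      (Suc j)"
    proof -
      have "164 * w * k = 82 * w * k + 82 * w * k"
        "257 * w ^ 3 * Suc (Suc j) = 257 * w ^ 3 * Suc j + 257 * w ^ 3"
        by simp_all
      with t \<open>max (time left) (time right) \<le> _\<close> show ?thesis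
        unfolding prog(2) using pow(1) by linarith
    qed
    then show ?thesis
      using seg by simp
  qed
qed

section \<open>The barcode form and the time bound\<close>

lemma transforms_components:
  assumes "transforms dims lo Ms X Y Ns"
  shows "\<exists>g. g 0 = X \<and> (\<forall>i\<le>length Ms. factor_at (dims (lo + i)) (g i)) \<and>
    (\<forall>i<length Ms. edge_mat (fst (Ms ! i)) (dims (lo + i)) (dims (Suc (lo + i))) (snd (Ms ! i)) \<and>
       edge_mat (fst (Ms ! i)) (dims (lo + i)) (dims (Suc (lo + i))) (snd (Ns ! i)) \<and>
       intertwines (fst (Ms ! i)) (snd (Ms ! i)) (fst (g i)) (fst (g (Suc i))) (snd (Ns ! i)))"
  using assms
proof (induction rule: transforms.induct)
  case (Nil lo X)
  then show ?case
    by (intro exI[of _ "\<lambda>_. X"]) simp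
next
  case (Cons lo X a M N Y Ms Z Ns)
  then obtain g where g: "g 0 = Y" "\<And>i. i \<le> length Ms \<Longrightarrow> factor_at (dims (Suc lo + i)) (g i)"
    "\<And>i. i < length Ms \<Longrightarrow>
      edge_mat (fst (Ms ! i)) (dims (Suc lo + i)) (dims (Suc (Suc lo + i))) (snd (Ms ! i)) \<and>
      edge_mat (fst (Ms ! i)) (dims (Suc lo + i)) (dims (Suc (Suc lo + i))) (snd (Ns ! i)) \<and>
      intertwines (fst (Ms ! i)) (snd (Ms ! i)) (fst (g i)) (fst (g (Suc i))) (snd (Ns ! i))"
    by blast
  show ?case
    by (rule exI[of _ "case_nat X g"])
      (use Cons.hyps g in \<open>auto simp: nth_Cons split: nat.split\<close>)
qed

text \<open>
  Factors turn new coordinates into old ones, whereas an isomorphism of representations goes from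
  the old to the new representation. It is given by the inverses.
\<close>

lemma intertwines_inverse:
  assumes "edge_mat a d d' M" "edge_mat a d d' N" "factor_at d F" "factor_at d' G"
    and "intertwines a M (fst F) (fst G) N"
  shows "case a of LArr \<Rightarrow> N * snd G = snd F * M | RArr \<Rightarrow> N * snd F = snd G * M"
proof -
  have *: "N * W = V * M"
    if M: "M \<in> carrier_mat r c" and N: "N \<in> carrier_mat r c" and X: "X \<in> carrier_mat r r"
      "V \<in> carrier_mat r r"
      and Y: "Y \<in> carrier_mat c c" "W \<in> carrier_mat c c" and inv: "V * X = 1\<^sub>m r" "Y * W = 1\<^sub>m c"
      and e: "M * Y = X * N" for M N X Y V W :: "'a mat" and r c
  proof -
    have "V * M = V * (M * (Y * W))"
      using M inv(2) by simp
    also have "M * (Y * W) = X * (N * W)"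
      using assoc_mult_mat[OF M Y] assoc_mult_mat[OF X(1) N Y(2)] e by simp
    also have "V * (X * (N * W)) = N * W"
      using assoc_mult_mat[OF X(2,1) mult_carrier_mat[OF N Y(2)]] inv(1)
        left_mult_one_mat[OF mult_carrier_mat[OF N Y(2)]] by simp
    finally show ?thesis ..
  qed
  show ?thesis
    using assms *[of M d d' N "fst F" "snd F" "fst G" "snd G"] *[of M d' d N "fst G" "snd G" "fst
      F" "snd F"]
    by (cases a) (auto simp: edge_mat_def factor_at_def intertwines_def)
qed

lemma barcode_form_of_segment:
  fixes A :: "nat \<Rightarrow> 'a::field mat"
  assumes "segment_in_form dims form 0 (input_edges dir A 0 n) (es, X, Y)"
  shows "is_barcode_form n dir dims A (rep_of_edges es)"
proof -
  define Ms where "Ms = input_edges dir A 0 n"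
  from assms have fits: "fits dims 0 es" and tr: "transforms dims 0 Ms X Y (mats es)"
    by (auto simp: segment_in_form_def Ms_def)
  have Ms: "length Ms = n" "\<And>i. i < n \<Longrightarrow> Ms ! i = (dir i, A i)"
    by (simp_all add: Ms_def)
  have len: "length es = n"
    using transforms_end[OF tr] Ms by simp
  have snd_mats: "snd (mats es ! i) = rep_of_edges es i" if "i < n" for i
    using that len by (simp add: mats_def rep_of_edges_def split: prod.split)
  obtain g where g: "\<forall>i\<le>n. factor_at (dims i) (g i)"
    "\<forall>i<n. edge_mat (dir i) (dims i) (dims (Suc i)) (A i) \<and>
      edge_mat (dir i) (dims i) (dims (Suc i)) (rep_of_edges es i :: 'a mat) \<and>
      intertwines (dir i) (A i) (fst (g i)) (fst (g (Suc i))) (rep_of_edges es i)"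
    using transforms_components[OF tr] by (auto simp: Ms snd_mats)
  have "is_rep n dir dims (rep_of_edges es :: nat \<Rightarrow> 'a mat)"
    using g(2) unfolding is_rep_def edge_mat_def Suc_eq_plus1 by blast
  moreover have "isomorphic_reps n dir dims A (rep_of_edges es)"
    unfolding isomorphic_reps_def
  proof (rule exI[of _ "\<lambda>i. snd (g i)"], intro conjI allI impI)
    fix i assume "i \<le> n"
    then have "factor_at (dims i) (g i)"
      using g by blast
    then show "snd (g i) \<in> carrier_mat (dims i) (dims i)" "invertible_mat (snd (g i))"
      by (auto simp: factor_at_def invertible_mat_def inverts_mat_def)
  next
    fix i assume i: "i < n"
    show "case dir i of
        LArr \<Rightarrow> rep_of_edges es i * snd (g (i + 1)) = snd (g i) * A i
      | RArr \<Rightarrow> rep_of_edges es i * snd (g i) = snd (g (i + 1)) * A i"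
      using intertwines_inverse[of "dir i" "dims i" "dims (Suc i)" "A i" "rep_of_edges es i" "g
        i" "g (Suc i)"]
        g i by (simp split: arrow.splits)
  qed
  moreover have "pivot_matrix (rep_of_edges es i :: 'a mat)" if "i < n" for i
  proof -
    have "\<exists>r c. sparse_in r c (snd (es ! i))" if "fits dims lo es" "i < length es" for lo i and es
      :: "edge list"
      using that by (induction es arbitrary: lo i)
        (force simp: edge_in_def nth_Cons split: arrow.splits nat.split)+
    then show ?thesis
      using fits that len pivot_mat_of_sparse unfolding rep_of_edges_def by blast
  qed
  ultimately show ?thesis
    by (simp add: is_barcode_form_def)
qed

text \<open>
  For \<open>2\<^sup>l \<le> n < 2\<^bsup>l+1\<^esup>\<close> with \<open>l \<ge> 1\<close>, the number \<open>l + 2\<close> of levels is at most \<open>3 l \<le> 3 log\<^sub>2 n\<close>; and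
  \<open>1 \<le> log\<^sub>2 d\<close>. The constant is \<open>935 = 164 + 3 \<cdot> 257\<close>.
\<close>

lemma time_bound_logarithmic:
  fixes n d t :: nat
  assumes "2 \<le> n" "2 \<le> d" and t: "\<And>j. n < 2 ^ j \<Longrightarrow> t \<le> 164 * d * n + 257 * d ^ 3 * Suc j"
  shows "real t \<le> 935 / ln 2 * ((d * ln d) * n + d ^ 3 * ln n)"
proof -
  obtain l where l: "2 ^ l \<le> n" "n < 2 ^ (l + 1)"
    using ex_power_ivl1[of 2 n] assms(1) by auto
  have "l \<noteq> 0"
    using l assms(1) by (intro notI) simp
  have "real l * ln 2 \<le> ln n"
  proof -
    have "real (2 ^ l) \<le> real n"
      using l(1) by (rule of_nat_mono)
    then have "ln (2 ^ l) \<le> ln (real n)"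
      by (intro ln_mono) auto
    then show ?thesis
      by (simp add: ln_realpow)
  qed
  then have log_n: "real l \<le> ln n / ln 2"
    by (simp add: field_simps)
  have log_d: "1 \<le> ln d / ln 2"
    using assms(2) by simp
  have "Suc (l + 1) \<le> 3 * l"
    using \<open>l \<noteq> 0\<close> by linarith
  then have "t \<le> 164 * d * n + 257 * d ^ 3 * (3 * l)"
    using t[OF l(2)] by (meson add_left_mono le_trans mult_le_mono2)
  then have "real t \<le> real (164 * d * n + 257 * d ^ 3 * (3 * l))"
    by (rule of_nat_mono)
  also have "\<dots> = 164 * (real d * n) * 1 + 771 * real d ^ 3 * l"
    by simp
  also have "\<dots> \<le> 164 * (real d * n) * (ln d / ln 2) + 771 * real d ^ 3 * (ln n / ln 2)"
    by (intro add_mono mult_left_mono log_n log_d) auto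
  also have "\<dots> \<le> 935 * (real d * n) * (ln d / ln 2) + 935 * real d ^ 3 * (ln n / ln 2)"
    using assms by (intro add_mono mult_right_mono) auto
  also have "\<dots> = 935 / ln 2 * ((d * ln d) * n + d ^ 3 * ln n)"
    by (simp add: field_simps)
  finally show ?thesis .
qed

theorem proposition16:
  "\<exists>C::real. \<forall>(form::form) (n::nat) (dir :: nat \<Rightarrow> arrow) (dims :: nat \<Rightarrow> nat) (A :: nat \<Rightarrow> 'a::field mat) (d::nat).
     is_rep n dir dims A \<longrightarrow> d = Max (dims ` {0..n}) \<longrightarrow>
       is_barcode_form n dir dims A (rep_of_edges (val (barcode_tm form n dir dims A))) \<and>
       (2 \<le> n \<longrightarrow> 2 \<le> d \<longrightarrow>
          real (time (barcode_tm form n dir dims A)) \<le> C * ((d * ln d) * n + d ^ 3 * ln n))"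
proof (rule exI[of _ "935 / ln 2"], intro allI impI)
  fix form n dir dims and A :: "nat \<Rightarrow> 'a mat" and d
  assume rep: "is_rep n dir dims A" and d: "d = Max (dims ` {0..n})"
  have edges: "edge_mat (dir i) (dims i) (dims (Suc i)) (A i)" if "i < n" for i
    using rep that unfolding is_rep_def edge_mat_def Suc_eq_plus1 by blast
  have dims: "dims i \<le> d" if "i \<le> n" for i
    unfolding d using that by (intro Max_ge) auto
  obtain es X Y where v: "val (divide_conquer_tm form dir dims A 0 n) = (es, X, Y)"
    by (cases "val (divide_conquer_tm form dir dims A 0 n)")
  have p: "val (barcode_tm form n dir dims A) = es"
    "time (barcode_tm form n dir dims A) = time (divide_conquer_tm form dir dims A 0 n)"
    by (simp_all add: barcode_tm_def v)
  have "segment_in_form dims form 0 (input_edges dir A 0 n) (es, X, Y)"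
    (* All spaces may be zero, but the dimension bound has to be positive. *)
    using divide_conquer[of n n 0 dir dims A "max 1 d" form] edges dims
    by (simp add: v less_exp le_max_iff_disj)
  then have "is_barcode_form n dir dims A (rep_of_edges es)"
    by (rule barcode_form_of_segment)
  moreover have "real (time (divide_conquer_tm form dir dims A 0 n)) \<le>
      935 / ln 2 * ((d * ln d) * n + d ^ 3 * ln n)" if "2 \<le> n" "2 \<le> d"
    using divide_conquer[of n _ 0 dir dims A d form] edges dims that
    by (intro time_bound_logarithmic) auto
  ultimately show "is_barcode_form n dir dims A (rep_of_edges (val (barcode_tm form n dir dims A))) \<and>
      (2 \<le> n \<longrightarrow> 2 \<le> d \<longrightarrow>
        real (time (barcode_tm form n dir dims A)) \<le> 935 / ln 2 * ((d * ln d) * n + d ^ 3 * ln n))"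
    by (simp add: p)
qed

end
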